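(* Let $p$ and $q$ be irreducible monic polynomials with degree $2$ over $\mathbb{F}$, and assume that they have the same splitting field $\mathbb{L}$ (in $\overline{\mathbb{F}}$). Assume further that $q$ is not homothetic to $p$ over $\mathbb{F}$ and that $p$ is separable, and set $\delta:=p(0)q(0)^{-1}$. Denote by $x_1,x_2$ (respectively, by $y_1,y_2$) the roots of $p$ (respectively, of $q$) in $\mathbb{L}$. Let $u$ be an endomorphism of a finite-dimensional vector space $V$ over $\mathbb{F}$. Then, the following conditions are equivalent: (i) $u$ is a q-exceptional $(p,q)$-quotient. (ii) The minimal polynomial of $u$ is the product of a power of $t^2-\operatorname{Tr}_{\mathbb{L}/\mathbb{F}}(x_1y_1^{-1})\,t+\delta$ with a power of $t^2-\operatorname{Tr}_{\mathbb{L}/\mathbb{F}}(x_1y_2^{-1})\,t+\delta$. Moreover, the invariant factors of $u$ read $r_1,r_2,\dots,r_{2k-1},r_{2k},\dots$ where, for every positive integer $k$, there are integers $a$ and $b$ in $\{0,1\}$ such that $$r_{2k-1}=r_{2k}\times\bigl(t^2-\operatorname{Tr}_{\mathbb{L}/\mathbb{F}}(x_1y_1^{-1})\,t+\delta\bigr)^a\bigl(t^2-\operatorname{Tr}_{\mathbb{L}/\mathbb{F}}(x_1y_2^{-1})\,t+\delta\bigr)^b.$$ (iii) In some basis of $V$, the endomorphism $u$ is represented by a block-diagonal matrix in which every diagonal block equals $$C\bigl((t^2-\operatorname{Tr}_{\mathbb{L}/\mathbb{F}}(xy^{-1})\,t+\delta)^{k+\epsilon}\bigr)\oplus C\bigl((t^2-\operatorname{Tr}_{\mathbb{L}/\mathbb{F}}(\delta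 x^{-1}y)\,t+\delta)^k\bigr)$$ for some root $x$ of $p$, some root $y$ of $q$, some integer $k\geq 0$ and some $\epsilon\in\{0,1\}$.
   Context: $\mathbb{F}$ is an arbitrary field with algebraic closure $\overline{\mathbb{F}}$. $\operatorname{Root}(p)$ is the set of roots of $p$ in $\overline{\mathbb{F}}$. Two monic polynomials $p_1,p_2$ of degree $2$ in $\mathbb{F}[t]$ are homothetic over $\mathbb{F}$ if $p_2=d^{-2}p_1(dt)$ for some $d\in\mathbb{F}\setminus\{0\}$. $\operatorname{Tr}_{\mathbb{L}/\mathbb{F}}$ is the trace of the quadratic extension $\mathbb{L}/\mathbb{F}$. An endomorphism $u$ of $V$ is a $(p,q)$-quotient if $u=ab^{-1}$ for some automorphisms $a,b$ of $V$ with $p(a)=0$ and $q(b)=0$. It is q-exceptional with respect to $(p,q)$ if all its eigenvalues in $\overline{\mathbb{F}}$ belong to $\operatorname{Root}(p)\operatorname{Root}(q)^{-1}=\{xy^{-1}: x\in\operatorname{Root}(p),\,y\in\operatorname{Root}(q)\}$; a q-exceptional $(p,q)$-quotient is a $(p,q)$-quotient that is q-exceptional with respect to $(p,q)$. $C(r)$ is the companion matrix of the monic polynomial $r$ ($C(1)$ is the $0\times0$ matrix), and $\oplus$ is block-diagonal sum. The invariant factors of $u$ are the monic polynomials $r_1,r_2,\dots$ with $r_{i+1}\mid r_i$ such that $u$ is represented in some basis by $C(r_1)\oplus C(r_2)\oplus\cdots$; the finite list of nonconstant ones is extended to an infinite sequence by $r_i=1$. *)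

theory Defs
  imports
    "HOL-Algebra.Algebraic_Closure_Type"
    "HOL-Algebra.Generated_Fields"
    "Jordan_Normal_Form.Char_Poly"
begin

section \<open>Polynomials and their roots in the algebraic closure\<close>

definition Root :: "'a::field poly \<Rightarrow> 'a alg_closure set" where
  "Root p = {x. poly (map_poly to_ac p) x = 0}"

definition separable_poly :: "'a::field poly \<Rightarrow> bool" where
  "separable_poly p \<longleftrightarrow> rsquarefree (map_poly to_ac p)"

definition splitting_field :: "'a::field poly \<Rightarrow> 'a alg_closure set" where
  "splitting_field p = generate_field ring_of_type_algebra (range to_ac \<union> Root p)"

definition homothetic :: "'a::field poly \<Rightarrow> 'a poly \<Rightarrow> bool" where
  "homothetic p1 p2 \<longleftrightarrow> (\<exists>d. d \<noteq> 0 \<and> p2 = smult (inverse (d ^ 2)) (pcompose p1 [:0, d:]))"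

section \<open>Matrices of endomorphisms\<close>

text \<open>Vectors live in a type \<open>'v\<close> with scalar multiplication \<open>scale\<close>; the set \<open>W\<close> is a subspace.
  It is the whole type for the space \<open>V\<close>, and a subfield of the algebraic closure when traces
  of field extensions are formed. Bases are lists, i.e. ordered; coordinates are columns.\<close>

definition basis_of :: "('a::field \<Rightarrow> 'v::ab_group_add \<Rightarrow> 'v) \<Rightarrow> 'v set \<Rightarrow> 'v list \<Rightarrow> bool" where
  "basis_of scale W bs \<longleftrightarrow>
     distinct bs \<and> \<not> Modules.module.dependent scale (set bs) \<and> Modules.module.span scale (set bs) = W"

definition matrix_in_basis ::
  "('a::field \<Rightarrow> 'v::ab_group_add \<Rightarrow> 'v) \<Rightarrow> 'v list \<Rightarrow> ('v \<Rightarrow> 'v) \<Rightarrow> 'a mat \<Rightarrow> bool" where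
  "matrix_in_basis scale bs f A \<longleftrightarrow>
     A \<in> carrier_mat (length bs) (length bs) \<and>
     (\<forall>j<length bs. f (bs ! j) = (\<Sum>i<length bs. scale (A $$ (i, j)) (bs ! i)))"

definition represented_on ::
  "('a::field \<Rightarrow> 'v::ab_group_add \<Rightarrow> 'v) \<Rightarrow> 'v set \<Rightarrow> ('v \<Rightarrow> 'v) \<Rightarrow> 'a mat \<Rightarrow> bool" where
  "represented_on scale W f A \<longleftrightarrow> (\<exists>bs. basis_of scale W bs \<and> matrix_in_basis scale bs f A)"

abbreviation represented ::
  "('a::field \<Rightarrow> 'v::ab_group_add \<Rightarrow> 'v) \<Rightarrow> ('v \<Rightarrow> 'v) \<Rightarrow> 'a mat \<Rightarrow> bool" where
  "represented scale f A \<equiv> represented_on scale UNIV f A"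

definition mat_trace :: "'a::comm_monoid_add mat \<Rightarrow> 'a" where
  "mat_trace A = (\<Sum>i<dim_row A. A $$ (i, i))"

text \<open>The trace of \<open>z \<in> L\<close> over the base field is the trace of multiplication by \<open>z\<close>, viewed as an
  endomorphism of \<open>L\<close> as a vector space over the base field.\<close>

definition field_trace :: "'a::field alg_closure set \<Rightarrow> 'a alg_closure \<Rightarrow> 'a" where
  "field_trace L z =
     (THE c. \<exists>A. represented_on (\<lambda>a w. to_ac a * w) L (\<lambda>w. z * w) A \<and> c = mat_trace A)"

text \<open>The sign and transposition convention: subdiagonal of ones, last column of negated
  coefficients.\<close>

definition companion :: "'a::field poly \<Rightarrow> 'a mat" where
  "companion r = (let n = Polynomial.degree r in
     mat n n (\<lambda>(i, j). if j = n - 1 then - Polynomial.coeff r i else if i = j + 1 then 1 else 0))"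

section \<open>Polynomials in an endomorphism\<close>

definition poly_endo ::
  "('a::field \<Rightarrow> 'v::ab_group_add \<Rightarrow> 'v) \<Rightarrow> 'a poly \<Rightarrow> ('v \<Rightarrow> 'v) \<Rightarrow> 'v \<Rightarrow> 'v" where
  "poly_endo scale p f = (\<lambda>v. \<Sum>i\<le>Polynomial.degree p. scale (Polynomial.coeff p i) ((f ^^ i) v))"

definition annihilates ::
  "('a::field \<Rightarrow> 'v::ab_group_add \<Rightarrow> 'v) \<Rightarrow> 'a poly \<Rightarrow> ('v \<Rightarrow> 'v) \<Rightarrow> bool" where
  "annihilates scale p f \<longleftrightarrow> poly_endo scale p f = (\<lambda>v. 0)"

definition minimal_poly ::
  "('a::field \<Rightarrow> 'v::ab_group_add \<Rightarrow> 'v) \<Rightarrow> ('v \<Rightarrow> 'v) \<Rightarrow> 'a poly" where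
  "minimal_poly scale f =
     (THE m. lead_coeff m = 1 \<and> (\<forall>g. annihilates scale g f \<longleftrightarrow> m dvd g))"

text \<open>\<open>r i\<close> is the invariant factor usually written \<open>r\<^sub>i\<^sub>+\<^sub>1\<close>. Since \<open>C(1)\<close> is the \<open>0 \<times> 0\<close> matrix, the
  cut-off \<open>n\<close> may be any index beyond the nonconstant factors.\<close>

definition invariant_factors ::
  "('a::field \<Rightarrow> 'v::ab_group_add \<Rightarrow> 'v) \<Rightarrow> ('v \<Rightarrow> 'v) \<Rightarrow> (nat \<Rightarrow> 'a poly) \<Rightarrow> bool" where
  "invariant_factors scale f r \<longleftrightarrow>
     (\<forall>i. lead_coeff (r i) = 1) \<and> (\<forall>i. r (Suc i) dvd r i) \<and>
     (\<exists>n. (\<forall>i\<ge>n. r i = 1) \<and>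
          represented scale f (diag_block_mat (map (\<lambda>i. companion (r i)) [0..<n])))"

section \<open>Quotients\<close>

definition automorphism :: "('a::field \<Rightarrow> 'v::ab_group_add \<Rightarrow> 'v) \<Rightarrow> ('v \<Rightarrow> 'v) \<Rightarrow> bool" where
  "automorphism scale a \<longleftrightarrow> Vector_Spaces.linear scale scale a \<and> bij a"

definition pq_quotient ::
  "('a::field \<Rightarrow> 'v::ab_group_add \<Rightarrow> 'v) \<Rightarrow> 'a poly \<Rightarrow> 'a poly \<Rightarrow> ('v \<Rightarrow> 'v) \<Rightarrow> bool" where
  "pq_quotient scale p q u \<longleftrightarrow>
     (\<exists>a b. automorphism scale a \<and> automorphism scale b \<and>
            annihilates scale p a \<and> annihilates scale q b \<and> u = a \<circ> inv_into UNIV b)"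

definition closure_eigenvalue ::
  "('a::field \<Rightarrow> 'v::ab_group_add \<Rightarrow> 'v) \<Rightarrow> ('v \<Rightarrow> 'v) \<Rightarrow> 'a alg_closure \<Rightarrow> bool" where
  "closure_eigenvalue scale f z \<longleftrightarrow>
     (\<exists>A. represented scale f A \<and> eigenvalue (map_mat to_ac A) z)"

definition q_exceptional ::
  "('a::field \<Rightarrow> 'v::ab_group_add \<Rightarrow> 'v) \<Rightarrow> 'a poly \<Rightarrow> 'a poly \<Rightarrow> ('v \<Rightarrow> 'v) \<Rightarrow> bool" where
  "q_exceptional scale p q u \<longleftrightarrow>
     (\<forall>z. closure_eigenvalue scale u z \<longrightarrow> z \<in> {x * inverse y | x y. x \<in> Root p \<and> y \<in> Root q})"

definition trace_poly :: "'a::field alg_closure set \<Rightarrow> 'a \<Rightarrow> 'a alg_closure \<Rightarrow> 'a poly" where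
  "trace_poly L \<delta> z = [:\<delta>, - field_trace L z, 1:]"

end

theory Submission
  imports Defs "HOL-Library.Function_Algebras"
begin

text \<open>If \<open>u = a b\<inverse>\<close>, then the commutator \<open>\<sigma> = a u - u a\<close> is semilinear for the involution
  \<open>u \<mapsto> \<delta> u\<inverse>\<close>, and \<open>\<sigma>\<^sup>2\<close> is, up to a nonzero scalar, \<open>(c - T1) (c - T2)\<close> with \<open>c = u + \<delta> u\<inverse>\<close> and
  \<open>T1\<close>, \<open>T2\<close> the two traces. On the part of the space where \<open>u\<close> is annihilated by a power of
  \<open>f = t\<^sup>2 - T1 t + \<delta>\<close>, every power \<open>f(u)\<^sup>k\<close> is thus a unit times \<open>\<sigma>\<^sup>2\<^sup>k\<close>, so \<open>\<sigma>\<close> is nilpotent and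
  a minimal system of generators \<open>v\<close> with \<open>\<sigma>\<^sup>m v = 0\<close> splits the space into cyclic modules generated by
  \<open>v\<close> and \<open>\<sigma> v\<close>, with annihilators \<open>f\<close> to the powers \<open>\<lceil>m/2\<rceil>\<close> and \<open>\<lfloor>m/2\<rfloor>\<close>. Conversely, on such a pair of
  cyclic modules the semilinear map exchanging the two generators (up to \<open>\<sigma>\<^sup>2\<close>) can be written down, and
  \<open>a\<close> is recovered from \<open>\<sigma>\<close> because \<open>\<delta> u\<inverse> - u\<close> is invertible. The description by invariant factors is
  obtained by sorting the exponents \<open>\<lceil>m/2\<rceil>\<close>, \<open>\<lfloor>m/2\<rfloor>\<close>.\<close>

section \<open>Polynomials over a field\<close>

text \<open>By itself \<open>a\<close> is semilinear only up to an error term: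
  \<open>a u = (\<delta> / u) a - (\<delta> tq - tp u)\<close>. Forming the commutator removes the
  error. The field hypotheses enter at separate places. Non-homothety keeps all four quotients
  \<open>x / y\<close> out of the base field, so both quadratics are irreducible. Separability makes
  the two traces distinct and, even in characteristic 2, makes \<open>u^2 - \<delta>\<close> and
  hence \<open>\<delta> / u - u\<close> invertible. The obstacle in the decomposition is that
  coefficients do not commute with \<sigma>: moving f(u) across \<sigma> turns it into
  f(\<delta>/u). Coefficients are therefore pairs of polynomials, one in u and one in \<delta>/u,
  and \<sigma> swaps the entries; a pair of units stays a pair of units. On a primary component
  \<sigma> then acts like a uniformiser: every nonzero polynomial in u is a unit times an even power
  of \<sigma>. A relation among generators can be divided by its lowest power of \<sigma> and
  shortens one of them, so generators of least total \<sigma>-length admit no relation. Directness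
  of sums is never proved as such; generation together with a dimension bound replaces it.\<close>

lemma poly_bezout:
  fixes f g :: "'a::field poly"
  assumes "g \<noteq> 0"
  obtains d a b where "lead_coeff d = 1" "d dvd f" "d dvd g" "d = a * f + b * g"
proof -
  define Q where "Q h \<longleftrightarrow> h \<noteq> 0 \<and> (\<exists>a b. h = a * f + b * g)" for h
  have "Q g"
    unfolding Q_def using assms by (metis add.left_neutral mult_1 mult_zero_left)
  then obtain h where h: "Q h" "\<And>k. Q k \<Longrightarrow> Polynomial.degree h \<le> Polynomial.degree k"
    using ex_has_least_nat[of Q g Polynomial.degree] by blast
  obtain a b where ab: "h = a * f + b * g" "h \<noteq> 0"
    using h(1) by (auto simp: Q_def)
  \<comment> \<open>The remainder of \<open>k\<close> by \<open>h\<close> is again a combination of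
    \<open>f\<close> and \<open>g\<close>, so it cannot be nonzero of smaller degree.\<close>
  have dvd: "h dvd k" if k: "k = a' * f + b' * g" for k a' b'
  proof (rule ccontr)
    assume "\<not> h dvd k"
    then have nz: "k mod h \<noteq> 0"
      by (simp add: dvd_eq_mod_eq_0)
    have "k mod h = k - k div h * h"
      by (simp add: minus_div_mult_eq_mod)
    also have "\<dots> = (a' - k div h * a) * f + (b' - k div h * b) * g"
      by (simp add: k ab(1) algebra_simps)
    finally have "Q (k mod h)"
      using nz by (auto simp: Q_def)
    then show False
      using h(2) nz degree_mod_less'[OF ab(2) nz] by fastforce
  qed
  show thesis
  proof (rule that)
    let ?d = "Polynomial.smult (inverse (lead_coeff h)) h"
    show "lead_coeff ?d = 1"
      using ab(2) by simp
    show "?d dvd f" "?d dvd g"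
      using dvd[of f 1 0] dvd[of g 0 1] ab(2) by (simp_all add: smult_dvd_iff)
    show "?d = Polynomial.smult (inverse (lead_coeff h)) a * f +
        Polynomial.smult (inverse (lead_coeff h)) b * g"
      by (subst ab(1)) (simp add: smult_add_right)
  qed
qed

text \<open>Coprimality in Bezout form: the identity can be evaluated at an endomorphism and there
  yields inverses and splittings directly.\<close>

definition comaximal :: "'a::field poly \<Rightarrow> 'a poly \<Rightarrow> bool" where
  "comaximal f g \<longleftrightarrow> (\<exists>a b. a * f + b * g = 1)"

lemma comaximal_commute: "comaximal f g \<Longrightarrow> comaximal g f"
  unfolding comaximal_def by (metis add.commute)

lemma comaximal_mult:
  assumes "comaximal f h" and "comaximal g h"
  shows "comaximal (f * g) h"
proof -
  obtain a b a' b' where 1: "a * f + b * h = 1" "a' * g + b' * h = 1"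
    using assms by (auto simp: comaximal_def)
  have "(a * a') * (f * g) + (a * f * b' + b * (a' * g + b' * h)) * h =
      (a * f + b * h) * (a' * g + b' * h)"
    by (simp add: algebra_simps)
  then show ?thesis
    unfolding comaximal_def 1 by (metis mult_1)
qed

lemma comaximal_power: "comaximal f g \<Longrightarrow> comaximal (f ^ m) (g ^ n)"
proof -
  have 1: "comaximal (f ^ m) g" if "comaximal f g" for f g :: "'a poly" and m
  proof (induction m)
    case 0
    have "1 * 1 + 0 * g = (1 :: 'a poly)"
      by simp
    then show ?case
      unfolding comaximal_def power_0 by blast
  qed (simp add: comaximal_mult that)
  assume "comaximal f g"
  from 1[OF comaximal_commute[OF 1[OF this]]] show ?thesis
    by (rule comaximal_commute)
qed

text \<open>Write f = d e with d the monic common divisor from Bezout. If e were a unit, f would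
  divide d and hence g; so d is a unit, and being monic it is 1.\<close>

lemma irreducible_comaximal:
  fixes f g :: "'a::field poly"
  assumes "Factorial_Ring.irreducible f" and "\<not> f dvd g"
  shows "comaximal f g"
proof -
  have "f \<noteq> 0"
    using assms(1) by auto
  then obtain d a b where d: "lead_coeff d = 1" "d dvd g" "d dvd f" "d = a * g + b * f"
    using poly_bezout[of f g] by metis
  obtain e where e: "f = d * e"
    using d(3) by (rule dvdE)
  have "\<not> e dvd 1"
  proof
    assume "e dvd 1"
    then have "f dvd d"
      unfolding e by (simp add: mult_unit_dvd_iff)
    then show False
      using d(2) assms(2) by (metis dvd_trans)
  qed
  then have "d dvd 1"
    using assms(1) e by (auto dest: Factorial_Ring.irreducibleD)
  then obtain c where "d = [:c:]"
    by (auto simp: is_unit_iff_degree elim: degree_eq_zeroE)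
  then have "d = 1"
    using d(1) by (simp flip: one_pCons)
  then show ?thesis
    using d(4) unfolding comaximal_def by (metis add.commute)
qed

lemma irreducible_comaximal_prime:
  assumes "comaximal f g" and "f dvd g * h"
  shows "f dvd h"
proof -
  obtain a b where ab: "a * f + b * g = 1"
    using assms(1) by (auto simp: comaximal_def)
  have "h = (a * f + b * g) * h"
    by (simp add: ab)
  also have "\<dots> = (a * h) * f + b * (g * h)"
    by (simp add: algebra_simps)
  finally show ?thesis
    using assms(2) by (metis dvd_add dvd_mult dvd_triv_right)
qed

lemma ex_power_factor:
  fixes f g :: "'a::field poly"
  assumes "f \<noteq> 0" and "Polynomial.degree g > 0"
  shows "\<exists>k h. f = g ^ k * h \<and> \<not> g dvd h"
  using assms(1)
proof (induction "Polynomial.degree f" arbitrary: f rule: less_induct)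
  case less
  show ?case
  proof (cases "g dvd f")
    case True
    then obtain h where h: "f = g * h"
      by (rule dvdE)
    then have "h \<noteq> 0" "g \<noteq> 0"
      using less.prems by auto
    then have "Polynomial.degree h < Polynomial.degree f"
      unfolding h using assms(2) by (subst degree_mult_eq) auto
    then obtain k h' where "h = g ^ k * h'" "\<not> g dvd h'"
      using less.hyps \<open>h \<noteq> 0\<close> by blast
    then show ?thesis
      unfolding h by (intro exI[of _ "Suc k"] exI[of _ h']) (simp add: mult.assoc)
  next
    case False
    then show ?thesis
      by (intro exI[of _ 0] exI[of _ f]) simp
  qed
qed

section \<open>Polynomials in an endomorphism\<close>

context vector_space
begin

lemma linear_selfI:
  assumes "\<And>x y. f (x + y) = f x + f y" and "\<And>c x. f (scale c x) = scale c (f x)"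
  shows "Vector_Spaces.linear scale scale f"
  by unfold_locales (use assms in auto)

lemma poly_endo_altdef:
  assumes "Polynomial.degree p \<le> n"
  shows "poly_endo scale p f v = (\<Sum>i\<le>n. scale (Polynomial.coeff p i) ((f ^^ i) v))"
  unfolding poly_endo_def
  by (rule sum.mono_neutral_left) (use assms in \<open>auto simp: coeff_eq_0\<close>)

lemma poly_endo_0 [simp]: "poly_endo scale 0 f v = 0"
  by (simp add: poly_endo_def)

lemma poly_endo_1 [simp]: "poly_endo scale 1 f v = v"
  by (simp add: poly_endo_def)

lemma poly_endo_add: "poly_endo scale (p + q) f v = poly_endo scale p f v + poly_endo scale q f v"
proof -
  let ?n = "max (Polynomial.degree p) (Polynomial.degree q)"
  have "poly_endo scale (p + q) f v = (\<Sum>i\<le>?n. scale (Polynomial.coeff (p + q) i) ((f ^^ i) v))"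
    by (rule poly_endo_altdef) (rule degree_add_le_max)
  also have "\<dots> = poly_endo scale p f v + poly_endo scale q f v"
    by (simp add: poly_endo_altdef[of _ ?n] scale_left_distrib sum.distrib)
  finally show ?thesis .
qed

lemma poly_endo_smult: "poly_endo scale (Polynomial.smult c p) f v = scale c (poly_endo scale p f v)"
  by (subst poly_endo_altdef[of _ "Polynomial.degree p"])
    (auto simp: poly_endo_def scale_sum_right degree_smult_le)

lemma poly_endo_pCons: "poly_endo scale (pCons c p) f v = scale c v + poly_endo scale p f (f v)"
proof -
  have "poly_endo scale (pCons c p) f v =
      (\<Sum>i\<le>Suc (Polynomial.degree p). scale (Polynomial.coeff (pCons c p) i) ((f ^^ i) v))"
    by (rule poly_endo_altdef) (simp add: degree_pCons_le)
  then show ?thesis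
    by (simp add: sum.atMost_Suc_shift poly_endo_def funpow_swap1 del: sum.atMost_Suc)
qed

lemma poly_endo_sum: "poly_endo scale (\<Sum>i\<in>I. p i) f v = (\<Sum>i\<in>I. poly_endo scale (p i) f v)"
  by (induction I rule: infinite_finite_induct) (auto simp: poly_endo_add)

lemma poly_endo_monom: "poly_endo scale (Polynomial.monom c n) f v = scale c ((f ^^ n) v)"
  by (induction n arbitrary: v) (auto simp: monom_0 monom_Suc poly_endo_pCons funpow_swap1)

lemma linear_funpow:
  assumes "Vector_Spaces.linear scale scale f"
  shows "Vector_Spaces.linear scale scale (f ^^ n)"
proof (induction n)
  case 0
  then show ?case by (simp add: linear_selfI)
next
  case (Suc n)
  interpret f: Vector_Spaces.linear scale scale f by fact
  interpret fn: Vector_Spaces.linear scale scale "f ^^ n" by fact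
  show ?case
    by (rule linear_selfI) (auto simp: f.add f.scale fn.add fn.scale)
qed

text \<open>With \<open>h = f\<close> this says that commuting maps commute with polynomials; with
  \<open>h\<close> equal to \<delta>/u it moves polynomials across the semilinear \<sigma>.\<close>

lemma poly_endo_intertwine:
  assumes "Vector_Spaces.linear scale scale g" and "\<And>x. g (f x) = h (g x)"
  shows "g (poly_endo scale p f v) = poly_endo scale p h (g v)"
proof -
  interpret g: Vector_Spaces.linear scale scale g by fact
  have "g ((f ^^ n) v) = (h ^^ n) (g v)" for n
    by (induction n) (auto simp: assms(2))
  then show ?thesis
    by (simp add: poly_endo_def g.sum g.scale)
qed

lemma linear_poly_endo:
  assumes "Vector_Spaces.linear scale scale f"
  shows "Vector_Spaces.linear scale scale (poly_endo scale p f)"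
proof (induction p)
  case 0
  interpret module_pair scale scale by unfold_locales
  show ?case
    using module_hom_zero by (simp add: module_hom_iff_linear poly_endo_def[abs_def])
next
  case (pCons c p)
  interpret f: Vector_Spaces.linear scale scale f by fact
  interpret p: Vector_Spaces.linear scale scale "poly_endo scale p f" by fact
  show ?case
    by (rule linear_selfI) (auto simp: poly_endo_pCons f.add p.add f.scale p.scale algebra_simps)
qed

lemma poly_endo_mult:
  assumes "Vector_Spaces.linear scale scale f"
  shows "poly_endo scale (p * q) f v = poly_endo scale p f (poly_endo scale q f v)"
proof (induction p arbitrary: v)
  case 0
  then show ?case by simp
next
  case (pCons c p)
  have "f (poly_endo scale q f v) = poly_endo scale q f (f v)"
    by (rule poly_endo_intertwine) (use assms in auto)
  then show ?case
    by (simp add: poly_endo_add poly_endo_smult poly_endo_pCons pCons.IH)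
qed

lemma poly_endo_commute:
  assumes "Vector_Spaces.linear scale scale f"
  shows "poly_endo scale p f (poly_endo scale q f v) = poly_endo scale q f (poly_endo scale p f v)"
  by (metis poly_endo_mult[OF assms] mult.commute)

lemma poly_endo_closed:
  assumes "subspace S" and "\<And>x. x \<in> S \<Longrightarrow> f x \<in> S" and "v \<in> S"
  shows "poly_endo scale p f v \<in> S"
proof -
  have "(f ^^ n) v \<in> S" for n
    by (induction n) (auto simp: assms)
  then show ?thesis
    unfolding poly_endo_def by (intro subspace_sum subspace_scale assms)
qed

end

section \<open>Cyclic decompositions\<close>

lemma (in vector_space) matrix_in_basis_append:
  assumes "A \<in> carrier_mat (length bs) (length bs)" and "D \<in> carrier_mat (length cs) (length cs)"
  shows "matrix_in_basis scale (bs @ cs) f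
      (four_block_mat A (0\<^sub>m (length bs) (length cs)) (0\<^sub>m (length cs) (length bs)) D) \<longleftrightarrow>
    matrix_in_basis scale bs f A \<and> matrix_in_basis scale cs f D" (is "matrix_in_basis _ _ _ ?F = _")
proof -
  let ?n = "length bs" and ?m = "length cs"
  have F: "?F \<in> carrier_mat (?n + ?m) (?n + ?m)"
    using assms by auto
  have split: "(\<Sum>i<n + m. g i) = (\<Sum>i<n. g i) + (\<Sum>i<m. g (n + i))" for g :: "nat \<Rightarrow> 'b" and n m
    by (induction m) (simp_all add: add.assoc)
  have l: "(\<Sum>i<?n + ?m. scale (?F $$ (i, j)) ((bs @ cs) ! i)) = (\<Sum>i<?n. scale (A $$ (i, j)) (bs ! i))"
    if "j < ?n" for j
    using that assms by (auto simp: split nth_append intro!: sum.cong)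
  have r: "(\<Sum>i<?n + ?m. scale (?F $$ (i, ?n + j)) ((bs @ cs) ! i)) = (\<Sum>i<?m. scale (D $$ (i, j)) (cs ! i))"
    if "j < ?m" for j
    using that assms by (auto simp: split nth_append intro!: sum.cong)
  have all: "(\<forall>j<?n + ?m. Q j) \<longleftrightarrow> (\<forall>j<?n. Q j) \<and> (\<forall>j<?m. Q (?n + j))" for Q
  proof (intro iffI conjI allI impI)
    fix j assume "(\<forall>j<?n. Q j) \<and> (\<forall>j<?m. Q (?n + j))" "j < ?n + ?m"
    then show "Q j"
      by (cases "j < ?n") (auto dest: spec[of _ "j - ?n"])
  qed auto
  let ?col = "\<lambda>as A j. f (as ! j) = (\<Sum>i<length as. A $$ (i, j) *s as ! i)"
  have "(\<forall>j<?n + ?m. ?col (bs @ cs) ?F j) \<longleftrightarrow> (\<forall>j<?n. ?col bs A j) \<and> (\<forall>j<?m. ?col cs D j)"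
    unfolding all length_append
    by (simp add: l r nth_append_left cong: conj_cong del: index_mat_four_block)
  then show ?thesis
    unfolding matrix_in_basis_def using assms F by simp
qed

locale endomorphism = finite_dimensional_vector_space scale Basis
  for scale :: "'a::field \<Rightarrow> 'v::ab_group_add \<Rightarrow> 'v" (infixr \<open>*s\<close> 75) and Basis :: "'v set" +
  fixes u :: "'v \<Rightarrow> 'v"
  assumes linear_u: "Vector_Spaces.linear scale scale u"
begin

sublocale u: Vector_Spaces.linear scale scale u
  by (rule linear_u)

abbreviation P :: "'a poly \<Rightarrow> 'v \<Rightarrow> 'v" where
  "P f \<equiv> poly_endo scale f u"

lemma linear_P: "Vector_Spaces.linear scale scale (P f)"
  by (rule linear_poly_endo) (rule linear_u)

sublocale P: Vector_Spaces.linear scale scale "P f" for f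
  by (rule linear_P)

lemmas P_mult = poly_endo_mult[OF linear_u]

text \<open>The power basis of a cyclic module with annihilator \<open>g\<close>; only the degree of
  \<open>g\<close> enters.\<close>

definition krylov :: "'v \<Rightarrow> 'a poly \<Rightarrow> 'v list" where
  "krylov v g = map (\<lambda>j. (u ^^ j) v) [0..<Polynomial.degree g]"

lemma length_krylov [simp]: "length (krylov v g) = Polynomial.degree g"
  by (simp add: krylov_def)

text \<open>Since \<open>g\<close> is monic and kills \<open>v\<close>, the iterate at exponent
  \<open>degree g\<close> is a combination of lower ones; applying a further power of u lowers any
  exponent in the same way.\<close>

lemma funpow_in_krylov:
  assumes "lead_coeff g = 1" and "P g v = 0"
  shows "(u ^^ n) v \<in> span (set (krylov v g))"
proof (induction n rule: less_induct)
  case (less n)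
  let ?d = "Polynomial.degree g"
  show ?case
  proof (cases "n < ?d")
    case True
    then show ?thesis
      by (intro span_base) (auto simp: krylov_def)
  next
    case False
    interpret uk: Vector_Spaces.linear scale scale "u ^^ (n - ?d)"
      by (rule linear_funpow[OF linear_u])
    have "(\<Sum>i<?d. Polynomial.coeff g i *s (u ^^ i) v) + (u ^^ ?d) v = 0"
      using assms by (simp add: poly_endo_def lessThan_Suc_atMost[symmetric])
    then have "(u ^^ ?d) v = - (\<Sum>i<?d. Polynomial.coeff g i *s (u ^^ i) v)"
      by (metis add.commute eq_neg_iff_add_eq_0)
    then have "(u ^^ (n - ?d)) ((u ^^ ?d) v) =
        - (\<Sum>i<?d. Polynomial.coeff g i *s (u ^^ (n - ?d)) ((u ^^ i) v))"
      by (simp add: uk.neg uk.sum uk.scale)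
    moreover have "(u ^^ n) v = (u ^^ (n - ?d)) ((u ^^ ?d) v)"
      using False funpow_add[of "n - ?d" ?d u] by simp
    moreover have "(u ^^ (n - ?d)) ((u ^^ i) v) = (u ^^ (n - ?d + i)) v" for i
      by (simp add: funpow_add)
    ultimately have "(u ^^ n) v = - (\<Sum>i<?d. Polynomial.coeff g i *s (u ^^ (n - ?d + i)) v)"
      by simp
    moreover have "(u ^^ (n - ?d + i)) v \<in> span (set (krylov v g))" if "i < ?d" for i
      using that False by (intro less) auto
    ultimately show ?thesis
      by (auto intro!: span_neg span_sum span_scale)
  qed
qed

lemma span_krylov_closed:
  assumes "\<And>v g. (v, g) \<in> Y \<Longrightarrow> lead_coeff g = 1 \<and> P g v = 0"
    and "x \<in> span (\<Union>(v, g)\<in>Y. set (krylov v g))"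
  shows "u x \<in> span (\<Union>(v, g)\<in>Y. set (krylov v g))" (is "_ \<in> ?S")
  using assms(2)
proof (induction rule: span_induct)
  case base
  then show ?case
    unfolding subspace_def by (auto simp: u.add u.scale span_zero span_add span_scale)
next
  case (step x)
  then obtain v g j where vg: "(v, g) \<in> Y" "x = (u ^^ j) v"
    by (auto simp: krylov_def)
  have "(u ^^ Suc j) v \<in> span (set (krylov v g))"
    using assms(1)[OF vg(1)] by (intro funpow_in_krylov) auto
  also have "\<dots> \<subseteq> ?S"
    using vg(1) by (intro span_mono) auto
  finally show ?case
    by (simp add: vg(2))
qed

text \<open>A direct sum of cyclic modules, with directness encoded by the dimension bound: the
  Krylov lists span the space and have too few members to be dependent. Only generation and a count
  have to be checked.\<close>

definition cyclic_decomposition :: "('v \<times> 'a poly) multiset \<Rightarrow> bool" where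
  "cyclic_decomposition M \<longleftrightarrow>
     (\<forall>(v, g)\<in>#M. lead_coeff g = 1 \<and> P g v = 0) \<and>
     (\<forall>S. subspace S \<longrightarrow> (\<forall>x\<in>S. u x \<in> S) \<longrightarrow> (\<forall>(v, g)\<in>#M. v \<in> S) \<longrightarrow> S = UNIV) \<and>
     (\<Sum>(v, g)\<in>#M. Polynomial.degree g) \<le> dim (UNIV :: 'v set)"

lemma span_krylovs:
  assumes "\<forall>(v, g)\<in>#M. lead_coeff g = 1 \<and> P g v = 0"
    and "\<And>S. subspace S \<Longrightarrow> \<forall>x\<in>S. u x \<in> S \<Longrightarrow> \<forall>(v, g)\<in>#M. v \<in> S \<Longrightarrow> S = UNIV"
  shows "span (\<Union>(v, g)\<in>set_mset M. set (krylov v g)) = UNIV"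
proof (rule assms(2))
  show "\<forall>x\<in>span (\<Union>(v, g)\<in>set_mset M. set (krylov v g)).
      u x \<in> span (\<Union>(v, g)\<in>set_mset M. set (krylov v g))"
    using assms(1) by (intro ballI span_krylov_closed) auto
  have "v \<in> span (\<Union>(v, g)\<in>set_mset M. set (krylov v g))" if "(v, g) \<in># M" for v g
  proof -
    have "(u ^^ 0) v \<in> span (set (krylov v g))"
      using assms(1) that by (intro funpow_in_krylov) auto
    also have "\<dots> \<subseteq> span (\<Union>(v, g)\<in>set_mset M. set (krylov v g))"
      using that by (intro span_mono) auto
    finally show ?thesis
      by simp
  qed
  then show "\<forall>(v, g)\<in>#M. v \<in> span (\<Union>(v, g)\<in>set_mset M. set (krylov v g))"
    by blast
qed (rule subspace_span)

text \<open>Kept apart from the decompositions because it is applied again to a generating family in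
  which one annihilator has been replaced by a divisor.\<close>

lemma dim_le_sum_degree:
  assumes "\<forall>(v, g)\<in>#M. lead_coeff g = 1 \<and> P g v = 0"
    and "\<And>S. subspace S \<Longrightarrow> \<forall>x\<in>S. u x \<in> S \<Longrightarrow> \<forall>(v, g)\<in>#M. v \<in> S \<Longrightarrow> S = UNIV"
  shows "dim (UNIV :: 'v set) \<le> (\<Sum>(v, g)\<in>#M. Polynomial.degree g)"
proof -
  obtain xs where xs: "mset xs = M"
    using ex_mset by blast
  let ?bs = "concat (map (\<lambda>(v, g). krylov v g) xs)"
  have "set ?bs = (\<Union>(v, g)\<in>set_mset M. set (krylov v g))"
    unfolding xs[symmetric] by auto
  then have "span (set ?bs) = UNIV"
    using span_krylovs[OF assms] by (simp only:)
  then have "dim (UNIV :: 'v set) \<le> card (set ?bs)"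
    by (intro dim_le_card) (simp_all only: finite_set subset_refl)
  also have "\<dots> \<le> length ?bs"
    by (rule card_length)
  also have "\<dots> = (\<Sum>(v, g)\<in>#M. Polynomial.degree g)"
    by (simp add: length_concat o_def case_prod_unfold flip: xs sum_mset_sum_list)
  finally show ?thesis .
qed

lemma cyclic_decompositionI:
  assumes "\<And>v g. (v, g) \<in># M \<Longrightarrow> lead_coeff g = 1" and "\<And>v g. (v, g) \<in># M \<Longrightarrow> P g v = 0"
    and "\<And>S. subspace S \<Longrightarrow> (\<And>x. x \<in> S \<Longrightarrow> u x \<in> S) \<Longrightarrow> (\<And>v g. (v, g) \<in># M \<Longrightarrow> v \<in> S) \<Longrightarrow> S = UNIV"
    and "(\<Sum>(v, g)\<in>#M. Polynomial.degree g) \<le> dim (UNIV :: 'v set)"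
  shows "cyclic_decomposition M"
  unfolding cyclic_decomposition_def
proof (intro conjI allI impI)
  fix S assume "subspace S" "\<forall>x\<in>S. u x \<in> S" "\<forall>(v, g)\<in>#M. v \<in> S"
  then show "S = UNIV"
    by (intro assms(3)) auto
next
  show "\<forall>(v, g)\<in>#M. lead_coeff g = 1 \<and> P g v = 0"
    using assms(1,2) by blast
qed (rule assms(4))

lemma cyclic_decompositionD:
  assumes "cyclic_decomposition M"
  shows "(v, g) \<in># M \<Longrightarrow> lead_coeff g = 1" and "(v, g) \<in># M \<Longrightarrow> P g v = 0"
    and "subspace S \<Longrightarrow> (\<And>x. x \<in> S \<Longrightarrow> u x \<in> S) \<Longrightarrow> (\<And>v g. (v, g) \<in># M \<Longrightarrow> v \<in> S) \<Longrightarrow> S = UNIV"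
    and "(\<Sum>(v, g)\<in>#M. Polynomial.degree g) = dim (UNIV :: 'v set)"
proof -
  note cyc = assms[unfolded cyclic_decomposition_def, THEN conjunct1]
    assms[unfolded cyclic_decomposition_def, THEN conjunct2, THEN conjunct1, THEN spec, THEN mp, THEN mp, THEN mp]
    assms[unfolded cyclic_decomposition_def, THEN conjunct2, THEN conjunct2]
  show "lead_coeff g = 1" "P g v = 0" if "(v, g) \<in># M"
    using cyc(1) that by blast+
  show "S = UNIV" if "subspace S" "\<And>x. x \<in> S \<Longrightarrow> u x \<in> S" "\<And>v g. (v, g) \<in># M \<Longrightarrow> v \<in> S"
    by (rule cyc(2)) (use that in auto)
  show "(\<Sum>(v, g)\<in>#M. Polynomial.degree g) = dim (UNIV :: 'v set)"
    by (rule antisym[OF cyc(3) dim_le_sum_degree[OF cyc(1,2)]])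
qed

text \<open>A spanning list whose length is at most the dimension is distinct and independent;
  conversely a basis has exactly that many members.\<close>

lemma cyclic_decomposition_iff_basis:
  assumes "\<And>v g. (v, g) \<in> set xs \<Longrightarrow> lead_coeff g = 1" and "\<And>v g. (v, g) \<in> set xs \<Longrightarrow> P g v = 0"
  shows "cyclic_decomposition (mset xs) \<longleftrightarrow>
    basis_of scale UNIV (concat (map (\<lambda>(v, g). krylov v g) xs))" (is "_ \<longleftrightarrow> basis_of scale UNIV ?bs")
proof -
  have len: "length ?bs = (\<Sum>(v, g)\<in>#mset xs. Polynomial.degree g)"
    by (simp add: length_concat o_def case_prod_unfold flip: sum_mset_sum_list)
  have set: "set ?bs = (\<Union>(v, g)\<in>set_mset (mset xs). set (krylov v g))"
    by auto
  show ?thesis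
  proof
    assume cyc: "cyclic_decomposition (mset xs)"
    have sp: "span (set ?bs) = UNIV"
      unfolding set
    proof (rule span_krylovs)
      show "\<forall>(v, g)\<in>#mset xs. lead_coeff g = 1 \<and> P g v = 0"
        using assms by auto
      show "S = UNIV" if "subspace S" "\<forall>x\<in>S. u x \<in> S" "\<forall>(v, g)\<in>#mset xs. v \<in> S" for S
        by (rule cyclic_decompositionD(3)[OF cyc that(1)]) (use that(2,3) in auto)
    qed
    have "card (set ?bs) \<le> dim (UNIV :: 'v set)"
      using card_length[of ?bs] unfolding cyclic_decompositionD(4)[OF cyc] len .
    moreover have "dim (UNIV :: 'v set) \<le> card (set ?bs)"
      by (intro dim_le_card) (simp_all only: sp finite_set subset_refl)
    ultimately have eq: "card (set ?bs) = dim (UNIV :: 'v set)"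
      by (rule antisym)
    then have "distinct ?bs"
      by (intro card_distinct) (simp only: len cyclic_decompositionD(4)[OF cyc])
    moreover have "independent (set ?bs)"
      by (intro card_le_dim_spanning[of _ UNIV]) (simp_all only: sp eq finite_set subset_UNIV order_refl)
    ultimately show "basis_of scale UNIV ?bs"
      using sp by (simp only: basis_of_def simp_thms)
  next
    assume b: "basis_of scale UNIV ?bs"
    show "cyclic_decomposition (mset xs)"
    proof (rule cyclic_decompositionI)
      fix S assume S: "subspace S" "\<And>x. x \<in> S \<Longrightarrow> u x \<in> S" "\<And>v g. (v, g) \<in># mset xs \<Longrightarrow> v \<in> S"
      have "(u ^^ n) v \<in> S" if "v \<in> S" for n v
        by (induction n) (auto simp: that S)
      then have "set ?bs \<subseteq> S"
        using S(3) by (auto simp: krylov_def)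
      then have "span (set ?bs) \<subseteq> S"
        using S(1) by (rule span_minimal)
      then show "S = UNIV"
        using b unfolding basis_of_def by blast
    next
      have "card (set ?bs) = dim (UNIV :: 'v set)"
        using b unfolding basis_of_def by (intro basis_card_eq_dim) (simp_all only: subset_UNIV order_refl simp_thms)
      then show "(\<Sum>(v, g)\<in>#mset xs. Polynomial.degree g) \<le> dim (UNIV :: 'v set)"
        using b distinct_card[of ?bs] unfolding basis_of_def len by linarith
    qed (use assms in auto)
  qed
qed

end

text \<open>Matrices fix an order of the blocks while decompositions are unordered; this picks an
  order of the generators that matches a given order of the polynomials.\<close>

lemma ex_list_of_image_mset:
  assumes "image_mset f M = mset ys"
  obtains xs where "map f xs = ys" and "mset xs = M"
  using assms
proof (induction ys arbitrary: M thesis)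
  case Nil
  then show ?case by simp
next
  case (Cons y ys)
  obtain N x where N: "M = add_mset x N" "f x = y" "image_mset f N = mset ys"
    using Cons.prems(2) msed_map_invR[of f M y "mset ys"] by auto
  obtain xs where "map f xs = ys" "mset xs = N"
    using Cons.IH[OF _ N(3)] by blast
  then show ?case
    using N by (intro Cons.prems(1)[of "x # xs"]) auto
qed

section \<open>Companion blocks, Krylov bases and elementary divisors\<close>

context endomorphism
begin

lemma P_monic:
  assumes "lead_coeff g = 1"
  shows "P g v = (\<Sum>i<Polynomial.degree g. Polynomial.coeff g i *s (u ^^ i) v) + (u ^^ Polynomial.degree g) v"
proof -
  have "(\<Sum>i\<le>d. f i) = (\<Sum>i<d. f i) + f d" for f :: "nat \<Rightarrow> 'v" and d
    using sum.lessThan_Suc[of f d] by (simp only: lessThan_Suc_atMost)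
  then show ?thesis
    unfolding poly_endo_def by (simp only: assms scale_one)
qed

lemma companion_column:
  assumes "length bs = Polynomial.degree g" and "j < Polynomial.degree g"
  shows "(\<Sum>i<length bs. companion g $$ (i, j) *s bs ! i) =
    (if Suc j = Polynomial.degree g
     then - (\<Sum>i<Polynomial.degree g. Polynomial.coeff g i *s bs ! i) else bs ! Suc j)"
proof (cases "Suc j = Polynomial.degree g")
  case True
  then have "(\<Sum>i<length bs. companion g $$ (i, j) *s bs ! i) =
      (\<Sum>i<Polynomial.degree g. - (Polynomial.coeff g i *s bs ! i))"
    using assms by (intro sum.cong) (auto simp: companion_def Let_def)
  then show ?thesis
    using True by (simp add: sum_negf)
next
  case False
  then have "(\<Sum>i<length bs. companion g $$ (i, j) *s bs ! i) =
      (\<Sum>i<Polynomial.degree g. if i = Suc j then bs ! i else 0)"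
    using assms by (intro sum.cong) (auto simp: companion_def Let_def)
  then show ?thesis
    using False assms(2) by simp
qed

text \<open>All columns but the last say that each basis vector is the u-image of its predecessor;
  the last column says that \<open>g\<close> kills the first vector.\<close>

lemma matrix_in_basis_companion:
  assumes "lead_coeff g = 1"
  shows "matrix_in_basis scale bs u (companion g) \<longleftrightarrow> (\<exists>v. bs = krylov v g \<and> P g v = 0)"
proof
  let ?d = "Polynomial.degree g"
  assume m: "matrix_in_basis scale bs u (companion g)"
  then have len: "length bs = ?d"
    by (auto simp: matrix_in_basis_def companion_def Let_def)
  have col: "u (bs ! j) = (if Suc j = ?d
     then - (\<Sum>i<?d. Polynomial.coeff g i *s bs ! i) else bs ! Suc j)" if "j < ?d" for j
    using m companion_column[OF len that] that len unfolding matrix_in_basis_def by simp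
  show "\<exists>v. bs = krylov v g \<and> P g v = 0"
  proof (cases ?d)
    case 0
    \<comment> \<open>Here \<open>g\<close> is 1 and the list is empty; the witness must be 0, the
      only vector killed by 1.\<close>
    then show ?thesis
      using len by (intro exI[of _ 0]) (simp add: krylov_def)
  next
    case (Suc d)
    define v where "v = bs ! 0"
    have nth: "bs ! j = (u ^^ j) v" if "j < ?d" for j
      using that
    proof (induction j)
      case (Suc j)
      then show ?case
        using col[of j] by simp
    qed (simp add: v_def)
    have "bs = krylov v g"
      by (rule nth_equalityI) (simp_all add: len krylov_def nth)
    moreover have "(u ^^ ?d) v = - (\<Sum>i<?d. Polynomial.coeff g i *s (u ^^ i) v)"
      using col[of d] Suc nth[of d] by (simp add: nth)
    then have "P g v = 0"
      by (simp add: P_monic assms)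
    ultimately show ?thesis
      by blast
  qed
next
  let ?d = "Polynomial.degree g"
  assume "\<exists>v. bs = krylov v g \<and> P g v = 0"
  then obtain v where v: "bs = krylov v g" "P g v = 0"
    by blast
  have nth: "bs ! j = (u ^^ j) v" if "j < ?d" for j
    using that by (simp add: v(1) krylov_def)
  have last: "(u ^^ ?d) v = - (\<Sum>i<?d. Polynomial.coeff g i *s bs ! i)"
    using v(2) by (simp add: P_monic assms nth eq_neg_iff_add_eq_0 add.commute)
  have "u (bs ! j) = (\<Sum>i<length bs. companion g $$ (i, j) *s bs ! i)" if "j < ?d" for j
  proof -
    have "u (bs ! j) = (u ^^ Suc j) v"
      using that by (simp add: nth)
    also have "\<dots> = (if Suc j = ?d then - (\<Sum>i<?d. Polynomial.coeff g i *s bs ! i) else bs ! Suc j)"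
    proof (cases "Suc j = ?d")
      case False
      then show ?thesis
        using nth[of "Suc j"] that by simp
    qed (use last in simp)
    also have "\<dots> = (\<Sum>i<length bs. companion g $$ (i, j) *s bs ! i)"
      using that by (intro companion_column[symmetric]) (simp_all add: v(1))
    finally show ?thesis .
  qed
  then show "matrix_in_basis scale bs u (companion g)"
    by (auto simp: matrix_in_basis_def v(1) companion_def Let_def)
qed

lemma matrix_in_basis_companions:
  assumes "\<And>g. g \<in> set gs \<Longrightarrow> lead_coeff g = 1"
  shows "matrix_in_basis scale bs u (diag_block_mat (map companion gs)) \<longleftrightarrow>
    (\<exists>xs. map snd xs = gs \<and> bs = concat (map (\<lambda>(v, g). krylov v g) xs) \<and> (\<forall>(v, g)\<in>set xs. P g v = 0))"
  using assms
proof (induction gs arbitrary: bs)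
  case Nil
  then show ?case
    by (auto simp: matrix_in_basis_def)
next
  case (Cons g gs)
  let ?D = "diag_block_mat (map companion gs)"
  have g: "companion g \<in> carrier_mat (Polynomial.degree g) (Polynomial.degree g)"
    by (simp add: companion_def Let_def)
  have "square_mat ?D"
    by (rule diag_block_mat_square) (auto simp: companion_def Let_def)
  then have D: "?D \<in> carrier_mat (dim_row ?D) (dim_row ?D)"
    by auto
  have diag: "diag_block_mat (map companion (g # gs)) =
      four_block_mat (companion g) (0\<^sub>m (Polynomial.degree g) (dim_row ?D))
        (0\<^sub>m (dim_row ?D) (Polynomial.degree g)) ?D"
    by (simp only: list.map diag_block_mat.simps Let_def carrier_matD[OF g] carrier_matD(2)[OF D])
  have IH: "matrix_in_basis scale bs u ?D \<longleftrightarrow>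
    (\<exists>xs. map snd xs = gs \<and> bs = concat (map (\<lambda>(v, g). krylov v g) xs) \<and> (\<forall>(v, g)\<in>set xs. P g v = 0))" for bs
    using Cons by simp
  have g1: "lead_coeff g = 1"
    using Cons.prems by simp
  show ?case
  proof
    assume m: "matrix_in_basis scale bs u (diag_block_mat (map companion (g # gs)))"
    let ?l = "take (Polynomial.degree g) bs" and ?r = "drop (Polynomial.degree g) bs"
    have "length bs = Polynomial.degree g + dim_row ?D"
      using m[unfolded diag matrix_in_basis_def, THEN conjunct1, THEN carrier_matD(1)]
      by (simp only: index_mat_four_block carrier_matD[OF g])
    then have len: "length ?l = Polynomial.degree g" "length ?r = dim_row ?D"
      by auto
    have "matrix_in_basis scale ?l u (companion g) \<and> matrix_in_basis scale ?r u ?D"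
      using matrix_in_basis_append[of "companion g" ?l ?D ?r u] m g D
      unfolding diag len append_take_drop_id by blast
    then obtain v xs where "?l = krylov v g" "P g v = 0" and xs: "map snd xs = gs"
      "?r = concat (map (\<lambda>(v, g). krylov v g) xs)" "\<forall>(v, g)\<in>set xs. P g v = 0"
      unfolding IH matrix_in_basis_companion[OF g1] by blast
    moreover have "bs = ?l @ ?r"
      by simp
    ultimately show "\<exists>xs. map snd xs = g # gs \<and> bs = concat (map (\<lambda>(v, g). krylov v g) xs) \<and>
        (\<forall>(v, g)\<in>set xs. P g v = 0)"
      by (intro exI[of _ "(v, g) # xs"]) (simp del: append_take_drop_id)
  next
    assume "\<exists>xs. map snd xs = g # gs \<and> bs = concat (map (\<lambda>(v, g). krylov v g) xs) \<and>
        (\<forall>(v, g)\<in>set xs. P g v = 0)"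
    then obtain v xs where xs: "map snd xs = gs" "bs = krylov v g @ concat (map (\<lambda>(v, g). krylov v g) xs)"
      "P g v = 0" "\<forall>(v, g)\<in>set xs. P g v = 0"
      by (auto simp: map_eq_Cons_conv)
    let ?r = "concat (map (\<lambda>(v, g). krylov v g) xs)"
    have 1: "matrix_in_basis scale (krylov v g) u (companion g)" "matrix_in_basis scale ?r u ?D"
      unfolding IH matrix_in_basis_companion[OF g1] using xs by blast+
    from 1(2)[unfolded matrix_in_basis_def, THEN conjunct1, THEN carrier_matD(1)]
    have len: "length ?r = dim_row ?D"
      by (rule sym)
    have "matrix_in_basis scale (krylov v g @ ?r) u
        (four_block_mat (companion g) (0\<^sub>m (length (krylov v g)) (length ?r))
          (0\<^sub>m (length ?r) (length (krylov v g))) ?D)"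
      by (subst matrix_in_basis_append) (simp_all only: length_krylov len g D 1 simp_thms)
    then show "matrix_in_basis scale bs u (diag_block_mat (map companion (g # gs)))"
      unfolding diag xs(2) by (simp only: len length_krylov)
  qed
qed

text \<open>Forgets generators and order, so that elementary divisors and invariant factors become
  multisets that the next lemmas transform into each other.\<close>

definition decomposes_as :: "'a poly multiset \<Rightarrow> bool" where
  "decomposes_as G \<longleftrightarrow> (\<exists>M. image_mset snd M = G \<and> cyclic_decomposition M)"

lemma represented_companions_iff:
  assumes "\<And>g. g \<in> set gs \<Longrightarrow> lead_coeff g = 1"
  shows "represented scale u (diag_block_mat (map companion gs)) \<longleftrightarrow> decomposes_as (mset gs)"
proof
  have mat: "matrix_in_basis scale bs u (diag_block_mat (map companion gs)) \<longleftrightarrow>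
    (\<exists>xs. map snd xs = gs \<and> bs = concat (map (\<lambda>(v, g). krylov v g) xs) \<and> (\<forall>(v, g)\<in>set xs. P g v = 0))" for bs
    by (rule matrix_in_basis_companions) (rule assms)
  {
  assume "represented scale u (diag_block_mat (map companion gs))"
  then obtain xs where xs: "map snd xs = gs" "\<forall>(v, g)\<in>set xs. P g v = 0"
    "basis_of scale UNIV (concat (map (\<lambda>(v, g). krylov v g) xs))"
    unfolding represented_on_def mat by blast
  moreover have "lead_coeff g = 1" if "(v, g) \<in> set xs" for v g
    using that assms xs(1) by force
  ultimately have "cyclic_decomposition (mset xs)"
    by (subst cyclic_decomposition_iff_basis) auto
  then show "decomposes_as (mset gs)"
    unfolding decomposes_as_def using xs(1) by (intro exI[of _ "mset xs"]) (simp flip: mset_map)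
  next
  assume "decomposes_as (mset gs)"
  then obtain M where M: "image_mset snd M = mset gs" "cyclic_decomposition M"
    by (auto simp: decomposes_as_def)
  obtain xs where xs: "map snd xs = gs" "mset xs = M"
    by (rule ex_list_of_image_mset[OF M(1)])
  have cyc: "lead_coeff g = 1" "P g v = 0" if "(v, g) \<in> set xs" for v g
    using cyclic_decompositionD(1,2)[OF M(2)] that by (auto simp flip: xs(2))
  have "cyclic_decomposition (mset xs) \<longleftrightarrow> basis_of scale UNIV (concat (map (\<lambda>(v, g). krylov v g) xs))"
    by (rule cyclic_decomposition_iff_basis) (fact cyc)+
  then have "basis_of scale UNIV (concat (map (\<lambda>(v, g). krylov v g) xs))"
    using M(2) xs(2) by simp
  moreover have "\<forall>(v, g)\<in>set xs. P g v = 0"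
    using cyc(2) by blast
  ultimately show "represented scale u (diag_block_mat (map companion gs))"
    unfolding represented_on_def mat
    using xs(1) by blast
  }
qed

lemma decomposes_as_one: "decomposes_as (add_mset 1 G) \<longleftrightarrow> decomposes_as G"
proof
  assume "decomposes_as (add_mset 1 G)"
  then obtain M where M: "image_mset snd M = add_mset 1 G" "cyclic_decomposition M"
    by (auto simp: decomposes_as_def)
  obtain N v where N: "M = add_mset (v, 1) N" "image_mset snd N = G"
    using msed_map_invR[OF M(1)] by force
  note cyc = cyclic_decompositionD[OF M(2), unfolded N(1)]
  have v: "v = 0"
    using cyc(2)[of v 1] by simp
  have "cyclic_decomposition N"
  proof (rule cyclic_decompositionI)
    fix S assume S: "subspace S" "\<And>x. x \<in> S \<Longrightarrow> u x \<in> S" "\<And>v g. (v, g) \<in># N \<Longrightarrow> v \<in> S"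
    show "S = UNIV"
      by (rule cyc(3)[OF S(1,2)]) (use S v in \<open>auto simp: subspace_0\<close>)
  qed (use cyc(1,2,4) in auto)
  then show "decomposes_as G"
    using N by (auto simp: decomposes_as_def)
next
  assume "decomposes_as G"
  then obtain M where M: "image_mset snd M = G" "cyclic_decomposition M"
    by (auto simp: decomposes_as_def)
  note cyc = cyclic_decompositionD[OF M(2)]
  have "cyclic_decomposition (add_mset (0, 1) M)"
  proof (rule cyclic_decompositionI)
    fix S assume S: "subspace S" "\<And>x. x \<in> S \<Longrightarrow> u x \<in> S" "\<And>v g. (v, g) \<in># add_mset (0, 1) M \<Longrightarrow> v \<in> S"
    show "S = UNIV"
      by (rule cyc(3)[OF S(1,2)]) (use S in auto)
  qed (use cyc(1,2,4) in auto)
  then show "decomposes_as (add_mset 1 G)"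
    using M(1) by (auto simp: decomposes_as_def intro!: exI[of _ "add_mset (0, 1) M"])
qed

text \<open>The Chinese remainder theorem for cyclic modules, as an exchange inside a decomposition;
  total degree is unchanged, so only generation has to be transferred.\<close>

lemma decomposes_as_mult:
  assumes "comaximal g h" and "lead_coeff g = 1" and "lead_coeff h = 1"
  shows "decomposes_as (add_mset (g * h) G) \<longleftrightarrow> decomposes_as (add_mset g (add_mset h G))"
proof
  obtain a b where ab: "a * g + b * h = 1"
    using assms(1) by (auto simp: comaximal_def)
  have deg: "Polynomial.degree (g * h) = Polynomial.degree g + Polynomial.degree h"
    using assms by (intro degree_mult_eq) auto
  {
    assume "decomposes_as (add_mset (g * h) G)"
    then obtain M where M: "image_mset snd M = add_mset (g * h) G" "cyclic_decomposition M"
      by (auto simp: decomposes_as_def)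
    obtain N v where N: "M = add_mset (v, g * h) N" "image_mset snd N = G"
      using msed_map_invR[OF M(1)] by force
    note cyc = cyclic_decompositionD[OF M(2), unfolded N(1)]
    have v: "P g (P h v) = 0"
      using cyc(2)[of v "g * h"] by (simp add: P_mult)
    \<comment> \<open>\<open>P h v\<close> is killed by \<open>g\<close> and \<open>P g v\<close> by
      \<open>h\<close>; the Bezout identity recovers \<open>v\<close> from both.\<close>
    let ?M = "add_mset (P h v, g) (add_mset (P g v, h) N)"
    have "cyclic_decomposition ?M"
    proof (rule cyclic_decompositionI)
      fix S assume S: "subspace S" "\<And>x. x \<in> S \<Longrightarrow> u x \<in> S" "\<And>v g. (v, g) \<in># ?M \<Longrightarrow> v \<in> S"
      have "P a (P g v) + P b (P h v) = v"
        using arg_cong[OF ab, of "\<lambda>f. P f v"] by (simp add: poly_endo_add P_mult)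
      moreover have gS: "P g v \<in> S" "P h v \<in> S"
        using S(3) by auto
      have "P a (P g v) \<in> S" "P b (P h v) \<in> S"
        by (rule poly_endo_closed[OF S(1)]; simp add: S(2) gS)+
      ultimately have "v \<in> S"
        using S(1) by (metis subspace_add)
      then show "S = UNIV"
        by (intro cyc(3)[OF S(1,2)]) (use S(3) in auto)
    next
      show "P g' v' = 0" if "(v', g') \<in># ?M" for v' g'
        using that cyc(2) v poly_endo_commute[OF linear_u] by auto
    qed (use cyc(1,4) assms deg in auto)
    then show "decomposes_as (add_mset g (add_mset h G))"
      unfolding decomposes_as_def using N(2) by (intro exI[of _ ?M]) simp
  next
    assume "decomposes_as (add_mset g (add_mset h G))"
    then obtain M where M: "image_mset snd M = add_mset g (add_mset h G)" "cyclic_decomposition M"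
      by (auto simp: decomposes_as_def)
    obtain N' v where N': "M = add_mset (v, g) N'" "image_mset snd N' = add_mset h G"
      using msed_map_invR[OF M(1)] by force
    obtain N w where N: "N' = add_mset (w, h) N" "image_mset snd N = G"
      using msed_map_invR[OF N'(2)] by force
    note cyc = cyclic_decompositionD[OF M(2), unfolded N' N(1)]
    have vw: "P g v = 0" "P h w = 0"
      using cyc(2) by auto
    \<comment> \<open>\<open>a * g\<close> kills \<open>v\<close> and fixes \<open>w\<close>, while
      \<open>b * h\<close> kills \<open>w\<close> and fixes \<open>v\<close>; so the sum generates
      both summands.\<close>
    let ?M = "add_mset (v + w, g * h) N"
    have "cyclic_decomposition ?M"
    proof (rule cyclic_decompositionI)
      fix S assume S: "subspace S" "\<And>x. x \<in> S \<Longrightarrow> u x \<in> S" "\<And>v g. (v, g) \<in># ?M \<Longrightarrow> v \<in> S"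
      have vwS: "P (a * g) (v + w) \<in> S" "P (b * h) (v + w) \<in> S"
        by (rule poly_endo_closed[OF S(1)]; simp add: S(2) S(3)[of "v + w" "g * h"])+
      have "P a (P g w) + P b (P h w) = w" "P a (P g v) + P b (P h v) = v"
        using arg_cong[OF ab, of "\<lambda>f. P f w"] arg_cong[OF ab, of "\<lambda>f. P f v"]
        by (simp_all add: poly_endo_add P_mult)
      then have "w \<in> S" "v \<in> S"
        using vwS by (simp_all add: P_mult P.add vw)
      then show "S = UNIV"
        by (intro cyc(3)[OF S(1,2)]) (use S(3) in auto)
    next
      have "P (g * h) (v + w) = P h (P g v) + P g (P h w)"
        by (simp add: P_mult P.add poly_endo_commute[OF linear_u, of g h v])
      then show "P g' v' = 0" if "(v', g') \<in># ?M" for v' g'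
        using that cyc(2) vw by auto
    next
      show "lead_coeff g' = 1" if "(v', g') \<in># ?M" for v' g'
        using that cyc(1) lead_coeff_mult[of g h] assms by auto
    qed (use cyc(4) deg in simp)
    then show "decomposes_as (add_mset (g * h) G)"
      unfolding decomposes_as_def using N(2) by (intro exI[of _ ?M]) simp
  }
qed

lemma decomposes_as_image_mult:
  assumes "\<And>i. i \<in># I \<Longrightarrow> comaximal (f i) (g i)" and "\<And>i. i \<in># I \<Longrightarrow> lead_coeff (f i) = 1"
    and "\<And>i. i \<in># I \<Longrightarrow> lead_coeff (g i) = 1"
  shows "decomposes_as (image_mset (\<lambda>i. f i * g i) I + G) \<longleftrightarrow>
    decomposes_as (image_mset f I + image_mset g I + G)"
  using assms
proof (induction I arbitrary: G)
  case (add i I)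
  have "decomposes_as (image_mset (\<lambda>i. f i * g i) (add_mset i I) + G) \<longleftrightarrow>
      decomposes_as (add_mset (f i) (add_mset (g i) (image_mset (\<lambda>i. f i * g i) I + G)))"
    using add.prems by (simp add: decomposes_as_mult)
  also have "\<dots> \<longleftrightarrow> decomposes_as (image_mset (\<lambda>i. f i * g i) I + add_mset (f i) (add_mset (g i) G))"
    by simp
  also have "\<dots> \<longleftrightarrow> decomposes_as (image_mset f I + image_mset g I + add_mset (f i) (add_mset (g i) G))"
    using add.prems by (intro add.IH) auto
  finally show ?case
    by (simp add: add_mset_commute)
qed simp

text \<open>The common divisor d of f and g kills v as well. Replacing g by d leaves a generating
  family, and the dimension bound forbids d to have smaller degree than g.\<close>

lemma cyclic_decomposition_annihilator:
  assumes cyc: "cyclic_decomposition M" and vg: "(v, g) \<in># M" and f: "P f v = 0"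
  shows "g dvd f"
proof -
  note cyc = cyclic_decompositionD[OF cyc]
  obtain N where N: "M = add_mset (v, g) N"
    using multi_member_split[OF vg] by blast
  have g: "lead_coeff g = 1" "P g v = 0"
    using cyc(1,2) vg by auto
  then have "g \<noteq> 0"
    by auto
  then obtain d a b where d: "lead_coeff d = 1" "d dvd f" "d dvd g" "d = a * f + b * g"
    by (rule poly_bezout)
  have dv: "P d v = 0"
    by (simp add: d(4) poly_endo_add P_mult f g)
  let ?M = "add_mset (v, d) N"
  have "dim (UNIV :: 'v set) \<le> (\<Sum>(v, g)\<in>#?M. Polynomial.degree g)"
  proof (rule dim_le_sum_degree)
    show "\<forall>(v, g)\<in>#?M. lead_coeff g = 1 \<and> P g v = 0"
      using cyc(1,2) d(1) dv unfolding N by auto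
    show "S = UNIV" if S: "subspace S" "\<forall>x\<in>S. u x \<in> S" "\<forall>(v, g)\<in>#?M. v \<in> S" for S
      by (rule cyc(3)[OF S(1)]) (use S(2,3) in \<open>auto simp: N\<close>)
  qed
  then have "Polynomial.degree g \<le> Polynomial.degree d"
    using cyc(4) unfolding N by simp
  moreover obtain e where e: "g = d * e"
    using d(3) by (rule dvdE)
  ultimately have "Polynomial.degree e = 0"
    using \<open>g \<noteq> 0\<close> by (auto simp: degree_mult_eq)
  then obtain c where "e = [:c:]"
    by (rule degree_eq_zeroE)
  then have "g = Polynomial.smult c d"
    using e by simp
  then have "g = d"
    using g(1) d(1) by (metis lead_coeff_smult mult.right_neutral smult_1_left)
  then show ?thesis
    using d(2) by simp
qed

end

section \<open>Semilinear maps over the involution of an endomorphism\<close>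

context endomorphism
begin

lemma funpow_closed:
  assumes "\<And>x. x \<in> S \<Longrightarrow> f x \<in> S" and "x \<in> S"
  shows "(f ^^ n) x \<in> S"
  by (induction n) (auto simp: assms)

text \<open>Coefficients sit on indices rather than on vectors, so that a repeated vector already
  counts as a relation.\<close>

lemma independent_family_card_le:
  assumes "finite E" and "\<And>e. e \<in> E \<Longrightarrow> b e \<in> W"
    and indep: "\<And>c. (\<Sum>e\<in>E. c e *s b e) = 0 \<Longrightarrow> \<forall>e\<in>E. c e = 0"
  shows "card E \<le> dim W"
proof -
  have inj: "inj_on b E"
  proof (rule inj_onI, rule ccontr)
    fix e e' assume e: "e \<in> E" "e' \<in> E" "b e = b e'" "e \<noteq> e'"
    define c :: "_ \<Rightarrow> 'a" where "c = (\<lambda>x. if x = e then 1 else if x = e' then - 1 else 0)"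
    have "(\<Sum>x\<in>E. c x *s b x) = (\<Sum>x\<in>{e, e'}. c x *s b x)"
      using e assms(1) by (intro sum.mono_neutral_right) (auto simp: c_def)
    also have "\<dots> = 0"
      using e by (simp add: c_def)
    finally show False
      using indep[of c] e(1) by (auto simp: c_def)
  qed
  have "independent (b ` E)"
  proof (rule independent_if_scalars_zero)
    fix f x assume "(\<Sum>x\<in>b ` E. f x *s x) = 0" "x \<in> b ` E"
    then show "f x = 0"
      using indep[of "f \<circ> b"] by (auto simp: sum.reindex[OF inj])
  qed (use assms(1) in simp)
  then have "card (b ` E) \<le> dim W"
    using assms(2) by (intro independent_card_le_dim) auto
  then show ?thesis
    by (simp add: card_image[OF inj])
qed

text \<open>Gathering the scalar coefficients of the iterates of \<open>w j\<close> into one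
  polynomial \<open>h j\<close> turns linear relations into relations over polynomials in u, the
  form in which \<sigma> can be brought in.\<close>

lemma sum_degree_le_dim:
  fixes d :: "'j \<Rightarrow> nat"
  assumes "finite J" and "\<And>j. j \<in> J \<Longrightarrow> w j \<in> W" and "\<And>x. x \<in> W \<Longrightarrow> u x \<in> W"
    and indep: "\<And>h. \<lbrakk>\<And>j. j \<in> J \<Longrightarrow> h j \<noteq> 0 \<Longrightarrow> Polynomial.degree (h j) < d j;
      (\<Sum>j\<in>J. P (h j) (w j)) = 0\<rbrakk> \<Longrightarrow> \<forall>j\<in>J. h j = 0"
  shows "(\<Sum>j\<in>J. d j) \<le> dim W"
proof -
  let ?E = "Sigma J (\<lambda>j. {..<d j})" and ?b = "\<lambda>(j, i). (u ^^ i) (w j)"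
  have "card ?E \<le> dim W"
  proof (rule independent_family_card_le)
    show "?b e \<in> W" if "e \<in> ?E" for e
      using that assms(2,3) by (auto intro: funpow_closed)
    show "\<forall>e\<in>?E. c e = 0" if c: "(\<Sum>e\<in>?E. c e *s ?b e) = 0" for c
    proof -
      define h where "h j = (\<Sum>i<d j. Polynomial.monom (c (j, i)) i)" for j
      have coeff: "Polynomial.coeff (h j) i = (if i < d j then c (j, i) else 0)" for j i
        by (simp add: h_def coeff_sum)
      have "P (h j) (w j) = (\<Sum>i<d j. c (j, i) *s (u ^^ i) (w j))" for j
        by (simp add: h_def poly_endo_sum poly_endo_monom)
      then have "(\<Sum>j\<in>J. P (h j) (w j)) = 0"
        using c assms(1) by (simp add: sum.Sigma case_prod_unfold)
      moreover have "Polynomial.degree (h j) < d j" if "h j \<noteq> 0" for j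
      proof -
        have "Polynomial.coeff (h j) (Polynomial.degree (h j)) \<noteq> 0"
          using that by simp
        then show ?thesis
          unfolding coeff by (metis (full_types))
      qed
      ultimately have "\<forall>j\<in>J. h j = 0"
        by (intro indep) auto
      then show ?thesis
        using coeff by (metis (no_types, lifting) SigmaE coeff_0 lessThan_iff)
    qed
  qed (use assms(1) in auto)
  then show ?thesis
    using assms(1) by simp
qed

text \<open>The substitution z -> \<delta>/z exchanges the roots of the quadratic: its value at
  \<delta>/z is \<delta>/z^2 times its value at z.\<close>

lemma poly_endo_reciprocal:
  assumes ui: "Vector_Spaces.linear scale scale ui" "\<And>x. u (ui x) = x" "\<And>x. ui (u x) = x"
  shows "poly_endo scale [:\<delta>, - T, 1:] (\<lambda>x. \<delta> *s ui x) x = \<delta> *s ui (ui (P [:\<delta>, - T, 1:] x))"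
proof -
  interpret ui: Vector_Spaces.linear scale scale ui by fact
  show ?thesis
    by (simp add: poly_endo_pCons ui(2,3) ui.add ui.scale ui.neg ui.diff u.scale u.add u.diff algebra_simps)
qed

lemma poly_endo_reciprocal_power:
  assumes ui: "Vector_Spaces.linear scale scale ui" "\<And>x. u (ui x) = x" "\<And>x. ui (u x) = x"
    and "P ([:\<delta>, - T, 1:] ^ n) x = 0"
  shows "poly_endo scale ([:\<delta>, - T, 1:] ^ n) (\<lambda>x. \<delta> *s ui x) x = 0"
  using assms(4)
proof (induction n arbitrary: x)
  case (Suc n)
  interpret ui: Vector_Spaces.linear scale scale ui by fact
  have lin: "Vector_Spaces.linear scale scale (\<lambda>x. \<delta> *s ui x)"
    by (rule linear_selfI) (simp_all add: ui.add ui.scale scale_right_distrib mult.commute)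
  let ?f = "[:\<delta>, - T, 1:]"
  have ui_P: "ui (P f y) = P f (ui y)" for f y
    by (rule poly_endo_intertwine[OF ui(1)]) (simp add: ui)
  have "P (?f ^ n) (P ?f x) = 0"
    using Suc.prems by (simp only: power_Suc2 P_mult)
  then have "P (?f ^ n) (\<delta> *s ui (ui (P ?f x))) = 0"
    by (simp only: P.scale ui_P[symmetric] ui.zero scale_zero_right)
  then have "poly_endo scale (?f ^ n) (\<lambda>x. \<delta> *s ui x) (poly_endo scale ?f (\<lambda>x. \<delta> *s ui x) x) = 0"
    unfolding poly_endo_reciprocal[OF ui] by (rule Suc.IH)
  then show ?case
    by (simp only: power_Suc2 poly_endo_mult[OF lin])
qed simp

end

text \<open>The equation for \<open>\<sigma>\<^sup>2\<close> is \<open>\<sigma>\<^sup>2 = \<kappa> (c - T) (c - T')\<close> for the central element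
  \<open>c = u + \<delta> u\<inverse>\<close>, multiplied by \<open>u\<^sup>2\<close>; note that \<open>t\<^sup>2 - T t + \<delta>\<close> at \<open>u\<close> is \<open>u (c - T)\<close>.\<close>

locale semilinear_involution = endomorphism scale Basis u
  for scale :: "'a::field \<Rightarrow> 'v::ab_group_add \<Rightarrow> 'v" (infixr \<open>*s\<close> 75) and Basis :: "'v set"
    and u :: "'v \<Rightarrow> 'v" +
  fixes ui \<sigma> :: "'v \<Rightarrow> 'v" and \<delta> \<kappa> T T' :: 'a
  assumes linear_ui: "Vector_Spaces.linear scale scale ui"
    and linear_\<sigma>: "Vector_Spaces.linear scale scale \<sigma>"
    and u_ui [simp]: "u (ui x) = x" and ui_u [simp]: "ui (u x) = x"
    and \<delta>_nz: "\<delta> \<noteq> 0" and \<kappa>_nz: "\<kappa> \<noteq> 0"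
    and \<sigma>_u: "\<sigma> (u x) = \<delta> *s ui (\<sigma> x)"
    and \<sigma>_\<sigma>: "u (u (\<sigma> (\<sigma> x))) = \<kappa> *s P [:\<delta>, - T, 1:] (P [:\<delta>, - T', 1:] x)"
    and irreducible_F: "Factorial_Ring.irreducible [:\<delta>, - T, 1:]"
    and comaximal_F: "comaximal [:\<delta>, - T, 1:] [:\<delta>, - T', 1:]"
begin

sublocale ui: Vector_Spaces.linear scale scale ui
  by (rule linear_ui)

sublocale \<sigma>: Vector_Spaces.linear scale scale \<sigma>
  by (rule linear_\<sigma>)

section \<open>Coefficients in u and \<delta>/u, and their units on a primary component\<close>

definition F :: "'a poly" where "F = [:\<delta>, - T, 1:]"
definition F' :: "'a poly" where "F' = [:\<delta>, - T', 1:]"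

lemmas \<sigma>_\<sigma>_F = \<sigma>_\<sigma>[folded F_def F'_def]
  and irreducible_F' = irreducible_F[folded F_def]
  and comaximal_F_F' = comaximal_F[folded F_def F'_def]

lemma degree_F [simp]: "Polynomial.degree F = 2" and F_nz [simp]: "F \<noteq> 0"
  by (simp_all add: F_def)

text \<open>Polynomials in \<delta>/u, which is what a polynomial in u becomes on the other side of
  \<sigma>; crossing \<sigma> once more leads back to u.\<close>

abbreviation Q :: "'a poly \<Rightarrow> 'v \<Rightarrow> 'v" where
  "Q f \<equiv> poly_endo scale f (\<lambda>x. \<delta> *s ui x)"

lemma linear_Q_arg: "Vector_Spaces.linear scale scale (\<lambda>x. \<delta> *s ui x)"
  by (rule linear_selfI) (simp_all add: ui.add ui.scale scale_right_distrib mult.commute)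

sublocale Q: Vector_Spaces.linear scale scale "Q f" for f
  by (rule linear_poly_endo) (rule linear_Q_arg)

lemmas Q_mult = poly_endo_mult[OF linear_Q_arg]

lemma \<sigma>_P: "\<sigma> (P f x) = Q f (\<sigma> x)"
  by (rule poly_endo_intertwine[OF linear_\<sigma>]) (rule \<sigma>_u)

lemma \<sigma>_Q: "\<sigma> (Q f x) = P f (\<sigma> x)"
proof (rule poly_endo_intertwine[OF linear_\<sigma>])
  fix x
  have "u (\<sigma> x) = u (\<sigma> (u (ui x)))"
    by simp
  then show "\<sigma> (\<delta> *s ui x) = u (\<sigma> x)"
    by (simp add: \<sigma>_u \<sigma>.scale u.scale del: u_ui) (simp)
qed

lemma ui_P: "ui (P f x) = P f (ui x)"
  by (rule poly_endo_intertwine[OF linear_ui]) simp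

lemma Q_P: "Q f (P g x) = P g (Q f x)"
  by (rule poly_endo_intertwine[OF linear_P, symmetric]) (simp add: ui_P P.scale)

text \<open>A commutative ring of coefficients on which conjugation by \<sigma> acts by swapping the
  two entries.\<close>

definition R :: "'a poly \<Rightarrow> 'a poly \<Rightarrow> 'v \<Rightarrow> 'v" where
  "R f g x = P f (Q g x)"

lemma R_1 [simp]: "R 1 1 x = x"
  by (simp add: R_def)

lemma R_R: "R f g (R f' g' x) = R (f * f') (g * g') x"
  by (simp add: R_def P_mult Q_mult Q_P)

lemma linear_R: "Vector_Spaces.linear scale scale (R f g)"
  unfolding R_def by (rule linear_selfI) (simp_all add: P.add Q.add P.scale Q.scale)

sublocale R: Vector_Spaces.linear scale scale "R f g" for f g
  by (rule linear_R)

lemma \<sigma>_R: "\<sigma> (R f g x) = R g f (\<sigma> x)"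
  by (simp add: R_def \<sigma>_P \<sigma>_Q Q_P)

lemma \<sigma>_power_R:
  "(\<sigma> ^^ n) (R f g x) = (if even n then R f g ((\<sigma> ^^ n) x) else R g f ((\<sigma> ^^ n) x))"
  by (induction n) (auto simp: \<sigma>_R)

text \<open>Coprimality to the same \<open>F\<close> is the right condition for the second entry
  too, because powers of \<open>F\<close> that kill a vector at u also kill it at
  \<delta>/u.\<close>

definition unit_pair :: "'a poly \<Rightarrow> 'a poly \<Rightarrow> bool" where
  "unit_pair f g \<longleftrightarrow> comaximal f F \<and> comaximal g F"

lemma comaximal_1: "comaximal 1 f"
  unfolding comaximal_def by (metis add.right_neutral mult_1 mult_zero_left)

lemma comaximal_\<delta>X: "comaximal [:0, 1:] F"
proof -
  have "[:T / \<delta>, - 1 / \<delta>:] * [:0, 1:] + [:1 / \<delta>:] * F = 1"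
    using \<delta>_nz by (simp add: F_def one_pCons field_simps)
  then show ?thesis
    unfolding comaximal_def by blast
qed

lemma comaximal_const: "c \<noteq> 0 \<Longrightarrow> comaximal [:c:] f"
  unfolding comaximal_def
  by (rule exI[of _ "[:1 / c:]"], rule exI[of _ 0]) (simp add: one_pCons)

definition stable :: "'v set \<Rightarrow> bool" where
  "stable S \<longleftrightarrow> subspace S \<and> (\<forall>x\<in>S. u x \<in> S \<and> ui x \<in> S \<and> \<sigma> x \<in> S)"

lemma stableD:
  assumes "stable S"
  shows "subspace S" "x \<in> S \<Longrightarrow> u x \<in> S" "x \<in> S \<Longrightarrow> ui x \<in> S" "x \<in> S \<Longrightarrow> \<sigma> x \<in> S"
    "x \<in> S \<Longrightarrow> (\<sigma> ^^ n) x \<in> S" "x \<in> S \<Longrightarrow> R f g x \<in> S"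
proof -
  show 1: "subspace S" "x \<in> S \<Longrightarrow> u x \<in> S" "x \<in> S \<Longrightarrow> ui x \<in> S" "x \<in> S \<Longrightarrow> \<sigma> x \<in> S" for x
    using assms by (auto simp: stable_def)
  show "(\<sigma> ^^ n) x \<in> S" if "x \<in> S"
    by (induction n) (auto simp: that 1)
  show "R f g x \<in> S" if "x \<in> S"
    unfolding R_def
    by (intro poly_endo_closed) (auto simp: 1 that subspace_scale)
qed

context
  fixes N :: nat
begin

text \<open>The \<open>F\<close>-primary component once \<open>N\<close> is large. The exponent is
  positive so that a Bezout identity modulo the power can be read modulo \<open>F\<close>.\<close>

definition W :: "'v set" where
  "W = {x. P (F ^ Suc N) x = 0}"

lemma Q_F_power: "P (F ^ n) x = 0 \<Longrightarrow> Q (F ^ n) x = 0"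
  unfolding F_def by (rule poly_endo_reciprocal_power[OF linear_ui u_ui ui_u])

lemma stable_W: "stable W"
  unfolding stable_def
proof (intro conjI ballI)
  show "subspace W"
    unfolding W_def by (rule P.subspace_kernel)
  fix x assume x: "x \<in> W"
  show "u x \<in> W"
    using x poly_endo_intertwine[OF linear_u, of u u "F ^ Suc N" x] by (auto simp: W_def)
  show "ui x \<in> W"
    using x ui_P[of "F ^ Suc N" x] by (auto simp: W_def)
  show "\<sigma> x \<in> W"
    using x \<sigma>_Q[of "F ^ Suc N" x] Q_F_power[of "Suc N" x] by (auto simp: W_def)
qed

text \<open>One Bezout coefficient inverts \<open>f\<close> at u and at \<delta>/u simultaneously,
  as the power of \<open>F\<close> vanishes on \<open>W\<close> at both.\<close>

lemma inverse_on_W: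
  assumes "comaximal f F"
  obtains g where "comaximal g F" and "\<And>x. x \<in> W \<Longrightarrow> P (g * f) x = x" and "\<And>x. x \<in> W \<Longrightarrow> Q (g * f) x = x"
proof -
  have "comaximal f (F ^ Suc N)"
    using comaximal_power[OF assms, of 1 "Suc N"] by simp
  then obtain a b where ab: "a * f + b * F ^ Suc N = 1"
    by (auto simp: comaximal_def)
  show thesis
  proof
    have "f * a + (b * F ^ N) * F = 1"
      using ab by (simp add: mult_ac)
    then show "comaximal a F"
      unfolding comaximal_def by blast
    fix x assume "x \<in> W"
    then have "P (F ^ Suc N) x = 0" "Q (F ^ Suc N) x = 0"
      using Q_F_power[of "Suc N" x] by (auto simp: W_def)
    then have "P (a * f + b * F ^ Suc N) x = P (a * f) x" "Q (a * f + b * F ^ Suc N) x = Q (a * f) x"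
      by (simp_all only: poly_endo_add P_mult[of b] Q_mult[of b] P.zero Q.zero add_0_right)
    then show "P (a * f) x = x" "Q (a * f) x = x"
      unfolding ab by simp_all
  qed
qed

lemma unit_pair_inverse:
  assumes "unit_pair f g"
  obtains f' g' where "unit_pair f' g'" and "\<And>x. x \<in> W \<Longrightarrow> R f' g' (R f g x) = x"
proof -
  obtain f' where f': "comaximal f' F" "\<And>x. x \<in> W \<Longrightarrow> P (f' * f) x = x"
    using assms inverse_on_W unfolding unit_pair_def by metis
  obtain g' where g': "comaximal g' F" "\<And>x. x \<in> W \<Longrightarrow> Q (g' * g) x = x"
    using assms inverse_on_W unfolding unit_pair_def by metis
  show thesis
    using f' g' by (intro that[of f' g']) (simp_all add: unit_pair_def R_R, simp add: R_def)
qed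

text \<open>On \<open>W\<close> the other quadratic \<open>F'\<close> is invertible, so the equation
  for \<sigma>\<sigma> can be solved for \<open>F\<close> at u. Powers follow because
  \<sigma>\<sigma> commutes with coefficients.\<close>

lemma P_F_power:
  obtains a where "comaximal a F" and "\<And>k x. x \<in> W \<Longrightarrow> P (F ^ k) x = R (a ^ k) 1 ((\<sigma> ^^ (2 * k)) x)"
proof -
  obtain g where g: "comaximal g F" "\<And>x. x \<in> W \<Longrightarrow> P (g * F') x = x"
    using inverse_on_W[of F'] comaximal_commute[OF comaximal_F_F'] by metis
  \<comment> \<open>This is t^2 g / \<kappa>, where \<open>g\<close> inverts \<open>F'\<close> on
    \<open>W\<close>; the factor t^2 comes from the two u in front of \<sigma>\<sigma>.\<close>
  define a where "a = [:1 / \<kappa>:] * ([:0, 1:] * ([:0, 1:] * g))"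
  have "comaximal a F"
    unfolding a_def using \<kappa>_nz g(1) by (intro comaximal_mult comaximal_const comaximal_\<delta>X) auto
  moreover have one: "P F x = R a 1 (\<sigma> (\<sigma> x))" if x: "x \<in> W" for x
  proof -
    have "P F x \<in> W"
      using stableD(6)[OF stable_W x, of F 1] by (simp add: R_def)
    then have "P F x = P g (P F' (P F x))"
      using g(2) P_mult by simp
    also have "P F' (P F x) = (1 / \<kappa>) *s u (u (\<sigma> (\<sigma> x)))"
      using \<kappa>_nz by (simp add: \<sigma>_\<sigma>_F poly_endo_commute[OF linear_u, of F' F])
    also have "P g \<dots> = P a (\<sigma> (\<sigma> x))"
      unfolding a_def P_mult by (simp add: poly_endo_pCons P.scale poly_endo_intertwine[OF linear_u, of u u g])
    finally show ?thesis
      by (simp add: R_def)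
  qed
  have "P (F ^ k) x = R (a ^ k) 1 ((\<sigma> ^^ (2 * k)) x)" if x: "x \<in> W" for k x
  proof (induction k)
    case (Suc k)
    have s: "(\<sigma> ^^ (2 * k)) x \<in> W"
      by (rule stableD(5)[OF stable_W x])
    have "P (F ^ Suc k) x = P F (R (a ^ k) 1 ((\<sigma> ^^ (2 * k)) x))"
      by (simp only: power_Suc P_mult Suc)
    also have "\<dots> = R (a ^ k) 1 (R F 1 ((\<sigma> ^^ (2 * k)) x))"
      unfolding R_R by (simp add: R_def P_mult poly_endo_commute[OF linear_u, of F])
    also have "R F 1 ((\<sigma> ^^ (2 * k)) x) = R a 1 (\<sigma> (\<sigma> ((\<sigma> ^^ (2 * k)) x)))"
      using one[OF s] by (simp add: R_def)
    finally show ?case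
      by (simp add: R_R mult.commute)
  qed simp
  ultimately show thesis
    by (intro that)
qed

text \<open>The vanishing power of \<open>F\<close> is a unit times this power of \<sigma>.\<close>

lemma \<sigma>_nilpotent:
  assumes "x \<in> W"
  shows "(\<sigma> ^^ (2 * Suc N)) x = 0"
proof -
  obtain a where a: "comaximal a F" "\<And>k x. x \<in> W \<Longrightarrow> P (F ^ k) x = R (a ^ k) 1 ((\<sigma> ^^ (2 * k)) x)"
    by (rule P_F_power) blast
  have "unit_pair (a ^ Suc N) 1"
    unfolding unit_pair_def using comaximal_power[OF a(1), of "Suc N" 1] comaximal_1 by simp
  then obtain f g where fg: "\<And>x. x \<in> W \<Longrightarrow> R f g (R (a ^ Suc N) 1 x) = x"
    by (rule unit_pair_inverse) blast
  have "R (a ^ Suc N) 1 ((\<sigma> ^^ (2 * Suc N)) x) = 0"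
    using a(2)[OF assms, of "Suc N"] assms by (simp only: W_def mem_Collect_eq)
  then show ?thesis
    using fg[OF stableD(5)[OF stable_W assms], of "2 * Suc N"] by (simp only: R.zero)
qed

text \<open>Split off the largest power \<open>F ^ k\<close>; the cofactor is a unit on
  \<open>W\<close>. As \<open>F\<close> has degree 2, the exponent 2k of \<sigma> is bounded by the
  degree of \<open>f\<close>.\<close>

lemma P_eq_unit_\<sigma>_power:
  assumes "f \<noteq> 0"
  obtains k a b where "2 * k \<le> Polynomial.degree f" and "unit_pair a b"
    and "\<And>x. x \<in> W \<Longrightarrow> P f x = R a b ((\<sigma> ^^ (2 * k)) x)"
proof -
  have "\<exists>k g. f = F ^ k * g \<and> \<not> F dvd g"
    using assms by (intro ex_power_factor) simp_all
  then obtain k g where kg: "f = F ^ k * g" "\<not> F dvd g"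
    by blast
  then have "g \<noteq> 0"
    by auto
  then have deg: "2 * k \<le> Polynomial.degree f"
    unfolding kg(1) by (subst degree_mult_eq) (simp_all add: degree_power_eq)
  have g: "comaximal g F"
    using irreducible_comaximal[OF irreducible_F' kg(2)] by (rule comaximal_commute)
  obtain a where a: "comaximal a F" "\<And>k x. x \<in> W \<Longrightarrow> P (F ^ k) x = R (a ^ k) 1 ((\<sigma> ^^ (2 * k)) x)"
    by (rule P_F_power) blast
  have "unit_pair (g * a ^ k) 1"
    unfolding unit_pair_def using comaximal_mult[OF g comaximal_power[OF a(1), of k 1, simplified]] comaximal_1 by simp
  moreover have "P f x = R (g * a ^ k) 1 ((\<sigma> ^^ (2 * k)) x)" if "x \<in> W" for x
    using a(2)[OF that, of k] by (simp add: kg(1) P_mult poly_endo_commute[OF linear_u, of "F ^ k"] R_def)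
  ultimately show thesis
    using deg that by blast
qed

end

end

lemma image_mset_sum_mset: "image_mset f (\<Sum>i\<in>#A. g i) = (\<Sum>i\<in>#A. image_mset f (g i))"
  by (induction A) auto

lemma sum_mset_sum_mset: "\<Sum>\<^sub># (\<Sum>i\<in>#A. g i) = (\<Sum>i\<in>#A. \<Sum>\<^sub># (g i))"
  by (induction A) auto

context endomorphism
begin

text \<open>In finite dimension an injective map sends a stable subspace onto itself.\<close>

lemma ex_inverse_closed:
  assumes "\<And>x. ui (u x) = x" and "\<And>x. u (ui x) = x" and S: "subspace S" "\<And>x. x \<in> S \<Longrightarrow> u x \<in> S"
    and x: "x \<in> S"
  shows "ui x \<in> S"
proof -
  interpret finite_dimensional_vector_space_pair_1 scale Basis scale
    by unfold_locales
  have "inj u"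
    by (rule injI) (metis assms(1))
  have "dim (u ` S) = dim S"
    by (rule dim_image_eq[OF linear_u]) (use \<open>inj u\<close> in \<open>auto intro: inj_on_subset\<close>)
  then have "u ` S = S"
    using S by (intro subspace_dim_equal u.subspace_image) auto
  then obtain y where "y \<in> S" "x = u y"
    using x by blast
  then show ?thesis
    by (simp add: assms(1))
qed

end

section \<open>Generators of least total \<sigma>-length\<close>

context semilinear_involution
begin

text \<open>\<open>m i\<close> only bounds the \<sigma>-order of \<open>v i\<close>; it is
  minimising the sum of the \<open>m i\<close> that excludes relations.\<close>

definition \<sigma>_generators :: "nat \<Rightarrow> nat \<Rightarrow> (nat \<Rightarrow> 'v) \<Rightarrow> (nat \<Rightarrow> nat) \<Rightarrow> bool" where
  "\<sigma>_generators N n v m \<longleftrightarrow> (\<forall>i<n. v i \<in> W N \<and> (\<sigma> ^^ m i) (v i) = 0) \<and>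
     (\<forall>S. stable S \<longrightarrow> (\<forall>i<n. v i \<in> S) \<longrightarrow> W N \<subseteq> S)"

lemma ex_\<sigma>_generators: "\<exists>n v m. \<sigma>_generators N n v m"
proof -
  obtain B where B: "B \<subseteq> W N" "independent B" "W N \<subseteq> span B"
    by (rule basis_exists[of "W N"]) blast
  obtain bs where bs: "set bs = B"
    using finite_list[OF finiteI_independent[OF B(2)]] by blast
  have "\<sigma>_generators N (length bs) (\<lambda>i. bs ! i) (\<lambda>_. 2 * Suc N)"
    unfolding \<sigma>_generators_def
  proof (intro conjI allI impI)
    fix i assume "i < length bs"
    then show "bs ! i \<in> W N"
      using B(1) bs by auto
    then show "(\<sigma> ^^ (2 * Suc N)) (bs ! i) = 0"
      by (rule \<sigma>_nilpotent)
  next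
    fix S assume S: "stable S" "\<forall>i<length bs. bs ! i \<in> S"
    then have "B \<subseteq> S"
      unfolding bs[symmetric] by (auto simp: in_set_conv_nth)
    then show "W N \<subseteq> S"
      using span_minimal[OF _ stableD(1)[OF S(1)]] B(3) by blast
  qed
  then show ?thesis
    by blast
qed

text \<open>Modulo a stable subspace a unit combination whose leading term is \<open>y\<close> and whose other terms
  are higher \<open>\<sigma>\<close>-iterates of \<open>y\<close> is as good as \<open>y\<close>, as \<open>\<sigma>\<close> is nilpotent.\<close>

lemma mem_stable_of_unit_combination:
  assumes S: "stable S" and y: "y \<in> W N" and f: "unit_pair f g" and r: "\<And>j. j \<in> J \<Longrightarrow> r j > 0"
    and sum: "R f g y + (\<Sum>j\<in>J. R (a j) (b j) ((\<sigma> ^^ r j) y)) \<in> S"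
  shows "y \<in> S"
proof -
  \<comment> \<open>Descending induction on \<open>l\<close>, with \<open>t\<close> measuring the
    distance to the nilpotency bound: under \<sigma>^l all other terms of the combination are
    already in \<open>S\<close>, leaving a unit multiple of \<sigma>^l y.\<close>
  have "(\<sigma> ^^ l) y \<in> S" if "2 * Suc N \<le> l + t" for l t
    using that
  proof (induction t arbitrary: l)
    case 0
    have "(\<sigma> ^^ l) y = (\<sigma> ^^ (l - 2 * Suc N)) ((\<sigma> ^^ (2 * Suc N)) y)"
      using 0 funpow_add[of "l - 2 * Suc N" "2 * Suc N" \<sigma>] by (simp del: mult_Suc_right mult_Suc)
    also have "\<dots> = 0"
      by (simp only: \<sigma>_nilpotent[OF y] module_hom.zero[OF linear_funpow[OF linear_\<sigma>, unfolded linear_iff_module_hom]])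
    finally show ?case
      using stableD(1)[OF S] by (simp add: subspace_0)
  next
    case (Suc t)
    interpret \<sigma>l: Vector_Spaces.linear scale scale "\<sigma> ^^ l"
      by (rule linear_funpow[OF linear_\<sigma>])
    have "(\<sigma> ^^ l) (R (a j) (b j) ((\<sigma> ^^ r j) y)) \<in> S" if "j \<in> J" for j
    proof -
      have "(\<sigma> ^^ (l + r j)) y \<in> S"
        using Suc.prems r[OF that] by (intro Suc.IH) simp
      then have "(\<sigma> ^^ l) ((\<sigma> ^^ r j) y) \<in> S"
        by (simp add: funpow_add)
      then show ?thesis
        by (auto simp: \<sigma>_power_R intro: stableD(6)[OF S])
    qed
    then have "(\<Sum>j\<in>J. (\<sigma> ^^ l) (R (a j) (b j) ((\<sigma> ^^ r j) y))) \<in> S"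
      by (intro subspace_sum stableD(1)[OF S])
    moreover have "(\<sigma> ^^ l) (R f g y) + (\<Sum>j\<in>J. (\<sigma> ^^ l) (R (a j) (b j) ((\<sigma> ^^ r j) y))) \<in> S"
      using stableD(5)[OF S sum, of l] by (simp add: \<sigma>l.add \<sigma>l.sum)
    ultimately have "(\<sigma> ^^ l) (R f g y) \<in> S"
      using subspace_diff[OF stableD(1)[OF S]] by force
    moreover obtain f' g' where "unit_pair f' g'" "(\<sigma> ^^ l) (R f g y) = R f' g' ((\<sigma> ^^ l) y)"
      using f unfolding \<sigma>_power_R unit_pair_def by (metis (full_types))
    moreover obtain f'' g'' where "\<And>x. x \<in> W N \<Longrightarrow> R f'' g'' (R f' g' x) = x"
      using unit_pair_inverse[OF \<open>unit_pair f' g'\<close>] by metis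
    ultimately show ?case
      using stableD(6)[OF S, of _ f'' g''] stableD(5)[OF stable_W y, of l] by metis
  qed
  from this[where l = 0, OF le_add2] show ?thesis
    by simp
qed

text \<open>Pull the lowest power \<sigma>^s out of the relation. The remaining factor
  \<open>w\<close> is killed by \<sigma>^s and contains a generator with unit coefficient, so
  \<open>w\<close> can replace that generator, whose length drops to s.\<close>

lemma \<sigma>_generators_reduce:
  assumes gen: "\<sigma>_generators N n v m"
    and K: "finite K" "K \<noteq> {}" "\<And>j. j \<in> K \<Longrightarrow> fst j < n"
    and unit: "\<And>j. j \<in> K \<Longrightarrow> unit_pair (a j) (b j)"
    and r: "\<And>j. j \<in> K \<Longrightarrow> r j < m (fst j)" "\<And>j j'. j \<in> K \<Longrightarrow> j' \<in> K \<Longrightarrow> fst j = fst j' \<Longrightarrow> r j = r j' \<Longrightarrow> j = j'"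
    and sum: "(\<Sum>j\<in>K. R (a j) (b j) ((\<sigma> ^^ r j) (v (fst j)))) = 0"
  obtains v' m' where "\<sigma>_generators N n v' m'" and "(\<Sum>i<n. m' i) < (\<Sum>i<n. m i)"
proof -
  obtain j0 where j0: "j0 \<in> K" "\<And>j. j \<in> K \<Longrightarrow> r j0 \<le> r j"
    using ex_min_if_finite[of "r ` K"] K(1,2) by (metis (mono_tags, lifting) finite_imageI image_iff image_is_empty not_le)
  define s where "s = r j0"
  define i0 where "i0 = fst j0"
  \<comment> \<open>Moving \<sigma>^s across a coefficient swaps its entries when \<open>s\<close>
    is odd; the swap is undone in advance.\<close>
  define a' where "a' j = (if even s then a j else b j)" for j
  define b' where "b' j = (if even s then b j else a j)" for j
  define w where "w = (\<Sum>j\<in>K. R (a' j) (b' j) ((\<sigma> ^^ (r j - s)) (v (fst j))))"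
  interpret \<sigma>s: Vector_Spaces.linear scale scale "\<sigma> ^^ s"
    by (rule linear_funpow[OF linear_\<sigma>])
  have "(\<sigma> ^^ s) (R (a' j) (b' j) ((\<sigma> ^^ (r j - s)) (v (fst j)))) = R (a j) (b j) ((\<sigma> ^^ r j) (v (fst j)))"
    if "j \<in> K" for j
  proof -
    have "(\<sigma> ^^ s) ((\<sigma> ^^ (r j - s)) (v (fst j))) = (\<sigma> ^^ r j) (v (fst j))"
      using j0(2)[OF that] funpow_add[of s "r j - s" \<sigma>] by (simp add: s_def)
    then show ?thesis
      by (simp add: \<sigma>_power_R a'_def b'_def)
  qed
  then have w0: "(\<sigma> ^^ s) w = 0"
    unfolding w_def \<sigma>s.sum using sum by simp
  have vW: "v i \<in> W N" if "i < n" for i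
    using gen that by (auto simp: \<sigma>_generators_def)
  have i0: "i0 < n"
    using K(3) j0(1) by (simp add: i0_def)
  have wW: "w \<in> W N"
    unfolding w_def by (intro subspace_sum stableD[OF stable_W] vW K(3))
  have "\<sigma>_generators N n (v(i0 := w)) (m(i0 := s))"
    unfolding \<sigma>_generators_def
  proof (intro conjI allI impI)
    show "(v(i0 := w)) i \<in> W N" if "i < n" for i
      using that wW vW by simp
    show "(\<sigma> ^^ (m(i0 := s)) i) ((v(i0 := w)) i) = 0" if "i < n" for i
      using that w0 gen by (auto simp: \<sigma>_generators_def)
    fix S assume S: "stable S" "\<forall>i<n. (v(i0 := w)) i \<in> S"
    then have wS: "w \<in> S" and vS: "\<And>i. i < n \<Longrightarrow> i \<noteq> i0 \<Longrightarrow> v i \<in> S"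
      using i0 by (auto split: if_splits)
    let ?t = "\<lambda>j. R (a' j) (b' j) ((\<sigma> ^^ (r j - s)) (v (fst j)))"
    \<comment> \<open>The remaining terms at the replaced generator. Exponents at one generator are
      distinct, so these carry strictly higher powers of \<sigma>.\<close>
    let ?J = "{j \<in> K - {j0}. fst j = i0}"
    have "w = ?t j0 + (\<Sum>j\<in>K - {j0}. ?t j)"
      unfolding w_def by (rule sum.remove[OF K(1) j0(1)])
    also have "(\<Sum>j\<in>K - {j0}. ?t j) = (\<Sum>j\<in>?J. ?t j) + (\<Sum>j\<in>{j \<in> K - {j0}. fst j \<noteq> i0}. ?t j)"
      by (subst sum.union_disjoint[symmetric]) (use K(1) in \<open>auto intro: sum.cong\<close>)
    finally have "?t j0 + (\<Sum>j\<in>?J. ?t j) = w - (\<Sum>j\<in>{j \<in> K - {j0}. fst j \<noteq> i0}. ?t j)"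
      by (simp add: algebra_simps)
    moreover have "(\<Sum>j\<in>{j \<in> K - {j0}. fst j \<noteq> i0}. ?t j) \<in> S"
      by (intro subspace_sum stableD(1)[OF S(1)] stableD(6)[OF S(1)] stableD(5)[OF S(1)] vS) (auto intro: K(3))
    ultimately have "?t j0 + (\<Sum>j\<in>?J. ?t j) \<in> S"
      using subspace_diff[OF stableD(1)[OF S(1)] wS] by simp
    then have "R (a' j0) (b' j0) (v i0) + (\<Sum>j\<in>?J. R (a' j) (b' j) ((\<sigma> ^^ (r j - s)) (v i0))) \<in> S"
      by (simp add: i0_def s_def)
    moreover have "r j - s > 0" if j: "j \<in> ?J" for j
    proof -
      have "r j0 \<noteq> r j"
        using j j0(1) r(2)[of j0 j] by (auto simp: i0_def)
      then show ?thesis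
        using j0(2)[of j] j by (simp add: s_def)
    qed
    moreover have "unit_pair (a' j0) (b' j0)"
      using unit[OF j0(1)] by (auto simp: unit_pair_def a'_def b'_def)
    ultimately have "v i0 \<in> S"
      by (intro mem_stable_of_unit_combination[OF S(1) vW[OF i0], where J = ?J])
    then have "\<forall>i<n. v i \<in> S"
      using vS by metis
    then show "W N \<subseteq> S"
      using gen S(1) by (auto simp: \<sigma>_generators_def)
  qed
  moreover have "(\<Sum>i<n. (m(i0 := s)) i) < (\<Sum>i<n. m i)"
    using i0 r(1)[OF j0(1)] by (intro sum_strict_mono_ex1) (auto simp: s_def i0_def)
  ultimately show thesis
    by (rule that)
qed

text \<open>For a minimal system, the vectors \<open>v i\<close> and \<sigma> (v i) admit no
  relation with polynomial coefficients of degree below 2\<lceil>m/2\<rceil> and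
  2\<lfloor>m/2\<rfloor>; these bounds add up to 2m. A relation would become one in powers of
  \<sigma> and contradict minimality.\<close>

lemma ex_small_\<sigma>_generators: "\<exists>n v m. \<sigma>_generators N n v m \<and> 2 * (\<Sum>i<n. m i) \<le> dim (W N)"
proof -
  have "\<exists>n v m. \<sigma>_generators N n v m \<and> (\<forall>n' v' m'. \<sigma>_generators N n' v' m' \<longrightarrow> (\<Sum>i<n. m i) \<le> (\<Sum>i<n'. m' i))"
    using ex_has_least_nat[of "\<lambda>(n, v, m). \<sigma>_generators N n v m" _ "\<lambda>(n, v, m). \<Sum>i<n. m i"]
      ex_\<sigma>_generators[of N] by (simp add: split_paired_all) blast
  then obtain n v m where gen: "\<sigma>_generators N n v m"
    and least: "\<And>n' v' m'. \<sigma>_generators N n' v' m' \<Longrightarrow> (\<Sum>i<n. m i) \<le> (\<Sum>i<n'. m' i)"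
    by blast
  have vW: "v i \<in> W N" if "i < n" for i
    using gen that by (auto simp: \<sigma>_generators_def)
  let ?J = "{..<n} \<times> {0, 1::nat}"
  define d where "d = (\<lambda>(i, e :: nat). if e = 0 then 2 * ((m i + 1) div 2) else 2 * (m i div 2))"
  define w where "w = (\<lambda>(i, e :: nat). (\<sigma> ^^ e) (v i))"
  have two_halves: "2 * (Suc k div 2) + 2 * (k div 2) = 2 * k" for k
    by presburger
  have "(\<Sum>j\<in>?J. d j) = (\<Sum>i<n. 2 * m i)"
    unfolding sum.cartesian_product[symmetric, of "\<lambda>i e. d (i, e)", simplified]
    by (intro sum.cong) (auto simp: d_def two_halves)
  moreover have "(\<Sum>j\<in>?J. d j) \<le> dim (W N)"
  proof (rule sum_degree_le_dim)
    show "w j \<in> W N" if "j \<in> ?J" for j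
      using that vW by (auto simp: w_def intro!: stableD[OF stable_W])
    show "u x \<in> W N" if "x \<in> W N" for x
      using that by (rule stableD[OF stable_W])
    show "\<forall>j\<in>?J. h j = 0"
      if deg: "\<And>j. j \<in> ?J \<Longrightarrow> h j \<noteq> 0 \<Longrightarrow> Polynomial.degree (h j) < d j"
        and sum: "(\<Sum>j\<in>?J. P (h j) (w j)) = 0" for h
    proof (rule ccontr)
      assume nz: "\<not> (\<forall>j\<in>?J. h j = 0)"
      define K where "K = {j \<in> ?J. h j \<noteq> 0}"
      have "\<exists>k a b. 2 * k \<le> Polynomial.degree (h j) \<and> unit_pair a b \<and>
          (\<forall>x\<in>W N. P (h j) x = R a b ((\<sigma> ^^ (2 * k)) x))" if "j \<in> K" for j
      proof -
        have "h j \<noteq> 0"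
          using that by (simp add: K_def)
        then obtain k a b where "2 * k \<le> Polynomial.degree (h j)" "unit_pair a b"
          "\<And>x. x \<in> W N \<Longrightarrow> P (h j) x = R a b ((\<sigma> ^^ (2 * k)) x)"
          by (rule P_eq_unit_\<sigma>_power[of "h j" N]) blast
        then show ?thesis
          by blast
      qed
      then obtain k a b where kab: "\<And>j. j \<in> K \<Longrightarrow> 2 * k j \<le> Polynomial.degree (h j)"
        "\<And>j. j \<in> K \<Longrightarrow> unit_pair (a j) (b j)"
        "\<And>j x. j \<in> K \<Longrightarrow> x \<in> W N \<Longrightarrow> P (h j) x = R (a j) (b j) ((\<sigma> ^^ (2 * k j)) x)"
        by metis
      \<comment> \<open>The coefficient contributes an even power of \<sigma> and the vector
        contributes 0 or 1 more; parity therefore keeps the exponents at one generator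
        distinct.\<close>
      define r where "r j = 2 * k j + snd j" for j
      obtain v' m' where "\<sigma>_generators N n v' m'" "(\<Sum>i<n. m' i) < (\<Sum>i<n. m i)"
      proof (rule \<sigma>_generators_reduce[OF gen])
        show "finite K" "K \<noteq> {}"
          using nz by (auto simp: K_def)
        show "fst j < n" if "j \<in> K" for j
          using that by (auto simp: K_def)
        show "unit_pair (a j) (b j)" if "j \<in> K" for j
          by (rule kab(2)[OF that])
        show "r j < m (fst j)" if j: "j \<in> K" for j
        proof -
          have "2 * k j < d j"
            using kab(1)[OF j] deg[of j] j by (auto simp: K_def)
          then show ?thesis
            using j by (cases j) (auto simp: K_def d_def r_def split: if_splits; presburger)
        qed
        show "j = j'" if "j \<in> K" "j' \<in> K" "fst j = fst j'" "r j = r j'" for j j'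
          using that by (cases j; cases j') (auto simp: K_def r_def; presburger)
        have "R (a j) (b j) ((\<sigma> ^^ r j) (v (fst j))) = P (h j) (w j)" if "j \<in> K" for j
        proof -
          have "w j = (\<sigma> ^^ snd j) (v (fst j))"
            by (simp add: w_def case_prod_unfold)
          moreover have "w j \<in> W N"
            using that vW by (auto simp: K_def w_def intro!: stableD[OF stable_W])
          ultimately show ?thesis
            using kab(3)[OF that] by (simp add: r_def funpow_add)
        qed
        then have "(\<Sum>j\<in>K. R (a j) (b j) ((\<sigma> ^^ r j) (v (fst j)))) = (\<Sum>j\<in>K. P (h j) (w j))"
          by simp
        also have "\<dots> = (\<Sum>j\<in>?J. P (h j) (w j))"
          by (rule sum.mono_neutral_left) (auto simp: K_def)
        finally show "(\<Sum>j\<in>K. R (a j) (b j) ((\<sigma> ^^ r j) (v (fst j)))) = 0"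
          using sum by simp
      qed
      then show False
        using least by (meson not_le)
    qed
  qed simp
  ultimately have "2 * (\<Sum>i<n. m i) \<le> dim (W N)"
    by (simp add: sum_distrib_left)
  then show ?thesis
    using gen by blast
qed

text \<open>Each generator of length m gives the two u-cyclic modules of \<open>v\<close> and
  \<sigma> v, whose degrees sum to 2m; the bound on the sum of the lengths is thus exactly the
  required dimension bound.\<close>

lemma primary_component:
  "\<exists>M ms. image_mset snd M = (\<Sum>m\<in>#ms. {#F ^ ((m + 1) div 2), F ^ (m div 2)#}) \<and>
     (\<forall>(v, g)\<in>#M. lead_coeff g = 1 \<and> P g v = 0) \<and>
     (\<forall>S. subspace S \<longrightarrow> (\<forall>x\<in>S. u x \<in> S) \<longrightarrow> (\<forall>(v, g)\<in>#M. v \<in> S) \<longrightarrow> W N \<subseteq> S) \<and>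
     (\<Sum>(v, g)\<in>#M. Polynomial.degree g) \<le> dim (W N)"
proof -
  obtain n v m where gen: "\<sigma>_generators N n v m" and dim: "2 * (\<Sum>i<n. m i) \<le> dim (W N)"
    using ex_small_\<sigma>_generators by blast
  obtain a where a: "\<And>k x. x \<in> W N \<Longrightarrow> P (F ^ k) x = R (a ^ k) 1 ((\<sigma> ^^ (2 * k)) x)"
    using P_F_power[of N] by metis
  have v: "v i \<in> W N" "(\<sigma> ^^ m i) (v i) = 0" if "i < n" for i
    using gen that by (auto simp: \<sigma>_generators_def)
  have zero: "(\<sigma> ^^ l) (v i) = 0" if "i < n" "m i \<le> l" for i l
  proof -
    interpret \<sigma>l: Vector_Spaces.linear scale scale "\<sigma> ^^ (l - m i)"
      by (rule linear_funpow[OF linear_\<sigma>])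
    show ?thesis
      using v(2)[OF that(1)] that(2) funpow_add[of "l - m i" "m i" \<sigma>] by simp
  qed
  define M where "M = (\<Sum>i\<in>#mset_set {..<n}. {#(v i, F ^ ((m i + 1) div 2)), (\<sigma> (v i), F ^ (m i div 2))#})"
  have M: "z \<in># M \<longleftrightarrow> (\<exists>i<n. z = (v i, F ^ ((m i + 1) div 2)) \<or> z = (\<sigma> (v i), F ^ (m i div 2)))" for z
    by (auto simp: M_def set_mset_Union_mset)
  show ?thesis
  proof (rule exI[of _ M], rule exI[of _ "image_mset m (mset_set {..<n})"], intro conjI allI impI)
    show "image_mset snd M = (\<Sum>m\<in>#image_mset m (mset_set {..<n}). {#F ^ ((m + 1) div 2), F ^ (m div 2)#})"
      by (simp add: M_def image_mset_sum_mset image_mset.compositionality o_def)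
    show "\<forall>(v, g)\<in>#M. lead_coeff g = 1 \<and> P g v = 0"
    proof (intro ballI, clarify, unfold M, elim exE conjE disjE)
      have "lead_coeff F = 1"
        by (simp add: F_def)
      then have lc: "lead_coeff (F ^ k) = 1" for k
        by (simp only: lead_coeff_power power_one)
      fix x g i assume i: "i < n"
      have "P (F ^ ((m i + 1) div 2)) (v i) = 0"
        unfolding a[OF v(1)[OF i]] by (subst zero[OF i]) (auto simp: R.zero)
      then show "lead_coeff g = 1 \<and> P g x = 0" if "(x, g) = (v i, F ^ ((m i + 1) div 2))"
        using that lc by simp
      \<comment> \<open>On \<sigma> (v i) the power of \<open>F\<close> amounts to
        \<open>2 * (m i div 2) + 1\<close> applications of \<sigma> to \<open>v i\<close>, which is
        at least \<open>m i\<close>.\<close>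
      have "\<sigma> (v i) \<in> W N"
        by (rule stableD(4)[OF stable_W v(1)[OF i]])
      then have "P (F ^ (m i div 2)) (\<sigma> (v i)) = R (a ^ (m i div 2)) 1 ((\<sigma> ^^ Suc (2 * (m i div 2))) (v i))"
        unfolding a[OF \<open>\<sigma> (v i) \<in> W N\<close>] by (simp add: funpow_swap1)
      also have "\<dots> = 0"
        by (subst zero[OF i]) (auto simp: R.zero)
      finally show "lead_coeff g = 1 \<and> P g x = 0" if "(x, g) = (\<sigma> (v i), F ^ (m i div 2))"
        using that lc by simp
    qed
    show "(\<Sum>(v, g)\<in>#M. Polynomial.degree g) \<le> dim (W N)"
    proof -
      have "(\<Sum>(v, g)\<in>#M. Polynomial.degree g) = (\<Sum>i<n. 2 * ((m i + 1) div 2) + 2 * (m i div 2))"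
        by (simp add: M_def image_mset_sum_mset sum_mset_sum_mset degree_power_eq sum_unfold_sum_mset mult.commute)
      also have "\<dots> = (\<Sum>i<n. 2 * m i)"
        by (intro sum.cong) (simp_all, presburger)
      finally show ?thesis
        using dim by (simp add: sum_distrib_left)
    qed
    fix S assume S: "subspace S" "\<forall>x\<in>S. u x \<in> S" "\<forall>(v, g)\<in>#M. v \<in> S"
    have ui: "ui x \<in> S" if "x \<in> S" for x
      using ex_inverse_closed[OF ui_u u_ui S(1) _ that] S(2) by blast
    \<comment> \<open>A u-stable \<open>S\<close> need not be \<sigma>-stable, but this part of it
      is: \<sigma>\<sigma> is expressed through u, so it maps \<open>S\<close> into itself.\<close>
    let ?S = "{x \<in> S. \<sigma> x \<in> S}"
    have "stable ?S"
      unfolding stable_def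
    proof (intro conjI ballI)
      show "subspace ?S"
        using S(1) by (auto simp: subspace_def \<sigma>.add \<sigma>.scale)
      fix x assume x: "x \<in> ?S"
      then show "u x \<in> ?S"
        using S(1,2) ui by (auto simp: \<sigma>_u subspace_scale)
      have "u (\<sigma> (u (ui x))) \<in> S"
        using x S(2) by simp
      then have "\<delta> *s \<sigma> (ui x) \<in> S"
        unfolding \<sigma>_u by (simp add: u.scale)
      then show "ui x \<in> ?S"
        using x ui subspace_scale[OF S(1), of "\<delta> *s \<sigma> (ui x)" "1 / \<delta>"] \<delta>_nz by simp
      have "u (u (\<sigma> (\<sigma> x))) \<in> S"
        unfolding \<sigma>_\<sigma> using x S(1,2) by (intro subspace_scale poly_endo_closed) auto
      then have "\<sigma> (\<sigma> x) \<in> S"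
        using ui[OF ui] by (metis ui_u)
      then show "\<sigma> x \<in> ?S"
        using x by simp
    qed
    moreover have "v i \<in> ?S" if "i < n" for i
      using S(3) that unfolding M by (auto simp: Ball_def M)
    ultimately show "W N \<subseteq> S"
      using gen unfolding \<sigma>_generators_def by blast
  qed
qed

end

section \<open>Quotients and semilinear maps\<close>

text \<open>The elementary divisors of a sum of \<sigma>-cyclic pieces of lengths
  \<open>ms\<close>.\<close>

definition paired_powers :: "'a::field poly \<Rightarrow> nat multiset \<Rightarrow> 'a poly multiset" where
  "paired_powers f ms = (\<Sum>m\<in>#ms. {#f ^ ((m + 1) div 2), f ^ (m div 2)#})"

context endomorphism
begin

lemma dim_direct_sum_le:
  assumes "subspace U" and "subspace U'" and "U \<inter> U' = {0}"
  shows "dim U + dim U' \<le> dim (UNIV :: 'v set)"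
proof -
  obtain B where B: "B \<subseteq> U" "independent B" "card B = dim U"
    using basis_exists[of U] by metis
  obtain B' where B': "B' \<subseteq> U'" "independent B'" "card B' = dim U'"
    using basis_exists[of U'] by metis
  have fin: "finite B" "finite B'"
    using B(2) B'(2) by (auto intro: finiteI_independent)
  have "card (B <+> B') \<le> dim (UNIV :: 'v set)"
  proof (rule independent_family_card_le[where b = "case_sum (\<lambda>x. x) (\<lambda>x. x)"])
    show "\<forall>e\<in>B <+> B'. c e = 0"
      if c: "(\<Sum>e\<in>B <+> B'. c e *s (case e of Inl x \<Rightarrow> x | Inr x \<Rightarrow> x)) = 0" for c
    proof -
      let ?s = "\<Sum>x\<in>B. c (Inl x) *s x" and ?s' = "\<Sum>x\<in>B'. c (Inr x) *s x"
      have sum: "?s + ?s' = 0"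
        using c fin by (simp add: sum.Plus)
      have "?s \<in> U" "?s' \<in> U'"
        using B(1) B'(1) assms(1,2) by (auto intro!: subspace_sum subspace_scale)
      moreover have "?s = - ?s'"
        using sum by (simp add: eq_neg_iff_add_eq_0)
      ultimately have "?s \<in> U \<inter> U'"
        using subspace_neg[OF assms(2)] by auto
      then have "?s = 0" "?s' = 0"
        using assms(3) sum by auto
      then have "\<forall>x\<in>B. c (Inl x) = 0" "\<forall>x\<in>B'. c (Inr x) = 0"
        using independentD[OF B(2) fin(1) order_refl, of "\<lambda>x. c (Inl x)"]
          independentD[OF B'(2) fin(2) order_refl, of "\<lambda>x. c (Inr x)"] by blast+
      then show ?thesis
        by auto
    qed
  qed (use fin in auto)
  then show ?thesis
    using fin B(3) B'(3) by (simp add: card_Plus)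
qed

lemma poly_endo_quadratic: "poly_endo scale [:c, d, 1:] f x = c *s x + (d *s f x + f (f x))"
  by (simp add: poly_endo_pCons)

text \<open>The universal property of a sum of cyclic modules: generators may be sent to any vectors
  killed by the same polynomials, where the target carries the action of \<open>h\<close>. With
  \<open>h\<close> = \<delta>/u this produces semilinear maps.\<close>

lemma ex_intertwining_map:
  assumes cyc: "cyclic_decomposition (mset (map (\<lambda>(v, g, z). (v, g)) xs))"
    and h: "Vector_Spaces.linear scale scale h"
    and kill: "\<And>v g z. (v, g, z) \<in> set xs \<Longrightarrow> poly_endo scale g h z = 0"
  obtains \<phi> where "Vector_Spaces.linear scale scale \<phi>" and "\<And>x. \<phi> (u x) = h (\<phi> x)"
    and "\<And>v g z. (v, g, z) \<in> set xs \<Longrightarrow> \<phi> v = z"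
proof -
  interpret h: Vector_Spaces.linear scale scale h by fact
  interpret hp: endomorphism scale Basis h
    by unfold_locales
  let ?bs = "concat (map (\<lambda>(v, g, z). krylov v g) xs)"
  let ?ts = "concat (map (\<lambda>(v, g, z). hp.krylov z g) xs)"
  have monic: "lead_coeff g = 1" and kill_v: "P g v = 0" if "(v, g, z) \<in> set xs" for v g z
    using cyclic_decompositionD(1,2)[OF cyc] that by force+
  have "basis_of scale UNIV (concat (map (\<lambda>(v, g). krylov v g) (map (\<lambda>(v, g, z). (v, g)) xs)))"
    using cyc by (subst cyclic_decomposition_iff_basis[symmetric]) (auto dest: monic kill_v)
  then have basis: "basis_of scale UNIV ?bs"
    by (simp add: o_def case_prod_unfold)
  have len: "length ?ts = length ?bs"
    by (simp add: length_concat o_def case_prod_unfold)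
  have "independent (set ?bs)" and distinct: "distinct ?bs" and span: "span (set ?bs) = UNIV"
    using basis by (auto simp: basis_of_def)
  interpret vector_space_pair scale scale
    by unfold_locales
  \<comment> \<open>Images are matched by position: the Krylov list of \<open>v\<close> under u is
    sent termwise to that of \<open>z\<close> under \<open>h\<close>.\<close>
  obtain \<phi> where \<phi>: "Vector_Spaces.linear scale scale \<phi>"
    and \<phi>_bs: "\<And>x. x \<in> set ?bs \<Longrightarrow> \<phi> x = the (map_of (zip ?bs ?ts) x)"
    using linear_independent_extend[OF \<open>independent (set ?bs)\<close>, of "\<lambda>x. the (map_of (zip ?bs ?ts) x)"] by blast
  interpret \<phi>: Vector_Spaces.linear scale scale \<phi> by fact
  have zip: "set (zip ?bs ?ts) = (\<Union>(v, g, z)\<in>set xs. set (zip (krylov v g) (hp.krylov z g)))"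
    by (induction xs) auto
  have \<phi>_krylov: "\<phi> ((u ^^ j) v) = (h ^^ j) z" if "(v, g, z) \<in> set xs" "j < Polynomial.degree g" for v g z j
  proof -
    have "((u ^^ j) v, (h ^^ j) z) \<in> set (zip (krylov v g) (hp.krylov z g))"
      using that(2) by (auto simp: set_zip krylov_def hp.krylov_def intro!: exI[of _ j])
    then have in_zip: "((u ^^ j) v, (h ^^ j) z) \<in> set (zip ?bs ?ts)"
      unfolding zip using that(1) by blast
    have "map_of (zip ?bs ?ts) ((u ^^ j) v) = Some ((h ^^ j) z)"
      by (rule map_of_is_SomeI[OF _ in_zip]) (simp only: map_fst_zip[OF len[symmetric]] distinct)
    then show ?thesis
      using \<phi>_bs[OF set_zip_leftD[OF in_zip]] by simp
  qed
  have "\<phi> (u x) = h (\<phi> x)" for x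
  proof -
    have "x \<in> span (set ?bs)"
      unfolding span by simp
    then show ?thesis
    proof (induction rule: span_induct)
      case base
      then show ?case
        by (auto simp: subspace_def u.add \<phi>.add h.add u.scale \<phi>.scale h.scale)
    next
      case (step x)
      then obtain v g z j where vgz: "(v, g, z) \<in> set xs" "j < Polynomial.degree g" "x = (u ^^ j) v"
        by (auto simp: krylov_def)
      have "\<phi> ((u ^^ Suc j) v) = (h ^^ Suc j) z"
      \<comment> \<open>Only the wrap-around at the last power uses that \<open>g\<close> kills both
        \<open>v\<close> and \<open>z\<close>.\<close>
      proof (cases "Suc j = Polynomial.degree g")
        case True
        have "(u ^^ Suc j) v = - (\<Sum>i<Polynomial.degree g. Polynomial.coeff g i *s (u ^^ i) v)"
          using kill_v[OF vgz(1)] P_monic[OF monic[OF vgz(1)], of v] unfolding True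
          by (metis add.commute eq_neg_iff_add_eq_0)
        then have "\<phi> ((u ^^ Suc j) v) = - (\<Sum>i<Polynomial.degree g. Polynomial.coeff g i *s (h ^^ i) z)"
          using \<phi>_krylov[OF vgz(1)] by (simp add: \<phi>.neg \<phi>.sum \<phi>.scale)
        also have "\<dots> = (h ^^ Suc j) z"
          using kill[OF vgz(1)] hp.P_monic[OF monic[OF vgz(1)], of z] unfolding True
          by (metis add.commute eq_neg_iff_add_eq_0)
        finally show ?thesis .
      next
        case False
        then show ?thesis
          using \<phi>_krylov[OF vgz(1), of "Suc j"] vgz(2) by simp
      qed
      then show ?case
        using \<phi>_krylov[OF vgz(1,2)] by (simp add: vgz(3))
    qed
  qed
  moreover have "\<phi> v = z" if vgz: "(v, g, z) \<in> set xs" for v g z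
  proof (cases "Polynomial.degree g = 0")
    case True
    \<comment> \<open>An empty Krylov list says nothing about \<open>v\<close>; instead
      \<open>g\<close> = 1 forces \<open>v\<close> and \<open>z\<close> to be 0.\<close>
    then have "g = 1"
      using monic[OF vgz] by (auto elim!: degree_eq_zeroE simp: one_pCons)
    then show ?thesis
      using kill_v[OF vgz] kill[OF vgz] by simp
  next
    case False
    then show ?thesis
      using \<phi>_krylov[OF vgz, of 0] by simp
  qed
  ultimately show thesis
    using \<phi> by (intro that)
qed

end

text \<open>All that the linear algebra needs from the field extension. \<open>sum_T\<close> and
  \<open>prod_T\<close> are T1 + T2 = tp tq / nq and T1 T2 = (tp^2 nq + tq^2 np - 4 np nq) / nq^2,
  multiplied by np = \<delta> nq to clear denominators.\<close>

locale pq_endomorphism = endomorphism scale Basis u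
  for scale :: "'a::field \<Rightarrow> 'v::ab_group_add \<Rightarrow> 'v" (infixr \<open>*s\<close> 75) and Basis :: "'v set"
    and u :: "'v \<Rightarrow> 'v" +
  fixes tp np tq nq \<delta> T1 T2 :: 'a
  assumes nq_nz: "nq \<noteq> 0" and \<delta>_nz: "\<delta> \<noteq> 0" and np_eq: "np = \<delta> * nq"
    and sum_T: "np * T1 + np * T2 = \<delta> * tp * tq"
    and prod_T: "np * T1 * T2 = \<delta> * \<delta> * tq * tq + \<delta> * tp * tp - 4 * np * \<delta>"
    and T_distinct: "T1 \<noteq> T2"
    and irreducible_1: "Factorial_Ring.irreducible [:\<delta>, - T1, 1:]"
    and irreducible_2: "Factorial_Ring.irreducible [:\<delta>, - T2, 1:]"
    and separable_1: "\<not> [:\<delta>, - T1, 1:] dvd [:- \<delta>, 0, 1:]"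
    and separable_2: "\<not> [:\<delta>, - T2, 1:] dvd [:- \<delta>, 0, 1:]"
begin

definition F1 :: "'a poly" where "F1 = [:\<delta>, - T1, 1:]"
definition F2 :: "'a poly" where "F2 = [:\<delta>, - T2, 1:]"

lemma np_nz: "np \<noteq> 0"
  using nq_nz \<delta>_nz np_eq by simp

lemma comaximal_F1_F2: "comaximal F1 F2"
proof (rule irreducible_comaximal)
  show "Factorial_Ring.irreducible F1"
    unfolding F1_def by (rule irreducible_1)
  show "\<not> F1 dvd F2"
  proof
    assume "F1 dvd F2"
    then have "F1 dvd F2 - F1"
      by simp
    also have "F2 - F1 = [:0, T1 - T2:]"
      by (simp add: F1_def F2_def)
    finally have "Polynomial.degree F1 \<le> Polynomial.degree [:0, T1 - T2:]"
      using T_distinct by (intro dvd_imp_degree_le) auto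
    then show False
      using T_distinct by (simp add: F1_def)
  qed
qed

context
  fixes ui :: "'v \<Rightarrow> 'v"
  assumes ui_linear: "Vector_Spaces.linear scale scale ui"
    and u_ui: "\<And>x. u (ui x) = x" and ui_u: "\<And>x. ui (u x) = x"
begin

interpretation ui: Vector_Spaces.linear scale scale ui
  by (rule ui_linear)

lemma scale_double: "(c * (d * 2)) *s x = (c * d) *s x + (c * d) *s x"
  by (metis mult.assoc mult_2_right scale_left_distrib)

lemmas operator_simps = u_ui ui_u u.add u.diff u.scale u.neg ui.add ui.diff ui.scale ui.neg

text \<open>Eliminates the individual traces: only T1 + T2 and T1 T2 occur, and these are known from
  tp, np, tq, nq. Both directions below compare \<sigma>\<sigma> with this expanded form.\<close>

lemma discriminant_identity:
  "np *s P F1 (P F2 x) =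
     np *s u (u (u (u x))) - (\<delta> * tp * tq) *s u (u (u x)) +
     (\<delta> * \<delta> * tq * tq + \<delta> * tp * tp - 2 * np * \<delta>) *s u (u x) -
     (\<delta> * \<delta> * tp * tq) *s u x + (np * \<delta> * \<delta>) *s x"
proof -
  have "np *s P F1 (P F2 x) =
     np *s u (u (u (u x))) - (np * T1 + np * T2) *s u (u (u x)) +
     (np * T1 * T2 + 2 * np * \<delta>) *s u (u x) -
     (\<delta> * (np * T1 + np * T2)) *s u x + (np * \<delta> * \<delta>) *s x"
    by (simp add: F1_def F2_def poly_endo_quadratic operator_simps algebra_simps scale_double)
  then show ?thesis
    unfolding sum_T prod_T by (simp add: algebra_simps)
qed

text \<open>Here \<open>ui\<close> composed with \<open>a\<close> plays the role of b. The two
  quadratic equations give a rule for moving \<open>a\<close> past u, after which both claims are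
  comparisons of normal forms.\<close>

lemma commutator_semilinear:
  assumes a: "Vector_Spaces.linear scale scale a"
    and a_a: "\<And>x. a (a x) = tp *s a x - np *s x"
    and b_b: "\<And>x. ui (a (ui (a x))) = tq *s ui (a x) - nq *s x"
  defines "\<sigma> \<equiv> \<lambda>x. a (u x) - u (a x)"
  shows "\<sigma> (u x) = \<delta> *s ui (\<sigma> x)" and "u (u (\<sigma> (\<sigma> x))) = np *s P F1 (P F2 x)"
proof -
  interpret a: Vector_Spaces.linear scale scale a by fact
  note lin = operator_simps a.add a.diff a.scale a.neg
  have a_u: "a (u x) = \<delta> *s ui (a x) - (\<delta> * tq) *s x + tp *s u x" for x
  proof -
    \<comment> \<open>This is the b-preimage of \<open>x\<close>, from b^-1 = (tq - b) / nq; hence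
      \<open>a y\<close> is \<open>u x\<close> and the equation for \<open>a\<close> applies to
      \<open>y\<close>.\<close>
    define y where "y = (1 / nq) *s (tq *s x - ui (a x))"
    have "ui (a y) = x"
      using nq_nz by (simp add: y_def lin b_b)
    then have "a y = u x"
      using u_ui by metis
    then have "a (u x) = tp *s u x - np *s y"
      using a_a[of y] by simp
    then show ?thesis
      using nq_nz by (simp add: y_def np_eq algebra_simps)
  qed
  have a_ui: "\<delta> *s a (ui x) = u (a x) + (\<delta> * tq) *s x - tp *s u x" for x
    using a_u[of "ui x"] by (simp add: u_ui) (simp add: lin algebra_simps)
  show \<sigma>_u: "\<sigma> (u x) = \<delta> *s ui (\<sigma> x)" for x
    by (simp add: \<sigma>_def a_u lin algebra_simps)
  have \<sigma>_a: "\<sigma> (a x) = (\<delta> * tp) *s ui (a x) - (\<delta> * np) *s ui x - (\<delta> * tq) *s a x + np *s u x" for x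
    by (simp add: \<sigma>_def a_u a_a lin algebra_simps)
  have "Vector_Spaces.linear scale scale \<sigma>"
    unfolding \<sigma>_def by (rule linear_selfI) (simp_all add: lin algebra_simps)
  then interpret \<sigma>: Vector_Spaces.linear scale scale \<sigma> .
  have \<sigma>_ui: "\<delta> *s \<sigma> (ui x) = u (\<sigma> x)" for x
    using \<sigma>_u[of "ui x"] by (simp add: u_ui u.scale)
  have \<sigma>_eq: "\<sigma> x = \<delta> *s ui (a x) - u (a x) - (\<delta> * tq) *s x + tp *s u x" for x
    by (simp add: \<sigma>_def a_u)
  \<comment> \<open>Only the inner \<sigma> is expanded; the outer one is then moved past u and its
    inverse by semilinearity.\<close>
  have "\<sigma> (\<sigma> x) = \<delta> *s \<sigma> (ui (a x)) - \<sigma> (u (a x)) - (\<delta> * tq) *s \<sigma> x + tp *s \<sigma> (u x)"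
    by (subst (2) \<sigma>_eq) (simp add: \<sigma>.add \<sigma>.diff \<sigma>.scale)
  also have "\<dots> = u (\<sigma> (a x)) - \<delta> *s ui (\<sigma> (a x)) - (\<delta> * tq) *s \<sigma> x + (tp * \<delta>) *s ui (\<sigma> x)"
    by (simp add: \<sigma>_ui \<sigma>_u)
  finally have \<sigma>_\<sigma>: "\<sigma> (\<sigma> x) = \<dots>" .
  show "u (u (\<sigma> (\<sigma> x))) = np *s P F1 (P F2 x)"
    unfolding discriminant_identity \<sigma>_\<sigma> \<sigma>_a
    by (simp add: \<sigma>_eq lin algebra_simps scale_double)
qed

text \<open>Writing \<open>D = \<delta> u\<inverse> - u\<close>, the automorphism is recovered from its commutator \<open>\<sigma>\<close> with \<open>u\<close> as
  \<open>a = D\<inverse> (\<sigma> + \<delta> tq - tp u)\<close>.\<close>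

lemma quotient_of_semilinear:
  assumes \<sigma>: "Vector_Spaces.linear scale scale \<sigma>"
    and \<sigma>_u: "\<And>x. \<sigma> (u x) = \<delta> *s ui (\<sigma> x)"
    and \<sigma>_\<sigma>: "\<And>x. u (u (\<sigma> (\<sigma> x))) = np *s P F1 (P F2 x)"
    and Di: "Vector_Spaces.linear scale scale Di"
    and Di_D: "\<And>x. Di (\<delta> *s ui x - u x) = x" and D_Di: "\<And>x. \<delta> *s ui (Di x) - u (Di x) = x"
  obtains a where "Vector_Spaces.linear scale scale a" and "\<And>x. a (a x) = tp *s a x - np *s x"
    and "\<And>x. ui (a (ui (a x))) = tq *s ui (a x) - nq *s x"
proof -
  interpret \<sigma>: Vector_Spaces.linear scale scale \<sigma> by fact
  interpret Di: Vector_Spaces.linear scale scale Di by fact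
  define D where "D x = \<delta> *s ui x - u x" for x
  define g where "g x = (\<delta> * tq) *s x - tp *s u x" for x
  define a where "a x = Di (\<sigma> x + g x)" for x
  note lin = operator_simps \<sigma>.add \<sigma>.diff \<sigma>.scale Di.add Di.diff Di.scale
  have "Vector_Spaces.linear scale scale D"
    by (rule linear_selfI) (simp_all add: D_def lin algebra_simps)
  then interpret D: Vector_Spaces.linear scale scale D .
  have "Vector_Spaces.linear scale scale g"
    by (rule linear_selfI) (simp_all add: g_def lin algebra_simps)
  then interpret g: Vector_Spaces.linear scale scale g .
  have lin_a: "Vector_Spaces.linear scale scale a"
    by (rule linear_selfI) (simp_all add: a_def g_def lin algebra_simps)
  then interpret a: Vector_Spaces.linear scale scale a .
  have D_inj: "x = 0" if "D x = 0" for x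
    using Di_D[of x] that by (simp add: D_def)
  have D_a: "D (a x) = \<sigma> x + g x" for x
    unfolding D_def a_def by (rule D_Di)
  have \<sigma>_ui: "\<delta> *s \<sigma> (ui x) = u (\<sigma> x)" for x
    using \<sigma>_u[of "ui x"] by (simp add: u_ui u.scale)
  \<comment> \<open>The involution u -> \<delta>/u sends \<open>D\<close> to its negative and, as
    \<open>g\<close> is affine in u, shifts \<open>g\<close> by -tp D.\<close>
  have \<sigma>_D: "\<sigma> (D x) = - D (\<sigma> x)" for x
    by (simp add: D_def lin \<sigma>_u \<sigma>_ui)
  have g_D: "g (D x) = D (g x)" for x
    by (simp add: D_def g_def lin algebra_simps)
  have \<sigma>_g: "\<sigma> (g x) = g (\<sigma> x) - tp *s D (\<sigma> x)" for x
    by (simp add: D_def g_def lin \<sigma>_u algebra_simps)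
  have u_D: "D (u x) = u (D x)" for x
    by (simp add: D_def lin)
  have "u (u (\<sigma> (\<sigma> x))) = u (u (g (g x) - tp *s D (g x) + np *s D (D x)))" for x
    unfolding \<sigma>_\<sigma> discriminant_identity by (simp add: D_def g_def lin algebra_simps scale_double)
  then have \<sigma>2: "\<sigma> (\<sigma> x) = g (g x) - tp *s D (g x) + np *s D (D x)" for x
    by (metis ui_u)
  \<comment> \<open>In operator form D D a a = (g - \<sigma>)(g + \<sigma>). The commutation rule
    for \<open>g\<close> and the formula for \<sigma>\<sigma> turn this into D D (tp a - np), and
    \<open>D\<close> is injective.\<close>
  have a_a: "a (a x) = tp *s a x - np *s x" for x
  proof -
    have "D (D (a (a x))) = D (\<sigma> (a x)) + D (g (a x))"
      by (simp only: D_a D.add)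
    also have "\<dots> = - \<sigma> (D (a x)) + g (D (a x))"
      by (simp only: \<sigma>_D g_D minus_minus)
    also have "\<dots> = D (D (tp *s a x - np *s x))"
      by (simp add: D_a D.add D.diff D.scale \<sigma>.add g.add \<sigma>_g \<sigma>2 algebra_simps)
    finally have "D (D (a (a x) - (tp *s a x - np *s x))) = 0"
      by (simp add: D.diff)
    from D_inj[OF D_inj[OF this]] show ?thesis
      by (simp only: right_minus_eq)
  qed
  have a_u: "a (u x) = \<delta> *s ui (a x) - g x" for x
  proof -
    have "D (a (u x)) = D (u (a x) + \<sigma> x)"
      by (simp add: D_a D.add u_D u.add \<sigma>_u) (simp add: D_def g_def lin)
    then have "D (a (u x) - (u (a x) + \<sigma> x)) = 0"
      by (simp add: D.diff)
    from D_inj[OF this] have "a (u x) = u (a x) + \<sigma> x"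
      by (simp only: right_minus_eq)
    also have "\<sigma> x = D (a x) - g x"
      by (simp add: D_a)
    finally show ?thesis
      by (simp add: D_def)
  qed
  have "\<delta> *s ui (a (ui (a x))) = \<delta> *s (tq *s ui (a x) - nq *s x)" for x
  proof -
    have "\<delta> *s ui (a (ui (a x))) = a (a x) + g (ui (a x))"
      using a_u[of "ui (a x)"] by (simp add: u_ui)
    also have "\<dots> = \<delta> *s (tq *s ui (a x) - nq *s x)"
      by (simp add: a_a g_def u_ui np_eq algebra_simps)
    finally show ?thesis .
  qed
  then have "ui (a (ui (a x))) = tq *s ui (a x) - nq *s x" for x
    using \<delta>_nz scale_cancel_left by blast
  then show thesis
    using that lin_a a_a by blast
qed

end

end

abbreviation halved_powers :: "'a::field poly \<times> nat \<Rightarrow> 'a poly list" where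
  "halved_powers \<equiv> \<lambda>(f, m). [f ^ ((m + 1) div 2), f ^ (m div 2)]"

lemma paired_powers_mem:
  assumes "g \<in># paired_powers f ms"
  obtains k where "g = f ^ k" and "k \<le> \<Sum>\<^sub># ms"
proof -
  obtain m where m: "m \<in># ms" "g = f ^ ((m + 1) div 2) \<or> g = f ^ (m div 2)"
    using assms by (auto simp: paired_powers_def set_mset_Union_mset)
  have "m \<le> \<Sum>\<^sub># ms"
    using m(1) by (metis multi_member_split sum_mset.add_mset le_add1)
  moreover have "(m + 1) div 2 \<le> m" "m div 2 \<le> m"
    by presburger+
  ultimately show thesis
    using m(2) by (elim disjE) (rule that, assumption, linarith)+
qed

text \<open>Groups the generators two by two, so that \<sigma> can be prescribed on each
  pair.\<close>

lemma split_paired_list: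
  assumes "map snd xs = concat (map halved_powers bl)"
  obtains ys where "map (\<lambda>(v, w, p). p) ys = bl"
    and "xs = concat (map (\<lambda>(v, w, f, m). [(v, f ^ ((m + 1) div 2)), (w, f ^ (m div 2))]) ys)"
  using assms
proof (induction bl arbitrary: xs thesis)
  case Nil
  then show ?case by simp
next
  case (Cons p bl)
  obtain f m where p: "p = (f, m)"
    by (cases p)
  obtain v w zs where xs: "xs = (v, f ^ ((m + 1) div 2)) # (w, f ^ (m div 2)) # zs"
    and zs: "map snd zs = concat (map halved_powers bl)"
    using Cons.prems(2) by (auto simp: p map_eq_Cons_conv)
  obtain ys where "map (\<lambda>(v, w, p). p) ys = bl"
    "zs = concat (map (\<lambda>(v, w, f, m). [(v, f ^ ((m + 1) div 2)), (w, f ^ (m div 2))]) ys)"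
    using Cons.IH[OF _ zs] by blast
  then show ?case
    by (intro Cons.prems(1)[of "(v, w, f, m) # ys"]) (simp_all add: p xs)
qed

lemma mset_paired_list:
  "mset (concat (map halved_powers (map (Pair f) ms))) = paired_powers f (mset ms)"
  by (induction ms) (auto simp: paired_powers_def)

lemma (in vector_space) annihilates_quadratic_iff:
  "annihilates scale [:n, - t, 1:] a \<longleftrightarrow> (\<forall>x. a (a x) = scale t (a x) - scale n x)"
proof -
  have "poly_endo scale [:n, - t, 1:] a x = 0 \<longleftrightarrow> a (a x) = scale t (a x) - scale n x" for x
    by (simp add: poly_endo_pCons algebra_simps eq_neg_iff_add_eq_0)
  then show ?thesis
    by (simp add: annihilates_def fun_eq_iff)
qed

context endomorphism
begin

lemma ex_poly_inverse:
  assumes "comaximal f h" and "\<And>x. P h x = 0"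
  obtains g where "\<And>x. P g (P f x) = x"
proof -
  obtain a b where ab: "a * f + b * h = 1"
    using assms(1) by (auto simp: comaximal_def)
  have "P a (P f x) = x" for x
    using arg_cong[OF ab, of "\<lambda>f. P f x"] by (simp add: poly_endo_add P_mult assms(2))
  then show thesis
    by (rule that)
qed

end

section \<open>From quotients to elementary divisors and back\<close>

context pq_endomorphism
begin

text \<open>The equation for \<sigma>\<sigma> is symmetric in the two quadratics, so the primary
  decomposition applies to each of them with the other as \<open>F'\<close>; the Bezout identity for
  their powers splits the space.\<close>

lemma decomposes_of_quotient:
  assumes pq: "pq_quotient scale [:np, - tp, 1:] [:nq, - tq, 1:] u"
    and kill: "\<And>x. P ((F1 * F2) ^ Suc N) x = 0"
  shows "\<exists>ms ns. decomposes_as (paired_powers F1 ms + paired_powers F2 ns)"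
proof -
  obtain a b where ab: "automorphism scale a" "automorphism scale b"
    "annihilates scale [:np, - tp, 1:] a" "annihilates scale [:nq, - tq, 1:] b" "u = a \<circ> inv_into UNIV b"
    using pq by (auto simp: pq_quotient_def)
  have a: "Vector_Spaces.linear scale scale a" "bij a" and b: "Vector_Spaces.linear scale scale b" "bij b"
    using ab(1,2) by (auto simp: automorphism_def)
  interpret a: Vector_Spaces.linear scale scale a by fact
  interpret b: Vector_Spaces.linear scale scale b by fact
  have inv_a: "Vector_Spaces.linear scale scale (inv_into UNIV a)"
    by (rule inj_linear_imp_inv_linear[OF a(1) bij_is_inj[OF a(2)]])
  interpret ia: Vector_Spaces.linear scale scale "inv_into UNIV a" by fact
  \<comment> \<open>b a^-1, the inverse of u = a b^-1.\<close>
  define ui where "ui = b \<circ> inv_into UNIV a"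
  have ui: "Vector_Spaces.linear scale scale ui"
    unfolding ui_def by (rule linear_selfI) (simp_all add: b.add ia.add b.scale ia.scale)
  have u_ui: "u (ui x) = x" and ui_u: "ui (u x) = x" and ui_a: "ui (a x) = b x" for x
    using a(2) b(2) by (simp_all add: ab(5) ui_def bij_is_inj bij_is_surj surj_f_inv_f)
  have a_a: "a (a x) = tp *s a x - np *s x" and b_b: "b (b x) = tq *s b x - nq *s x" for x
    using ab(3,4) by (simp_all add: annihilates_quadratic_iff)
  define \<sigma> where "\<sigma> x = a (u x) - u (a x)" for x
  have \<sigma>: "Vector_Spaces.linear scale scale \<sigma>"
    unfolding \<sigma>_def by (rule linear_selfI) (simp_all add: a.add u.add a.scale u.scale algebra_simps)
  have \<sigma>_u: "\<sigma> (u x) = \<delta> *s ui (\<sigma> x)" and \<sigma>_\<sigma>: "u (u (\<sigma> (\<sigma> x))) = np *s P F1 (P F2 x)" for x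
    unfolding \<sigma>_def by (rule commutator_semilinear[OF ui u_ui ui_u a(1) a_a]; simp add: ui_a b_b)+
  have \<sigma>_\<sigma>': "u (u (\<sigma> (\<sigma> x))) = np *s P F2 (P F1 x)" for x
    unfolding \<sigma>_\<sigma> by (subst poly_endo_commute[OF linear_u]) (rule refl)
  interpret ui: Vector_Spaces.linear scale scale ui by (rule ui)
  interpret \<sigma>: Vector_Spaces.linear scale scale \<sigma> by (rule \<sigma>)
  note comax = comaximal_F1_F2 comaximal_commute[OF comaximal_F1_F2]
  interpret I1: semilinear_involution scale Basis u ui \<sigma> \<delta> np T1 T2
    by (unfold_locales; rule u_ui ui_u \<delta>_nz np_nz \<sigma>_u irreducible_1
        \<sigma>_\<sigma>[unfolded F1_def F2_def] comax(1)[unfolded F1_def F2_def])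
  interpret I2: semilinear_involution scale Basis u ui \<sigma> \<delta> np T2 T1
    by (unfold_locales; rule u_ui ui_u \<delta>_nz np_nz \<sigma>_u irreducible_2 \<sigma>_\<sigma>'[unfolded F1_def F2_def] comax(2)[unfolded F1_def F2_def])
  have F: "I1.F = F1" "I2.F = F2"
    by (simp_all only: I1.F_def I2.F_def F1_def F2_def)
  obtain M ms where M: "image_mset snd M = paired_powers F1 ms" "\<forall>(v, g)\<in>#M. lead_coeff g = 1 \<and> P g v = 0"
    "\<And>S. subspace S \<Longrightarrow> \<forall>x\<in>S. u x \<in> S \<Longrightarrow> \<forall>(v, g)\<in>#M. v \<in> S \<Longrightarrow> I1.W N \<subseteq> S"
    "(\<Sum>(v, g)\<in>#M. Polynomial.degree g) \<le> dim (I1.W N)"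
    using I1.primary_component[of N] unfolding F paired_powers_def by blast
  obtain M' ns where M': "image_mset snd M' = paired_powers F2 ns" "\<forall>(v, g)\<in>#M'. lead_coeff g = 1 \<and> P g v = 0"
    "\<And>S. subspace S \<Longrightarrow> \<forall>x\<in>S. u x \<in> S \<Longrightarrow> \<forall>(v, g)\<in>#M'. v \<in> S \<Longrightarrow> I2.W N \<subseteq> S"
    "(\<Sum>(v, g)\<in>#M'. Polynomial.degree g) \<le> dim (I2.W N)"
    using I2.primary_component[of N] unfolding F paired_powers_def by blast
  let ?f1 = "F1 ^ Suc N" and ?f2 = "F2 ^ Suc N"
  obtain c d where cd: "c * ?f1 + d * ?f2 = 1"
    using comaximal_power[OF comaximal_F1_F2, of "Suc N" "Suc N"] by (auto simp: comaximal_def)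
  have cd_x: "P c (P ?f1 x) + P d (P ?f2 x) = x" for x
    using arg_cong[OF cd, of "\<lambda>f. P f x"] by (simp only: poly_endo_add P_mult poly_endo_1)
  have "P ?f1 (P ?f2 x) = 0" for x
    using kill[of x] by (simp only: power_mult_distrib P_mult)
  then have in_W: "P c (P ?f1 x) \<in> I2.W N" "P d (P ?f2 x) \<in> I1.W N" for x
    unfolding I1.W_def I2.W_def F mem_Collect_eq
    by (simp_all only: poly_endo_commute[OF linear_u, of ?f2] poly_endo_commute[OF linear_u, of ?f1 d] P.zero)
  have "I1.W N \<inter> I2.W N \<subseteq> {0}"
  proof
    fix x assume "x \<in> I1.W N \<inter> I2.W N"
    then have "P ?f1 x = 0" "P ?f2 x = 0"
      by (simp_all only: I1.W_def I2.W_def F Int_iff mem_Collect_eq)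
    then show "x \<in> {0}"
      using cd_x[of x] by (simp only: P.zero add_0 singleton_iff)
  qed
  then have "I1.W N \<inter> I2.W N = {0}"
    using subspace_0[OF I1.stableD(1)[OF I1.stable_W]] subspace_0[OF I2.stableD(1)[OF I2.stable_W]] by blast
  then have dims: "dim (I1.W N) + dim (I2.W N) \<le> dim (UNIV :: 'v set)"
    by (intro dim_direct_sum_le I1.stableD(1)[OF I1.stable_W] I2.stableD(1)[OF I2.stable_W])
  have "cyclic_decomposition (M + M')"
  proof (rule cyclic_decompositionI)
    fix S assume S: "subspace S" "\<And>x. x \<in> S \<Longrightarrow> u x \<in> S" "\<And>v g. (v, g) \<in># M + M' \<Longrightarrow> v \<in> S"
    have "\<forall>(v, g)\<in>#M. v \<in> S" "\<forall>(v, g)\<in>#M'. v \<in> S" "\<forall>x\<in>S. u x \<in> S"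
      using S(2,3) by auto
    then have "I1.W N \<subseteq> S" "I2.W N \<subseteq> S"
      using M(3)[OF S(1)] M'(3)[OF S(1)] by blast+
    then have "x \<in> S" for x
      using subspace_add[OF S(1), of "P c (P ?f1 x)" "P d (P ?f2 x)"] in_W unfolding cd_x by blast
    then show "S = UNIV"
      by blast
  next
    show "(\<Sum>(v, g)\<in>#M + M'. Polynomial.degree g) \<le> dim (UNIV :: 'v set)"
      using M(4) M'(4) dims unfolding image_mset_union sum_mset.union by linarith
  qed (use M(2) M'(2) in auto)
  then show ?thesis
    unfolding decomposes_as_def using M(1) M'(1) by (metis image_mset_union)
qed

text \<open>Each exponent is at most the sum of the lengths, which serves as a uniform
  bound.\<close>

lemma decomposes_kill:
  assumes "decomposes_as (paired_powers F1 ms + paired_powers F2 ns)"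
  shows "\<exists>N. \<forall>x. P ((F1 * F2) ^ Suc N) x = 0"
proof -
  obtain M where M: "image_mset snd M = paired_powers F1 ms + paired_powers F2 ns" "cyclic_decomposition M"
    using assms by (auto simp: decomposes_as_def)
  let ?N = "\<Sum>\<^sub># ms + \<Sum>\<^sub># ns"
  have "P ((F1 * F2) ^ Suc ?N) v = 0" if "(v, g) \<in># M" for v g
  proof -
    have "g \<in># image_mset snd M"
      using that by force
    then have "g \<in># paired_powers F1 ms \<or> g \<in># paired_powers F2 ns"
      unfolding M(1) by auto
    then obtain k where "g = F1 ^ k \<or> g = F2 ^ k" "k \<le> Suc ?N"
      by (metis paired_powers_mem le_SucI trans_le_add1 trans_le_add2)
    then have "g dvd (F1 * F2) ^ Suc ?N"
      unfolding power_mult_distrib by (auto intro: dvd_mult dvd_mult2 le_imp_power_dvd simp del: power_Suc)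
    then obtain h where "(F1 * F2) ^ Suc ?N = h * g"
      by (metis dvdE mult.commute)
    then show ?thesis
      using cyclic_decompositionD(2)[OF M(2) that] by (simp only: P_mult P.zero)
  qed
  moreover have "{x. P ((F1 * F2) ^ Suc ?N) x = 0} = UNIV"
  proof (rule cyclic_decompositionD(3)[OF M(2)])
    show "subspace {x. P ((F1 * F2) ^ Suc ?N) x = 0}"
      by (rule P.subspace_kernel)
    show "u x \<in> {x. P ((F1 * F2) ^ Suc ?N) x = 0}" if "x \<in> {x. P ((F1 * F2) ^ Suc ?N) x = 0}" for x
      using that poly_endo_intertwine[OF linear_u, of u u "(F1 * F2) ^ Suc ?N" x] by (simp del: power_Suc)
  qed (use calculation in blast)
  ultimately show ?thesis
    by blast
qed

text \<open>On every pair of generators put \<sigma> v = w and \<sigma> w = \<nu> v, where \<nu> is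
  the value that \<sigma>\<sigma> must have; then recover a from \<sigma>.\<close>

lemma quotient_of_decomposes:
  assumes dec: "decomposes_as (paired_powers F1 ms + paired_powers F2 ns)"
  shows "pq_quotient scale [:np, - tp, 1:] [:nq, - tq, 1:] u"
proof -
  obtain N where kill: "\<And>x. P ((F1 * F2) ^ Suc N) x = 0"
    using decomposes_kill[OF dec] by blast
  have comax: "comaximal f ((F1 * F2) ^ Suc N)" if "comaximal F1 f" "comaximal F2 f" for f
    using comaximal_power[OF comaximal_mult[OF that], of "Suc N" 1] comaximal_commute by simp
  have "comaximal [:\<delta>, - T, 1:] [:0, 1:]" for T
  proof -
    have "[:1 / \<delta>:] * [:\<delta>, - T, 1:] + [:T / \<delta>, - 1 / \<delta>:] * [:0, 1:] = 1"
      using \<delta>_nz by (simp add: one_pCons field_simps)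
    then show ?thesis
      unfolding comaximal_def by blast
  qed
  then have "comaximal [:0, 1:] ((F1 * F2) ^ Suc N)"
    unfolding F1_def F2_def by (intro comax[unfolded F1_def F2_def])
  then obtain c where c: "\<And>x. P c (P [:0, 1:] x) = x"
    using ex_poly_inverse kill by metis
  define ui where "ui = P c"
  have ui: "Vector_Spaces.linear scale scale ui"
    unfolding ui_def by (rule linear_P)
  interpret ui: Vector_Spaces.linear scale scale ui by (rule ui)
  have ui_u: "ui (u x) = x" for x
    using c[of x] by (simp add: ui_def poly_endo_pCons)
  have u_ui: "u (ui x) = x" for x
    using ui_u poly_endo_intertwine[OF linear_u, of u u c x] by (simp add: ui_def)
  have ui_P: "ui (P f x) = P f (ui x)" for f x
    unfolding ui_def by (rule poly_endo_commute[OF linear_u])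
  have "comaximal F1 [:- \<delta>, 0, 1:]" "comaximal F2 [:- \<delta>, 0, 1:]"
    unfolding F1_def F2_def
    using irreducible_comaximal irreducible_1 irreducible_2 separable_1 separable_2 by blast+
  then have "comaximal [:- \<delta>, 0, 1:] ((F1 * F2) ^ Suc N)"
    by (rule comax)
  then obtain e where e: "\<And>x. P e (P [:- \<delta>, 0, 1:] x) = x"
    using ex_poly_inverse kill by metis
  have E: "P [:- \<delta>, 0, 1:] x = u (u x) - \<delta> *s x" for x
    by (simp add: poly_endo_pCons)
  have u_P: "u (P f x) = P f (u x)" for f x
    by (rule poly_endo_intertwine[OF linear_u]) simp
  \<comment> \<open>\<delta>/u - u equals -(u^2 - \<delta>)/u, and \<open>e\<close> inverts u^2 -
    \<delta>.\<close>
  define Di where "Di x = - P e (u x)" for x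
  have Di: "Vector_Spaces.linear scale scale Di"
    unfolding Di_def by (rule linear_selfI) (simp_all add: u.add P.add u.scale P.scale)
  have Di_D: "Di (\<delta> *s ui x - u x) = x" for x
  proof -
    have "Di (\<delta> *s ui x - u x) = P e (P [:- \<delta>, 0, 1:] x)"
      by (simp add: Di_def E u.diff u.scale u_ui P.diff P.scale)
    then show ?thesis
      by (simp add: e)
  qed
  have D_Di: "\<delta> *s ui (Di x) - u (Di x) = x" for x
  proof -
    have "\<delta> *s ui (Di x) - u (Di x) = P e (P [:- \<delta>, 0, 1:] x)"
      by (simp add: Di_def E ui.neg u.neg ui_P ui_u u_P P.diff P.scale)
    then show ?thesis
      by (simp add: e)
  qed
  \<comment> \<open>The equation for \<sigma>\<sigma> solved for \<sigma>\<sigma>.\<close>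
  define \<nu> where "\<nu> x = np *s ui (ui (P F1 (P F2 x)))" for x
  have \<nu>: "Vector_Spaces.linear scale scale \<nu>"
    unfolding \<nu>_def by (rule linear_selfI) (simp_all add: P.add ui.add P.scale ui.scale scale_right_distrib mult.commute)
  let ?h = "\<lambda>x. \<delta> *s ui x"
  have h: "Vector_Spaces.linear scale scale ?h"
    by (rule linear_selfI) (simp_all add: ui.add ui.scale scale_right_distrib mult.commute)
  obtain M where M: "image_mset snd M = paired_powers F1 ms + paired_powers F2 ns" "cyclic_decomposition M"
    using dec by (auto simp: decomposes_as_def)
  obtain ml nl where ml: "mset ml = ms" and nl: "mset nl = ns"
    using ex_mset by metis
  define bl where "bl = map (Pair F1) ml @ map (Pair F2) nl"
  have bl_F: "f = F1 \<or> f = F2" if "(f, m) \<in> set bl" for f m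
    using that by (auto simp: bl_def)
  have "image_mset snd M = mset (concat (map halved_powers bl))"
    unfolding bl_def map_append concat_append mset_append mset_paired_list ml nl by (rule M(1))
  then obtain xs where xs: "map snd xs = concat (map halved_powers bl)" "mset xs = M"
    by (rule ex_list_of_image_mset)
  obtain ys where ys: "map (\<lambda>(v, w, p). p) ys = bl"
    "xs = concat (map (\<lambda>(v, w, f, m). [(v, f ^ ((m + 1) div 2)), (w, f ^ (m div 2))]) ys)"
    by (rule split_paired_list[OF xs(1)])
  \<comment> \<open>Third entries are the prescribed images: \<open>v\<close> goes to
    \<open>w\<close>, and \<open>w\<close> goes to \<nu> v.\<close>
  define zs where "zs = concat (map (\<lambda>(v, w, f, m). [(v, f ^ ((m + 1) div 2), w), (w, f ^ (m div 2), \<nu> v)]) ys)"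
  have "map (\<lambda>(v, g, z). (v, g)) zs = xs"
    unfolding zs_def ys(2) by (simp add: map_concat o_def case_prod_unfold)
  then have cyc: "cyclic_decomposition (mset (map (\<lambda>(v, g, z). (v, g)) zs))"
    using M(2) xs(2) by simp
  have zs: "(x, g, z) \<in> set zs \<longleftrightarrow> (\<exists>v w f m. (v, w, f, m) \<in> set ys \<and>
      ((x, g, z) = (v, f ^ ((m + 1) div 2), w) \<or> (x, g, z) = (w, f ^ (m div 2), \<nu> v)))" for x g z
    by (force simp: zs_def)
  have ysD: "f = F1 \<or> f = F2" "P (f ^ ((m + 1) div 2)) v = 0" "P (f ^ (m div 2)) w = 0"
    if "(v, w, f, m) \<in> set ys" for v w f m
  proof -
    show "f = F1 \<or> f = F2"
      using that by (intro bl_F[of f m]) (force simp: ys(1)[symmetric])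
    have "(v, f ^ ((m + 1) div 2)) \<in> set xs" "(w, f ^ (m div 2)) \<in> set xs"
      using that by (force simp: ys(2))+
    then show "P (f ^ ((m + 1) div 2)) v = 0" "P (f ^ (m div 2)) w = 0"
      using cyclic_decompositionD(2)[OF M(2)] xs(2) by auto
  qed
  have recip: "poly_endo scale (f ^ n) ?h x = 0" if "f = F1 \<or> f = F2" "P (f ^ n) x = 0" for f n x
    using that poly_endo_reciprocal_power[OF ui u_ui ui_u] unfolding F1_def F2_def by blast
  have mono: "P (f ^ k) x = 0" if "P (f ^ l) x = 0" "l \<le> k" for f k l x
    using that by (metis P_mult P.zero le_add_diff_inverse2 power_add)
  obtain \<sigma> where \<sigma>: "Vector_Spaces.linear scale scale \<sigma>" and \<sigma>_u: "\<And>x. \<sigma> (u x) = \<delta> *s ui (\<sigma> x)"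
    and \<sigma>_zs: "\<And>v g z. (v, g, z) \<in> set zs \<Longrightarrow> \<sigma> v = z"
  proof (rule ex_intertwining_map[OF cyc h])
    fix x g z assume "(x, g, z) \<in> set zs"
    then obtain v w f m where vwfm: "(v, w, f, m) \<in> set ys"
      and cases: "(x, g, z) = (v, f ^ ((m + 1) div 2), w) \<or> (x, g, z) = (w, f ^ (m div 2), \<nu> v)"
      unfolding zs by blast
    note ysD = ysD[OF vwfm]
    from cases show "poly_endo scale g ?h z = 0"
    proof
      assume "(x, g, z) = (v, f ^ ((m + 1) div 2), w)"
      moreover have "P (f ^ ((m + 1) div 2)) w = 0"
        by (rule mono[OF ysD(3)]) presburger
      ultimately show ?thesis
        using recip[OF ysD(1)] by simp
    next
      \<comment> \<open>\<nu> contains the factor \<open>f\<close>, so the shorter power suffices on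
        \<nu> v: one more factor \<open>f\<close> reaches the exponent that kills
        \<open>v\<close>.\<close>
      assume xgz: "(x, g, z) = (w, f ^ (m div 2), \<nu> v)"
      have "P (f ^ Suc (m div 2)) v = 0"
        by (rule mono[OF ysD(2)]) presburger
      then have fv: "P (f ^ (m div 2)) (P f v) = 0"
        by (simp only: power_Suc2 P_mult)
      have "P (f ^ (m div 2)) (P F1 (P F2 v)) = 0"
        using ysD(1)
      proof
        assume "f = F1"
        then show ?thesis
          using fv by (simp only: poly_endo_commute[OF linear_u, of _ F2] P.zero)
      next
        assume "f = F2"
        then show ?thesis
          using fv by (simp only: poly_endo_commute[OF linear_u, of _ F1] P.zero)
      qed
      then have "P (f ^ (m div 2)) (\<nu> v) = 0"
        unfolding \<nu>_def by (simp only: P.scale flip: ui_P) (simp only: ui.zero scale_zero_right)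
      then show ?thesis
        using recip[OF ysD(1)] xgz by simp
    qed
  qed blast
  interpret \<sigma>: Vector_Spaces.linear scale scale \<sigma> by (rule \<sigma>)
  interpret \<nu>: Vector_Spaces.linear scale scale \<nu> by (rule \<nu>)
  have \<sigma>_ui: "\<delta> *s \<sigma> (ui x) = u (\<sigma> x)" for x
    using \<sigma>_u[of "ui x"] by (simp add: u_ui u.scale)
  have \<nu>_u: "\<nu> (u x) = u (\<nu> x)" for x
  proof -
    have "P F1 (P F2 (u x)) = u (P F1 (P F2 x))"
      by (simp only: u_P)
    then show ?thesis
      by (simp add: \<nu>_def u.scale ui_u u_ui)
  qed
  \<comment> \<open>\<nu> equals np (c - T1)(c - T2) with c = u + \<delta>/u, which is invariant
    under u -> \<delta>/u. The computation clears \<delta>^2 instead of introducing c.\<close>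
  have \<sigma>_\<nu>: "\<sigma> (\<nu> x) = \<nu> (\<sigma> x)" for x
  proof -
    have \<sigma>_P: "\<sigma> (P [:\<delta>, - T, 1:] x) = \<delta> *s ui (ui (P [:\<delta>, - T, 1:] (\<sigma> x)))" for T x
      using poly_endo_intertwine[OF \<sigma>, of u ?h, OF \<sigma>_u] poly_endo_reciprocal[OF ui u_ui ui_u] by simp
    let ?y = "P F1 (P F2 (\<sigma> x))"
    have \<sigma>_ui_ui: "(\<delta> * \<delta>) *s \<sigma> (ui (ui y)) = u (u (\<sigma> y))" for y
      by (simp only: \<sigma>_ui u.scale[symmetric] flip: scale_scale)
    have "(\<delta> * \<delta>) *s \<sigma> (\<nu> x) = np *s ((\<delta> * \<delta>) *s \<sigma> (ui (ui (P F1 (P F2 x)))))"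
      by (simp add: \<nu>_def \<sigma>.scale mult.commute)
    also have "\<dots> = np *s u (u (\<sigma> (P F1 (P F2 x))))"
      by (simp only: \<sigma>_ui_ui)
    also have "\<sigma> (P F1 (P F2 x)) = (\<delta> * \<delta>) *s ui (ui (ui (ui ?y)))"
      by (simp add: F1_def F2_def \<sigma>_P P.scale ui.scale del: poly_endo_pCons flip: ui_P)
    also have "np *s u (u \<dots>) = (\<delta> * \<delta>) *s \<nu> (\<sigma> x)"
      by (simp add: \<nu>_def u.scale u_ui mult.commute)
    finally show ?thesis
      using \<delta>_nz by simp
  qed
  \<comment> \<open>The set is a u-stable subspace, so the generators suffice; for \<open>w\<close>
    = \<sigma> v use that \<sigma> and \<nu> commute.\<close>
  have "{x. \<sigma> (\<sigma> x) = \<nu> x} = UNIV"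
  proof (rule cyclic_decompositionD(3)[OF cyc])
    show "subspace {x. \<sigma> (\<sigma> x) = \<nu> x}"
      by (auto simp: subspace_def \<sigma>.add \<nu>.add \<sigma>.scale \<nu>.scale)
    show "u x \<in> {x. \<sigma> (\<sigma> x) = \<nu> x}" if "x \<in> {x. \<sigma> (\<sigma> x) = \<nu> x}" for x
      using that by (simp add: \<sigma>_u \<sigma>.scale \<sigma>_ui \<nu>_u)
    fix x g assume "(x, g) \<in># mset (map (\<lambda>(v, g, z). (v, g)) zs)"
    then obtain z where "(x, g, z) \<in> set zs"
      by auto
    then obtain v w f m where vwfm: "(v, w, f, m) \<in> set ys" "x = v \<or> x = w"
      unfolding zs by blast
    have "\<sigma> v = w"
      by (rule \<sigma>_zs) (use vwfm in \<open>auto simp: zs\<close>)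
    moreover have "\<sigma> w = \<nu> v"
      by (rule \<sigma>_zs) (use vwfm in \<open>auto simp: zs\<close>)
    ultimately show "x \<in> {x. \<sigma> (\<sigma> x) = \<nu> x}"
      using vwfm(2) \<sigma>_\<nu>[of v] by auto
  qed
  then have \<sigma>_\<sigma>: "u (u (\<sigma> (\<sigma> x))) = np *s P F1 (P F2 x)" for x
    by (simp add: set_eq_iff \<nu>_def u.scale u_ui)
  obtain a where a: "Vector_Spaces.linear scale scale a" "\<And>x. a (a x) = tp *s a x - np *s x"
    "\<And>x. ui (a (ui (a x))) = tq *s ui (a x) - nq *s x"
    by (rule quotient_of_semilinear[OF ui u_ui ui_u \<sigma> \<sigma>_u \<sigma>_\<sigma> Di Di_D D_Di]) blast
  interpret a: Vector_Spaces.linear scale scale a by (rule a(1))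
  have "bij a"
  proof (rule o_bij)
    show "(\<lambda>x. (1 / np) *s (tp *s x - a x)) \<circ> a = id" "a \<circ> (\<lambda>x. (1 / np) *s (tp *s x - a x)) = id"
      using np_nz by (auto simp: fun_eq_iff a(2) a.scale a.diff)
  qed
  have "bij ui"
    by (rule o_bij[of u]) (auto simp: fun_eq_iff u_ui ui_u)
  define b where "b = ui \<circ> a"
  have "bij b"
    unfolding b_def by (rule bij_comp[OF \<open>bij a\<close> \<open>bij ui\<close>])
  have "Vector_Spaces.linear scale scale b"
    unfolding b_def by (rule linear_selfI) (simp_all add: a.add ui.add a.scale ui.scale)
  moreover have "u = a \<circ> inv_into UNIV b"
  proof
    fix x
    have "u (b y) = a y" for y
      by (simp add: b_def u_ui)
    then show "u x = (a \<circ> inv_into UNIV b) x"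
      using surj_f_inv_f[OF bij_is_surj[OF \<open>bij b\<close>], of x] by (metis o_apply)
  qed
  moreover have "annihilates scale [:np, - tp, 1:] a" "annihilates scale [:nq, - tq, 1:] b"
    unfolding annihilates_quadratic_iff using a(2,3) by (simp_all add: b_def)
  ultimately show ?thesis
    unfolding pq_quotient_def automorphism_def using a(1) \<open>bij a\<close> \<open>bij b\<close> by blast
qed

end

section \<open>Quadratic extensions and traces\<close>

lemma degree_2_monic_eq:
  assumes "lead_coeff f = 1" and "Polynomial.degree f = 2"
  shows "f = [:Polynomial.coeff f 0, Polynomial.coeff f 1, 1:]"
proof (rule poly_eqI)
  fix n :: nat
  consider "n = 0" | "n = 1" | "n = 2" | "n > 2"
    by linarith
  then show "Polynomial.coeff f n = Polynomial.coeff [:Polynomial.coeff f 0, Polynomial.coeff f 1, 1:] n"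
    using assms by cases (auto simp: coeff_pCons numeral_2_eq_2 coeff_eq_0 split: nat.splits)
qed

lemma irreducible_quadratic_no_root:
  fixes a b x :: "'a::field"
  assumes "Factorial_Ring.irreducible [:a, b, 1:]"
  shows "a + b * x + x * x \<noteq> 0"
proof
  assume "a + b * x + x * x = 0"
  then have "a = - (b + x) * x"
    by (simp add: algebra_simps eq_neg_iff_add_eq_0)
  then have "[:a, b, 1:] = [:- x, 1:] * [:b + x, 1:]"
    by (simp add: algebra_simps)
  from Factorial_Ring.irreducibleD[OF assms this] show False
    by (auto simp: is_unit_iff_degree)
qed

lemma irreducible_quadraticI:
  fixes a b :: "'a::field"
  assumes "\<And>x. a + b * x + x * x \<noteq> 0"
  shows "Factorial_Ring.irreducible [:a, b, 1:]"
proof (rule Factorial_Ring.irreducibleI)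
  show "[:a, b, 1:] \<noteq> 0" "\<not> [:a, b, 1:] dvd 1"
    by (auto simp: is_unit_iff_degree)
  fix g h :: "'a poly" assume gh: "[:a, b, 1:] = g * h"
  then have "g \<noteq> 0" "h \<noteq> 0"
    by auto
  then have deg: "Polynomial.degree g + Polynomial.degree h = 2"
    using gh degree_mult_eq[of g h] by (metis degree_pCons_eq_if degree_0 one_neq_zero pCons_eq_0_iff Suc_1 One_nat_def)
  have "Polynomial.degree g \<noteq> 1"
  proof
    assume "Polynomial.degree g = 1"
    moreover obtain c r where "g = pCons c r"
      by (cases g)
    ultimately obtain d where "g = [:c, d:]" "d \<noteq> 0"
      by (auto split: if_splits elim!: degree_eq_zeroE)
    then have "poly g (- c / d) = 0"
      by simp
    then have "poly [:a, b, 1:] (- c / d) = 0"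
      unfolding gh by simp
    then show False
      using assms[of "- c / d"] by (simp add: algebra_simps)
  qed
  then have "Polynomial.degree g = 0 \<or> Polynomial.degree h = 0"
    using deg by linarith
  then show "g dvd 1 \<or> h dvd 1"
    using \<open>g \<noteq> 0\<close> \<open>h \<noteq> 0\<close> by (simp add: is_unit_iff_degree)
qed

locale quadratic_extension =
  fixes t n :: "'a::field" and x1 x2 :: "'a alg_closure"
  assumes sum: "x1 + x2 = to_ac t" and prod: "x1 * x2 = to_ac n" and distinct: "x1 \<noteq> x2"
    and irreducible: "Factorial_Ring.irreducible [:n, - t, 1:]"
begin

lemma root: "to_ac n - to_ac t * x1 + x1 * x1 = 0" "to_ac n - to_ac t * x2 + x2 * x2 = 0"
  unfolding sum[symmetric] prod[symmetric] by (simp_all add: algebra_simps)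

lemma root_not_in_range: "x1 \<noteq> to_ac c" "x2 \<noteq> to_ac c"
proof -
  have "to_ac (n + (- t) * c + c * c) \<noteq> 0"
    unfolding to_ac_eq_0_iff by (rule irreducible_quadratic_no_root) (rule irreducible)
  then have "to_ac n - to_ac t * to_ac c + to_ac c * to_ac c \<noteq> 0"
    by simp
  then show "x1 \<noteq> to_ac c" "x2 \<noteq> to_ac c"
    using root by auto
qed

lemma coordinates_unique:
  assumes "to_ac a + to_ac b * x1 = to_ac c + to_ac d * x1"
  shows "a = c" "b = d"
proof -
  have "b = d"
  proof (rule ccontr)
    assume "b \<noteq> d"
    then have "x1 = to_ac ((c - a) / (b - d))"
      using assms by (simp add: field_simps)
    then show False
      using root_not_in_range by blast
  qed
  then show "a = c" "b = d"
    using assms by auto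
qed

lemma not_in_range: "b \<noteq> 0 \<Longrightarrow> to_ac a + to_ac b * x1 \<noteq> to_ac c"
  using coordinates_unique[of a b c 0] by auto

definition K :: "'a alg_closure set" where
  "K = {to_ac a + to_ac b * x1 | a b. True}"

lemma KI: "z = to_ac a + to_ac b * x1 \<Longrightarrow> z \<in> K"
  by (auto simp: K_def)

lemma x1_sq: "x1 * x1 = to_ac t * x1 - to_ac n"
proof -
  have "x1 * x1 = (to_ac n - to_ac t * x1 + x1 * x1) + (to_ac t * x1 - to_ac n)"
    by simp
  then show ?thesis
    by (simp only: root(1) add_0)
qed

lemma K_inverse:
  assumes "z \<in> K" and "z \<noteq> 0"
  shows "inverse z \<in> K"
proof -
  obtain a b where z: "z = to_ac a + to_ac b * x1"
    using assms(1) by (auto simp: K_def)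
  \<comment> \<open>The conjugate of \<open>z\<close>; the product with it is the norm
    \<open>m\<close>, an element of the base field.\<close>
  define z' where "z' = to_ac a + to_ac b * x2"
  have "z' \<noteq> 0"
  proof
    assume "z' = 0"
    have "b = 0"
    proof (rule ccontr)
      assume "b \<noteq> 0"
      then have "x2 = to_ac (- a / b)"
        using \<open>z' = 0\<close> by (simp add: z'_def field_simps add_eq_0_iff)
      then show False
        using root_not_in_range by blast
    qed
    then show False
      using \<open>z' = 0\<close> assms(2) z by (simp add: z'_def)
  qed
  define m where "m = a * a + a * b * t + b * b * n"
  have m: "z * z' = to_ac m"
    unfolding z z'_def m_def to_ac_add to_ac_mult sum[symmetric] prod[symmetric] by (simp add: algebra_simps)
  then have "to_ac m \<noteq> 0"
    using assms(2) \<open>z' \<noteq> 0\<close> by (metis mult_eq_0_iff)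
  have "inverse z = z' / to_ac m"
    using assms(2) \<open>z' \<noteq> 0\<close> by (simp add: m[symmetric] field_simps)
  also have "z' = to_ac (a + b * t) + to_ac (- b) * x1"
  proof -
    have x2: "x2 = to_ac t - x1"
      using sum by (simp add: algebra_simps)
    show ?thesis
      unfolding z'_def x2 by (simp add: algebra_simps)
  qed
  finally have "inverse z = to_ac ((a + b * t) / m) + to_ac (- b / m) * x1"
    using \<open>to_ac m \<noteq> 0\<close> by (simp add: field_simps)
  then show ?thesis
    by (rule KI)
qed

text \<open>Explicit coordinates for the splitting field, needed to compute traces in it.\<close>

lemma generate_field_eq_K:
  assumes "S \<subseteq> K" and "x1 \<in> S"
  shows "generate_field ring_of_type_algebra (range to_ac \<union> S) = K" (is "generate_field ?R ?H = _")
proof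
  interpret R: field "?R"
    by (rule field_from_type_algebra)
  have simps: "\<one>\<^bsub>?R\<^esub> = 1" "\<zero>\<^bsub>?R\<^esub> = 0" "x \<otimes>\<^bsub>?R\<^esub> y = x * y" "x \<oplus>\<^bsub>?R\<^esub> y = x + y" "carrier ?R = UNIV" for x y :: "'a alg_closure"
    by (simp_all add: ring_of_type_algebra_def)
  have minus: "\<ominus>\<^bsub>?R\<^esub> x = - x" for x :: "'a alg_closure"
    by (rule R.minus_equality) (simp_all add: simps)
  have inv: "inv\<^bsub>?R\<^esub> x = inverse x" if "x \<noteq> 0" for x :: "'a alg_closure"
    using that by (intro R.comm_inv_char) (simp_all add: simps)
  show "generate_field ?R ?H \<subseteq> K"
  proof
    fix z assume "z \<in> generate_field ?R ?H"
    then show "z \<in> K"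
    proof induction
      case one
      show ?case by (rule KI[of _ 1 0]) (simp add: simps)
    next
      case (incl h)
      then show ?case
        using assms(1) by (auto intro: KI[of _ _ 0])
    next
      case (a_inv h)
      then obtain a b where "h = to_ac a + to_ac b * x1"
        by (auto simp: K_def)
      then show ?case
        by (intro KI[of _ "- a" "- b"]) (simp add: minus)
    next
      case (m_inv h)
      then show ?case
        using K_inverse inv by (simp add: simps)
    next
      case (eng_add g h)
      then obtain a b c d where "g = to_ac a + to_ac b * x1" "h = to_ac c + to_ac d * x1"
        by (auto simp: K_def)
      then show ?case
        by (intro KI[of _ "a + c" "b + d"]) (simp add: simps algebra_simps)
    next
      case (eng_mult g h)
      then obtain a b c d where gh: "g = to_ac a + to_ac b * x1" "h = to_ac c + to_ac d * x1"
        by (auto simp: K_def)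
      have "g * h = to_ac a * to_ac c + (to_ac a * to_ac d + to_ac b * to_ac c) * x1 + to_ac b * to_ac d * (x1 * x1)"
        by (simp add: gh algebra_simps)
      then show ?case
        unfolding x1_sq by (intro KI[of _ "a * c - b * d * n" "a * d + b * c + b * d * t"]) (simp add: simps algebra_simps)
    qed
  qed
  show "K \<subseteq> generate_field ?R ?H"
  proof
    fix z assume "z \<in> K"
    then obtain a b where z: "z = to_ac a \<oplus>\<^bsub>?R\<^esub> (to_ac b \<otimes>\<^bsub>?R\<^esub> x1)"
      by (auto simp: K_def simps)
    show "z \<in> generate_field ?R ?H"
      unfolding z using assms(2) by (intro generate_field.intros) auto
  qed
qed

text \<open>Any two-element basis works: if \<open>A\<close> represents multiplication by \<open>z\<close>, then
  \<open>(z - A\<^sub>1\<^sub>1)(z - A\<^sub>2\<^sub>2) = A\<^sub>1\<^sub>2 A\<^sub>2\<^sub>1\<close>, and comparing with the minimal polynomial of \<open>z\<close> gives the trace.\<close>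

lemma field_trace_K:
  assumes z: "z = to_ac a + to_ac b * x1" and b: "b \<noteq> 0"
  shows "field_trace K z = 2 * a + b * t"
proof -
  define sc where "sc = (\<lambda>(c :: 'a) w. to_ac c * w)"
  have sc: "sc c w = to_ac c * w" for c w
    by (simp add: sc_def)
  interpret vector_space sc
    by unfold_locales (simp_all add: sc algebra_simps)
  \<comment> \<open>\<open>m\<close> and \<open>s\<close> are the norm and the trace of
    \<open>z\<close>, read off from its quadratic equation.\<close>
  define m where "m = a * a + a * b * t + b * b * n"
  define s where "s = 2 * a + b * t"
  have z_sq: "z * z = to_ac s * z - to_ac m"
  proof -
    have "z * z = to_ac a * to_ac a + 2 * to_ac a * to_ac b * x1 + to_ac b * to_ac b * (x1 * x1)"
      by (simp add: z algebra_simps)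
    then show ?thesis
      unfolding x1_sq by (simp add: z s_def m_def algebra_simps)
  qed
  have z_range: "z \<noteq> to_ac c" for c
    unfolding z by (rule not_in_range[OF b])
  have span: "span {1, z} = K"
  proof -
    have "span {1, z} = {x. \<exists>k l. x - to_ac k = to_ac l * z}"
      by (simp add: span_insert span_singleton image_def sc)
    also have "\<dots> = K"
    proof (intro equalityI subsetI)
      fix x assume "x \<in> {x. \<exists>k l. x - to_ac k = to_ac l * z}"
      then obtain k l where "x = to_ac k + to_ac l * z"
        by (auto simp: algebra_simps)
      then show "x \<in> K"
        by (intro KI[of _ "k + l * a" "l * b"]) (simp add: z algebra_simps)
    next
      fix x assume "x \<in> K"
      then obtain c d where x: "x = to_ac c + to_ac d * x1"
        by (auto simp: K_def)
      have "x - to_ac (c - d / b * a) = to_ac (d / b) * z"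
        using b by (simp add: x z field_simps)
      then show "x \<in> {x. \<exists>k l. x - to_ac k = to_ac l * z}"
        by blast
    qed
    finally show ?thesis .
  qed
  have indep: "independent {1, z}"
  proof -
    have "z \<notin> span {1}"
      using z_range by (auto simp: span_singleton sc)
    then show ?thesis
      by (subst insert_commute) (simp add: independent_insert)
  qed
  have "z \<noteq> 1"
    using z_range[of 1] by simp
  have trace: "mat_trace A = s"
    if rep: "represented_on sc K (\<lambda>w. z * w) A" for A
  proof -
    obtain bs where bs: "basis_of sc K bs" "matrix_in_basis sc bs (\<lambda>w. z * w) A"
      using rep by (auto simp: represented_on_def)
    have "card (set bs) = card {1, z}"
      using bs(1) indep span unfolding basis_of_def
      by (metis dim_span_eq_card_independent)
    then have len: "length bs = 2"
      using bs(1) \<open>z \<noteq> 1\<close> by (simp add: basis_of_def distinct_card)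
    then obtain v w where vw: "bs = [v, w]"
      by (metis (no_types, opaque_lifting) One_nat_def Suc_1 length_0_conv length_Suc_conv)
    have nz: "v \<noteq> 0" "w \<noteq> 0"
      using bs(1) dependent_zero[of "set bs"] by (auto simp: basis_of_def vw)
    have A: "A \<in> carrier_mat 2 2" and
      col: "\<And>j. j < 2 \<Longrightarrow> z * bs ! j = (\<Sum>i<2. to_ac (A $$ (i, j)) * bs ! i)"
      using bs(2) len by (auto simp: matrix_in_basis_def sc)
    have "z * v = to_ac (A $$ (0, 0)) * v + to_ac (A $$ (1, 0)) * w"
      "z * w = to_ac (A $$ (0, 1)) * v + to_ac (A $$ (1, 1)) * w"
      using col[of 0] col[of 1] by (simp_all add: vw numeral_2_eq_2)
    then have 1: "(z - to_ac (A $$ (0, 0))) * v = to_ac (A $$ (1, 0)) * w"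
      "(z - to_ac (A $$ (1, 1))) * w = to_ac (A $$ (0, 1)) * v"
      by (simp_all add: algebra_simps)
    have "((z - to_ac (A $$ (0, 0))) * v) * ((z - to_ac (A $$ (1, 1))) * w) =
        (to_ac (A $$ (1, 0)) * w) * (to_ac (A $$ (0, 1)) * v)"
      unfolding 1 ..
    then have "(z - to_ac (A $$ (0, 0))) * (z - to_ac (A $$ (1, 1))) = to_ac (A $$ (1, 0)) * to_ac (A $$ (0, 1))"
      using nz by (simp add: mult_ac)
    then have "z * z = to_ac (A $$ (0, 0) + A $$ (1, 1)) * z -
        to_ac (A $$ (0, 0) * A $$ (1, 1) - A $$ (1, 0) * A $$ (0, 1))"
      by (simp add: algebra_simps)
    then have eq: "to_ac (s - (A $$ (0, 0) + A $$ (1, 1))) * z =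
        to_ac (m - (A $$ (0, 0) * A $$ (1, 1) - A $$ (1, 0) * A $$ (0, 1)))"
      unfolding z_sq by (simp add: algebra_simps)
    have "s - (A $$ (0, 0) + A $$ (1, 1)) = 0"
    proof (rule ccontr)
      assume nz: "s - (A $$ (0, 0) + A $$ (1, 1)) \<noteq> 0"
      then have "z = to_ac ((m - (A $$ (0, 0) * A $$ (1, 1) - A $$ (1, 0) * A $$ (0, 1))) / (s - (A $$ (0, 0) + A $$ (1, 1))))"
        using eq unfolding to_ac_divide by (metis nonzero_mult_div_cancel_left to_ac_eq_0_iff)
      then show False
        using z_range by blast
    qed
    then show ?thesis
      using A by (simp add: mat_trace_def numeral_2_eq_2)
  qed
  define A where "A = mat 2 2 (\<lambda>(i, j). if j = 0 then (if i = 0 then 0 else 1) else if i = 0 then - m else s)"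
  have "basis_of sc K [1, z]"
    using indep span \<open>z \<noteq> 1\<close> by (simp add: basis_of_def)
  moreover have "matrix_in_basis sc [1, z] (\<lambda>w. z * w) A"
    unfolding matrix_in_basis_def by (auto simp: A_def less_Suc_eq numeral_2_eq_2 z_sq sc)
  ultimately have "represented_on sc K (\<lambda>w. z * w) A"
    by (auto simp: represented_on_def)
  then show ?thesis
    unfolding field_trace_def s_def[symmetric] sc_def[symmetric] using trace by (intro the_equality) blast+
qed

end

lemma poly_map_to_ac_quadratic: "poly (map_poly to_ac [:a, b, 1:]) z = to_ac a + to_ac b * z + z * z"
  by (simp add: map_poly_pCons algebra_simps)

lemma Root_quadratic: "Root [:n, - t, 1:] = {z. to_ac n - to_ac t * z + z * z = 0}"
  unfolding Root_def poly_map_to_ac_quadratic by simp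

text \<open>A root set does not record multiplicities, so x1 = x2 is allowed; the starting point is
  that t - x1 is again a root.\<close>

lemma Vieta_Root:
  assumes "Root [:n, - t, 1:] = {x1, x2}"
  shows "x1 + x2 = to_ac t" and "x1 * x2 = to_ac n"
proof -
  have *: "to_ac n - to_ac t * z + z * z = 0 \<longleftrightarrow> z = x1 \<or> z = x2" for z
    using assms unfolding Root_quadratic by blast
  have x1: "to_ac n - to_ac t * x1 + x1 * x1 = 0"
    by (simp add: *)
  have x2: "to_ac n - to_ac t * x2 + x2 * x2 = 0"
    by (simp add: *)
  have "to_ac n - to_ac t * (to_ac t - x1) + (to_ac t - x1) * (to_ac t - x1) = to_ac n - to_ac t * x1 + x1 * x1"
    by (simp add: algebra_simps)
  then have "to_ac t - x1 = x1 \<or> to_ac t - x1 = x2"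
    using x1 * by metis
  \<comment> \<open>If x1 is its own partner, expanding the quadratic about x1 gives (x2 - x1)^2 =
    0.\<close>
  moreover have "x2 = to_ac t - x1" if "to_ac t - x1 = x1" "x1 \<noteq> x2"
  proof -
    have "(x2 - x1) * (x2 - x1) = to_ac n - to_ac t * x2 + x2 * x2 - (to_ac n - to_ac t * x1 + x1 * x1) + (x2 - x1) * (to_ac t - x1 - x1)"
      by (simp add: algebra_simps)
    then show ?thesis
      using x1 x2 that by simp
  qed
  ultimately show sum: "x1 + x2 = to_ac t"
    by (cases "x1 = x2") (auto simp: algebra_simps)
  have "x1 * x2 = to_ac n - (to_ac n - to_ac t * x1 + x1 * x1)"
    unfolding sum[symmetric] by (simp add: algebra_simps)
  then show "x1 * x2 = to_ac n"
    by (simp add: x1)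
qed

lemma separable_quadratic_distinct:
  assumes "separable_poly [:n, - t, 1:]" and "Root [:n, - t, 1:] = {x1, x2}"
  shows "x1 \<noteq> x2"
proof
  assume eq: "x1 = x2"
  let ?p = "map_poly to_ac [:n, - t, 1:]"
  have "?p = [:- x1, 1:] ^ 2"
    using Vieta_Root[OF assms(2)] eq
    by (simp add: map_poly_pCons power2_eq_square algebra_simps)
  then have "2 \<le> order x1 ?p"
    by (metis order_divides dvd_refl order_0I poly_eq_0_iff_dvd power_eq_0_iff pCons_eq_0_iff one_neq_zero)
  moreover have "order x1 ?p = 0 \<or> order x1 ?p = 1"
    using assms(1) by (auto simp: separable_poly_def rsquarefree_def)
  ultimately show False
    by auto
qed

context quadratic_extension
begin

text \<open>\<open>b\<close> being nonzero keeps z out of the base field, so the quadratic with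
  roots z, z' is its minimal polynomial, and its linear coefficient is the trace of both.\<close>

lemma conjugate_pair:
  assumes z: "z = to_ac a + to_ac b * x1" "z' = to_ac a + to_ac b * x2" and b: "b \<noteq> 0"
    and \<delta>: "z * z' = to_ac \<delta>"
  defines "T \<equiv> 2 * a + b * t"
  shows "field_trace K z = T" "field_trace K z' = T"
    and "to_ac \<delta> - to_ac T * w + w * w = 0 \<longleftrightarrow> w = z \<or> w = z'"
    and "Factorial_Ring.irreducible [:\<delta>, - T, 1:]"
    and "\<not> [:\<delta>, - T, 1:] dvd [:- \<delta>, 0, 1:]"
proof -
  have x2: "x2 = to_ac t - x1"
    using sum by (simp add: algebra_simps)
  have z': "z' = to_ac (a + b * t) + to_ac (- b) * x1"
    by (simp add: z(2) x2 algebra_simps)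
  show "field_trace K z = T"
    unfolding T_def by (rule field_trace_K[OF z(1) b])
  have "field_trace K z' = 2 * (a + b * t) + - b * t"
    using b by (intro field_trace_K[OF z']) simp
  then show "field_trace K z' = T"
    by (simp add: T_def algebra_simps)
  have zz': "z + z' = to_ac T"
    by (simp add: z(1) z' T_def algebra_simps)
  have factor: "to_ac \<delta> - to_ac T * w + w * w = (w - z) * (w - z')" for w
    unfolding \<delta>[symmetric] zz'[symmetric] by (simp add: algebra_simps)
  show roots: "to_ac \<delta> - to_ac T * w + w * w = 0 \<longleftrightarrow> w = z \<or> w = z'" for w
    by (simp add: factor)
  have range: "z \<noteq> to_ac c" "z' \<noteq> to_ac c" for c
    using not_in_range[OF b, of a c] not_in_range[of "- b" "a + b * t" c] b z(1) z' by auto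
  show "Factorial_Ring.irreducible [:\<delta>, - T, 1:]"
  proof (rule irreducible_quadraticI)
    fix c
    have "to_ac (\<delta> + - T * c + c * c) \<noteq> 0"
      using roots[of "to_ac c"] range by (metis add_uminus_conv_diff minus_mult_commute mult_minus_left to_ac_add to_ac_minus to_ac_mult)
    then show "\<delta> + - T * c + c * c \<noteq> 0"
      by (simp only: to_ac_eq_0_iff not_False_eq_True)
  qed
  show "\<not> [:\<delta>, - T, 1:] dvd [:- \<delta>, 0, 1:]"
  proof
    assume "[:\<delta>, - T, 1:] dvd [:- \<delta>, 0, 1:]"
    then have dvd: "[:\<delta>, - T, 1:] dvd [:- \<delta>, 0, 1:] - [:\<delta>, - T, 1:]"
      by (rule dvd_diff) simp
    have "[:- \<delta>, 0, 1:] - [:\<delta>, - T, 1:] = 0"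
    proof (rule ccontr)
      assume "[:- \<delta>, 0, 1:] - [:\<delta>, - T, 1:] \<noteq> 0"
      then have "Polynomial.degree [:\<delta>, - T, 1:] \<le> Polynomial.degree ([:- \<delta>, 0, 1:] - [:\<delta>, - T, 1:])"
        by (rule dvd_imp_degree_le[OF dvd])
      then show False
        by (auto split: if_splits)
    qed
    \<comment> \<open>Two monic quadratics, one dividing the other, coincide. The resulting z z = z
      z' then contradicts that conjugates are distinct.\<close>
    then have T: "T = 0" and \<delta>2: "\<delta> = - \<delta>"
      by (auto simp: minus_equation_iff)
    have "z * z = - to_ac \<delta>"
      using roots[of z] T by (simp add: eq_neg_iff_add_eq_0 add.commute)
    also have "\<dots> = to_ac \<delta>"
      using \<delta>2 by (metis to_ac_minus)
    finally have "z * z = z * z'"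
      unfolding \<delta> .
    then have "z = z'"
      using range[of 0] by simp
    then show False
      using b distinct by (simp add: z)
  qed
qed

end

section \<open>Quotients of roots in the common splitting field\<close>

locale pq_fields =
  fixes tp np tq nq :: "'a::field" and L :: "'a alg_closure set" and x1 x2 y1 y2 :: "'a alg_closure" and \<delta> :: 'a
  assumes p: "Factorial_Ring.irreducible [:np, - tp, 1:]"
    and q: "Factorial_Ring.irreducible [:nq, - tq, 1:]"
    and L: "splitting_field [:np, - tp, 1:] = L" "splitting_field [:nq, - tq, 1:] = L"
    and not_homothetic: "\<not> homothetic [:np, - tp, 1:] [:nq, - tq, 1:]"
    and separable: "separable_poly [:np, - tp, 1:]"
    and \<delta>_eq: "\<delta> = np * inverse nq"
    and roots: "Root [:np, - tp, 1:] = {x1, x2}" "Root [:nq, - tq, 1:] = {y1, y2}"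
begin

sublocale ext: quadratic_extension tp np x1 x2
  using Vieta_Root[OF roots(1)] separable_quadratic_distinct[OF separable roots(1)] p
  by unfold_locales

lemma nz: "np \<noteq> 0" "nq \<noteq> 0" "\<delta> \<noteq> 0" and np_eq: "np = \<delta> * nq"
proof -
  show "np \<noteq> 0" "nq \<noteq> 0"
    using irreducible_quadratic_no_root[OF p, of 0] irreducible_quadratic_no_root[OF q, of 0] by simp_all
  then show "\<delta> \<noteq> 0" "np = \<delta> * nq"
    by (simp_all add: \<delta>_eq)
qed

lemma y_sum: "y1 + y2 = to_ac tq" and y_prod: "y1 * y2 = to_ac nq"
  using Vieta_Root[OF roots(2)] by auto

lemma x_nz: "x1 * x2 \<noteq> 0" and y_nz: "y1 * y2 \<noteq> 0"
  unfolding ext.prod y_prod using nz by simp_all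

lemma L_eq: "L = ext.K"
proof -
  have "x1 \<in> ext.K"
    by (rule ext.KI[of _ 0 1]) simp
  moreover have "x2 \<in> ext.K"
    using ext.sum by (intro ext.KI[of _ tp "- 1"]) (simp add: algebra_simps)
  ultimately show ?thesis
    using L(1) ext.generate_field_eq_K[of "{x1, x2}"] by (simp add: splitting_field_def roots(1))
qed

text \<open>The common splitting field puts y1 in the span of 1 and x1; \<open>e\<close> is nonzero
  since q has no root in the base field. The last two formulas are the trace and norm of c + e
  x1.\<close>

lemma y_coordinates:
  obtains c e where "y1 = to_ac c + to_ac e * x1" "y2 = to_ac c + to_ac e * x2" "e \<noteq> 0"
    "tq = 2 * c + e * tp" "nq = c * c + c * e * tp + e * e * np"
proof -
  have "y1 \<in> L"
    unfolding L(2)[symmetric] splitting_field_def using roots(2) by (auto intro: generate_field.incl)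
  then obtain c e where y1: "y1 = to_ac c + to_ac e * x1"
    by (auto simp: L_eq ext.K_def)
  have root: "to_ac nq - to_ac tq * y1 + y1 * y1 = 0"
    unfolding y_sum[symmetric] y_prod[symmetric] by (simp add: algebra_simps)
  have e: "e \<noteq> 0"
  proof
    assume "e = 0"
    then have "to_ac (nq + - tq * c + c * c) = 0"
      using root by (simp add: y1)
    then have "nq + - tq * c + c * c = 0"
      unfolding to_ac_eq_0_iff .
    then show False
      using irreducible_quadratic_no_root[OF q, of c] by simp
  qed
  have "y1 * y1 = to_ac c * to_ac c + 2 * to_ac c * to_ac e * x1 + to_ac e * to_ac e * (x1 * x1)"
    by (simp add: y1 algebra_simps)
  then have "to_ac (nq - tq * c + c * c - e * e * np) + to_ac (- tq * e + 2 * c * e + e * e * tp) * x1 =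
      to_ac nq - to_ac tq * y1 + y1 * y1"
    unfolding ext.x1_sq by (simp add: y1 algebra_simps)
  then have "to_ac (nq - tq * c + c * c - e * e * np) + to_ac (- tq * e + 2 * c * e + e * e * tp) * x1 = to_ac 0 + to_ac 0 * x1"
    unfolding root by simp
  from ext.coordinates_unique[OF this]
  have 1: "nq = tq * c - c * c + e * e * np" and "e * tq = e * (2 * c + e * tp)"
    by (simp_all add: algebra_simps)
  then have tq: "tq = 2 * c + e * tp"
    using e by simp
  moreover have "nq = c * c + c * e * tp + e * e * np"
    unfolding 1 tq by (simp add: algebra_simps)
  moreover have "y2 = to_ac c + to_ac e * x2"
  proof -
    have "y2 = to_ac tq - y1" "x2 = to_ac tp - x1"
      using y_sum ext.sum by (simp_all add: algebra_simps)
    then show ?thesis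
      by (simp only: tq y1) (simp add: algebra_simps)
  qed
  ultimately show thesis
    using that y1 e by blast
qed

lemma not_homotheticD: "d \<noteq> 0 \<Longrightarrow> nq = np / (d * d) \<Longrightarrow> tq = tp / d \<Longrightarrow> False"
proof -
  assume d: "d \<noteq> 0" "nq = np / (d * d)" "tq = tp / d"
  have "[:nq, - tq, 1:] = Polynomial.smult (inverse (d ^ 2)) (pcompose [:np, - tp, 1:] [:0, d:])"
    using d(1) unfolding d(2,3) by (simp add: pcompose_pCons power2_eq_square field_simps)
  then show False
    using not_homothetic d(1) unfolding homothetic_def by blast
qed

text \<open>With y = c + e x, the quotients x1/y1 and x1/y2 have x1-coordinates c/nq and (c + e
  tp)/nq. Non-homothety makes both nonzero, so the quotients generate the extension; the traces
  differ by e (tp^2 - 4 np) / nq.\<close>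

lemma trace_poly_data:
  obtains T1 T2 where "np * T1 + np * T2 = \<delta> * tp * tq"
    and "np * T1 * T2 = \<delta> * \<delta> * tq * tq + \<delta> * tp * tp - 4 * np * \<delta>"
    and "T1 \<noteq> T2"
    and "Factorial_Ring.irreducible [:\<delta>, - T1, 1:]" "Factorial_Ring.irreducible [:\<delta>, - T2, 1:]"
    and "\<not> [:\<delta>, - T1, 1:] dvd [:- \<delta>, 0, 1:]" "\<not> [:\<delta>, - T2, 1:] dvd [:- \<delta>, 0, 1:]"
    and "trace_poly L \<delta> (x1 * inverse y1) = [:\<delta>, - T1, 1:]"
      "trace_poly L \<delta> (x1 * inverse y2) = [:\<delta>, - T2, 1:]"
      "trace_poly L \<delta> (x2 * inverse y1) = [:\<delta>, - T2, 1:]"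
      "trace_poly L \<delta> (x2 * inverse y2) = [:\<delta>, - T1, 1:]"
    and "\<And>w. to_ac \<delta> - to_ac T1 * w + w * w = 0 \<longleftrightarrow> w = x1 * inverse y1 \<or> w = x2 * inverse y2"
      "\<And>w. to_ac \<delta> - to_ac T2 * w + w * w = 0 \<longleftrightarrow> w = x1 * inverse y2 \<or> w = x2 * inverse y1"
proof -
  obtain c e where y: "y1 = to_ac c + to_ac e * x1" "y2 = to_ac c + to_ac e * x2" and e: "e \<noteq> 0"
    and tq: "tq = 2 * c + e * tp" and nq: "nq = c * c + c * e * tp + e * e * np"
    by (rule y_coordinates)
  \<comment> \<open>Otherwise y1 = e x1, a homothety with d = 1/e.\<close>
  have c: "c \<noteq> 0"
  proof
    assume "c = 0"
    then show False
      using not_homotheticD[of "1 / e"] e by (simp add: tq nq)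
  qed
  \<comment> \<open>Otherwise y1 = -e x2, a homothety with d = -1/e.\<close>
  have ce: "c + e * tp \<noteq> 0"
  proof
    assume "c + e * tp = 0"
    then have "c = - e * tp"
      by (simp add: add_eq_0_iff)
    then show False
      using not_homotheticD[of "- 1 / e"] e by (simp add: tq nq algebra_simps)
  qed
  have nz': "x1 \<noteq> 0" "x2 \<noteq> 0" "y1 \<noteq> 0" "y2 \<noteq> 0" "to_ac nq \<noteq> 0"
    using y_nz x_nz nz(2) by auto
  have inv: "inverse y1 = y2 / to_ac nq" "inverse y2 = y1 / to_ac nq"
    unfolding y_prod[symmetric] using nz' by (simp_all add: field_simps)
  have x_prod: "x1 * x2 = to_ac np" "x2 * x1 = to_ac np"
    using ext.prod by (simp_all add: mult.commute)
  have sq: "x1 * x1 = to_ac tp * x1 - to_ac np" "x2 * x2 = to_ac tp * x2 - to_ac np"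
    unfolding ext.sum[symmetric] ext.prod[symmetric] by (simp_all add: algebra_simps)
  \<comment> \<open>Coordinates of x1/y1 and x1/y2, from 1/y1 = y2/nq and 1/y2 = y1/nq.\<close>
  let ?a = "e * np / nq" and ?b = "c / nq" and ?a' = "- (e * np / nq)" and ?b' = "(c + e * tp) / nq"
  have "x1 * y2 = to_ac e * (x1 * x2) + to_ac c * x1" "x2 * y1 = to_ac e * (x2 * x1) + to_ac c * x2"
    "x1 * y1 = to_ac e * (x1 * x1) + to_ac c * x1" "x2 * y2 = to_ac e * (x2 * x2) + to_ac c * x2"
    by (simp_all add: y algebra_simps)
  then have z: "x1 * inverse y1 = to_ac ?a + to_ac ?b * x1" "x2 * inverse y2 = to_ac ?a + to_ac ?b * x2"
    and z': "x1 * inverse y2 = to_ac ?a' + to_ac ?b' * x1" "x2 * inverse y1 = to_ac ?a' + to_ac ?b' * x2"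
    unfolding inv x_prod sq using nz'(5) by (simp_all add: field_simps)
  have "to_ac \<delta> = to_ac np / to_ac nq"
    by (simp add: \<delta>_eq divide_inverse)
  then have \<delta>: "(x1 * inverse y1) * (x2 * inverse y2) = to_ac \<delta>" "(x1 * inverse y2) * (x2 * inverse y1) = to_ac \<delta>"
    unfolding ext.prod[symmetric] y_prod[symmetric] using nz' by (simp_all add: field_simps)
  note c1 = ext.conjugate_pair[OF z _ \<delta>(1)] and c2 = ext.conjugate_pair[OF z' _ \<delta>(2)]
  have b: "?b \<noteq> 0" "?b' \<noteq> 0"
    using c ce nz by auto
  let ?T1 = "2 * ?a + ?b * tp" and ?T2 = "2 * ?a' + ?b' * tp"
  have T: "?T1 = (c * tp + 2 * e * np) / nq" "?T2 = (c * tp + e * (tp * tp - 2 * np)) / nq"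
    using nz by (simp_all add: field_simps)
  \<comment> \<open>The discriminant is (x1 - x2)^2, nonzero by separability.\<close>
  have disc: "tp * tp - 4 * np \<noteq> 0"
  proof
    assume "tp * tp - 4 * np = 0"
    then have "to_ac tp * to_ac tp - 4 * to_ac np = 0"
      by (metis to_ac_0 to_ac_diff to_ac_mult to_ac_numeral)
    then have "(x1 - x2) * (x1 - x2) = 0"
      unfolding ext.sum[symmetric] ext.prod[symmetric] by (simp add: algebra_simps)
    then show False
      using ext.distinct by simp
  qed
  show thesis
  proof (rule that[of ?T1 ?T2])
    have "\<delta> = np / nq"
      by (simp add: \<delta>_eq divide_inverse)
    show "np * ?T1 + np * ?T2 = \<delta> * tp * tq"
      unfolding T \<open>\<delta> = np / nq\<close> tq using nz by (simp add: field_simps)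
    have "nq * nq * (np * ?T1 * ?T2) = np * (c * tp + 2 * e * np) * (c * tp + e * (tp * tp - 2 * np))"
      unfolding T using nz by (simp add: field_simps)
    also have "\<dots> = np * (np * tq * tq + (tp * tp - 4 * np) * nq)"
      unfolding tq nq by (simp add: algebra_simps)
    also have "\<dots> = nq * nq * (\<delta> * \<delta> * tq * tq + \<delta> * tp * tp - 4 * np * \<delta>)"
      unfolding np_eq by (simp add: algebra_simps)
    finally show "np * ?T1 * ?T2 = \<delta> * \<delta> * tq * tq + \<delta> * tp * tp - 4 * np * \<delta>"
      using nz by simp
    have diff: "nq * (?T2 - ?T1) = e * (tp * tp - 4 * np)"
      unfolding T using nz by (simp add: field_simps)
    show "?T1 \<noteq> ?T2"
    proof
      assume "?T1 = ?T2"
      then have "nq * (?T2 - ?T1) = 0"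
        by (simp only: diff_self mult_zero_right)
      from trans[OF diff[symmetric] this] show False
        using e disc by simp
    qed
    show "trace_poly L \<delta> (x1 * inverse y1) = [:\<delta>, - ?T1, 1:]"
      "trace_poly L \<delta> (x1 * inverse y2) = [:\<delta>, - ?T2, 1:]"
      "trace_poly L \<delta> (x2 * inverse y1) = [:\<delta>, - ?T2, 1:]"
      "trace_poly L \<delta> (x2 * inverse y2) = [:\<delta>, - ?T1, 1:]"
      unfolding trace_poly_def L_eq c1(1,2)[OF b(1)] c2(1,2)[OF b(2)] by simp_all
  qed (use c1(3-5)[OF b(1)] c2(3-5)[OF b(2)] in blast)+
qed

text \<open>\<delta> is the product of the quotient x/y with its conjugate, so \<delta> y / x is
  that conjugate and has the same trace.\<close>

lemma trace_poly_reciprocal: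
  assumes "x \<in> {x1, x2}" "y \<in> {y1, y2}"
  shows "trace_poly L \<delta> (to_ac \<delta> * inverse x * y) = trace_poly L \<delta> (x * inverse y)"
proof -
  have nz': "x1 \<noteq> 0" "x2 \<noteq> 0" "y1 \<noteq> 0" "y2 \<noteq> 0"
    using x_nz y_nz by auto
  have "to_ac \<delta> = to_ac np / to_ac nq"
    by (simp add: \<delta>_eq divide_inverse)
  then have "to_ac \<delta> = (x1 * x2) / (y1 * y2)"
    by (simp only: ext.prod y_prod)
  then have "to_ac \<delta> * inverse x1 * y1 = x2 * inverse y2" "to_ac \<delta> * inverse x1 * y2 = x2 * inverse y1"
    "to_ac \<delta> * inverse x2 * y1 = x1 * inverse y2" "to_ac \<delta> * inverse x2 * y2 = x1 * inverse y1"
    using nz' by (simp_all add: field_simps)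
  moreover obtain T1 T2 where "trace_poly L \<delta> (x1 * inverse y1) = [:\<delta>, - T1, 1:]"
      "trace_poly L \<delta> (x1 * inverse y2) = [:\<delta>, - T2, 1:]"
      "trace_poly L \<delta> (x2 * inverse y1) = [:\<delta>, - T2, 1:]"
      "trace_poly L \<delta> (x2 * inverse y2) = [:\<delta>, - T1, 1:]"
    by (rule trace_poly_data) blast
  ultimately show ?thesis
    using assms by auto
qed

end

section \<open>Eigenvalues in the algebraic closure\<close>

interpretation to_ac: map_poly_comm_ring_hom "to_ac :: 'a::field \<Rightarrow> 'a alg_closure"
  by unfold_locales simp_all

text \<open>Peel off linear factors of \<open>g\<close>; the last nonzero vector before reaching 0
  is an eigenvector. It has the form of a polynomial in \<open>f\<close> applied to
  \<open>c\<close>, hence stays in every \<open>f\<close>-stable subspace containing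
  \<open>c\<close>.\<close>

lemma (in vector_space) ex_eigenvector_of_kernel:
  fixes g :: "'a poly"
  assumes ac: "\<And>h :: 'a poly. Polynomial.degree h > 0 \<Longrightarrow> \<exists>z. poly h z = 0"
    and f: "Vector_Spaces.linear scale scale f" and "g \<noteq> 0" and "poly_endo scale g f c = 0" and "c \<noteq> 0"
  shows "\<exists>z h. poly g z = 0 \<and> poly_endo scale h f c \<noteq> 0 \<and>
    f (poly_endo scale h f c) = scale z (poly_endo scale h f c)"
  using assms(3,4)
proof (induction "Polynomial.degree g" arbitrary: g rule: less_induct)
  case less
  show ?case
  proof (cases "Polynomial.degree g = 0")
    case True
    then obtain a where "g = [:a:]"
      by (rule degree_eq_zeroE)
    then show ?thesis
      using less.prems assms(5) by (simp add: poly_endo_pCons)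
  next
    case False
    then obtain z where z: "poly g z = 0"
      using ac by blast
    then obtain h where h: "g = [:- z, 1:] * h"
      unfolding poly_eq_0_iff_dvd by (rule dvdE)
    then have "h \<noteq> 0"
      using less.prems by auto
    have "poly_endo scale [:- z, 1:] f (poly_endo scale h f c) = 0"
      using less.prems(2) unfolding h poly_endo_mult[OF f] .
    then have eig: "f (poly_endo scale h f c) = scale z (poly_endo scale h f c)"
      by (simp add: poly_endo_pCons eq_neg_iff_add_eq_0)
    show ?thesis
    proof (cases "poly_endo scale h f c = 0")
      case True
      have "Polynomial.degree h < Polynomial.degree g"
        using \<open>h \<noteq> 0\<close> unfolding h by (subst degree_mult_eq) auto
      then show ?thesis
        using less.hyps[OF _ \<open>h \<noteq> 0\<close> True] unfolding h by auto
    next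
      case False
      then show ?thesis
        using z eig by blast
    qed
  qed
qed

text \<open>Extension of scalars, with vectors over the closure as functions supported on \<open>{..<n}\<close>.\<close>

definition scale_fun :: "'b::field \<Rightarrow> (nat \<Rightarrow> 'b) \<Rightarrow> nat \<Rightarrow> 'b" where
  "scale_fun s c = (\<lambda>i. s * c i)"

interpretation fun_space: vector_space "scale_fun :: 'b::field \<Rightarrow> (nat \<Rightarrow> 'b) \<Rightarrow> nat \<Rightarrow> 'b"
  by unfold_locales (auto simp: scale_fun_def fun_eq_iff algebra_simps)

definition mat_act :: "'b::field mat \<Rightarrow> (nat \<Rightarrow> 'b) \<Rightarrow> nat \<Rightarrow> 'b" where
  "mat_act A c = (\<lambda>i. if i < dim_row A then \<Sum>j<dim_row A. A $$ (i, j) * c j else 0)"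

lemma linear_mat_act: "Vector_Spaces.linear scale_fun scale_fun (mat_act A)"
  by (rule fun_space.linear_selfI)
    (auto simp: mat_act_def scale_fun_def fun_eq_iff distrib_left sum.distrib sum_distrib_left mult.left_commute)

lemma eigenvalue_iff_mat_act:
  assumes A: "A \<in> carrier_mat n n"
  shows "eigenvalue A z \<longleftrightarrow> (\<exists>c. c \<noteq> 0 \<and> (\<forall>i\<ge>n. c i = 0) \<and> mat_act A c = scale_fun z c)"
proof
  assume "eigenvalue A z"
  then obtain v where v: "v \<in> carrier_vec n" "v \<noteq> 0\<^sub>v n" "A *\<^sub>v v = z \<cdot>\<^sub>v v"
    using A by (auto simp: eigenvalue_def eigenvector_def)
  let ?c = "\<lambda>i. if i < n then v $ i else 0"
  have "?c \<noteq> 0"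
  proof
    assume "?c = 0"
    then have "v $ i = 0" if "i < n" for i
      using fun_cong[of ?c 0 i] that by simp
    then have "v = 0\<^sub>v n"
      using v(1) by (intro eq_vecI) auto
    then show False
      using v(2) by simp
  qed
  moreover have "mat_act A ?c = scale_fun z ?c"
  proof
    fix i
    show "mat_act A ?c i = scale_fun z ?c i"
    proof (cases "i < n")
      case True
      have "(A *\<^sub>v v) $ i = (\<Sum>j<n. A $$ (i, j) * v $ j)"
        using A v(1) True by (simp add: scalar_prod_def lessThan_atLeast0)
      then show ?thesis
        using A v(1,3) True by (simp add: mat_act_def scale_fun_def)
    next
      case False
      then show ?thesis
        using A by (simp add: mat_act_def scale_fun_def)
    qed
  qed
  ultimately show "\<exists>c. c \<noteq> 0 \<and> (\<forall>i\<ge>n. c i = 0) \<and> mat_act A c = scale_fun z c"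
    by (intro exI[of _ ?c]) simp
next
  assume "\<exists>c. c \<noteq> 0 \<and> (\<forall>i\<ge>n. c i = 0) \<and> mat_act A c = scale_fun z c"
  then obtain c where c: "c \<noteq> 0" "\<forall>i\<ge>n. c i = 0" "mat_act A c = scale_fun z c"
    by blast
  let ?v = "vec n c"
  have "?v \<noteq> 0\<^sub>v n"
  proof
    assume "?v = 0\<^sub>v n"
    then have "c i = 0" if "i < n" for i
      using that by (metis index_vec index_zero_vec(1))
    then have "c = 0"
      using c(2) by (auto simp: fun_eq_iff not_less[symmetric])
    then show False
      using c(1) by simp
  qed
  moreover have "A *\<^sub>v ?v = z \<cdot>\<^sub>v ?v"
  proof (rule eq_vecI)
    fix i assume "i < dim_vec (z \<cdot>\<^sub>v ?v)"
    then have i: "i < n"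
      by simp
    have "(A *\<^sub>v ?v) $ i = mat_act A c i"
      using A i by (simp add: mat_act_def scalar_prod_def lessThan_atLeast0)
    then show "(A *\<^sub>v ?v) $ i = (z \<cdot>\<^sub>v ?v) $ i"
      using i by (simp add: c(3) scale_fun_def)
  qed (use A in simp)
  ultimately show "eigenvalue A z"
    unfolding eigenvalue_def eigenvector_def using A by (intro exI[of _ ?v]) auto
qed

context endomorphism
begin

context
  fixes bs :: "'v list" and A :: "'a mat"
  assumes basis: "basis_of scale UNIV bs" and mat: "matrix_in_basis scale bs u A"
begin

abbreviation A_ac :: "'a alg_closure mat" where
  "A_ac \<equiv> map_mat to_ac A"

text \<open>The map x -> x tensor 1 into the scalar extension, in coordinates; it carries u to the
  matrix over the closure.\<close>

definition coords :: "'v \<Rightarrow> nat \<Rightarrow> 'a alg_closure" where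
  "coords x = (\<lambda>i. if i < length bs then to_ac (representation (set bs) x (bs ! i)) else 0)"

lemma basisD: "distinct bs" "independent (set bs)" "span (set bs) = UNIV"
  using basis by (auto simp: basis_of_def)

lemma A_carrier: "A \<in> carrier_mat (length bs) (length bs)"
  using mat by (simp add: matrix_in_basis_def)

lemma coords_add: "coords (x + y) = coords x + coords y"
  using basisD by (auto simp: coords_def fun_eq_iff representation_add)

lemma coords_scale: "coords (c *s x) = scale_fun (to_ac c) (coords x)"
  using basisD by (auto simp: coords_def scale_fun_def fun_eq_iff representation_scale)

lemma coords_0: "coords 0 = 0"
  using coords_scale[of 0 0] by (simp add: scale_fun_def fun_eq_iff)

lemma coords_sum: "coords (sum f I) = (\<Sum>i\<in>I. coords (f i))"
  by (induction I rule: infinite_finite_induct) (auto simp: coords_0 coords_add)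

lemma coords_basis: "j < length bs \<Longrightarrow> coords (bs ! j) = (\<lambda>i. if i = j then 1 else 0)"
  using basisD by (auto simp: coords_def fun_eq_iff representation_basis nth_eq_iff_index_eq)

lemma coords_eq_0_iff: "coords x = 0 \<longleftrightarrow> x = 0"
proof
  assume "coords x = 0"
  then have "coords x i = 0" for i
    by simp
  then have "representation (set bs) x (bs ! i) = 0" if "i < length bs" for i
    using that unfolding coords_def by (metis to_ac_eq_0_iff)
  then have "representation (set bs) x b = 0" if "b \<in> set bs" for b
    using that by (auto simp: in_set_conv_nth)
  moreover have "(\<Sum>b\<in>set bs. representation (set bs) x b *s b) = x"
    using basisD by (intro sum_representation_eq) auto
  ultimately show "x = 0"
    by simp
qed (simp add: coords_0)

lemma coords_u: "coords (u x) = mat_act A_ac (coords x)"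
proof -
  interpret act: Vector_Spaces.linear scale_fun scale_fun "mat_act A_ac"
    by (rule linear_mat_act)
  have "x \<in> span (set bs)"
    by (simp add: basisD)
  then show ?thesis
  proof (induction rule: span_induct)
    case base
    show ?case
      by (auto simp: subspace_def u.add u.scale coords_add coords_scale act.add act.scale coords_0)
  next
    case (step x)
    then obtain j where j: "j < length bs" "x = bs ! j"
      by (auto simp: in_set_conv_nth)
    have "coords (u x) = (\<Sum>i<length bs. scale_fun (to_ac (A $$ (i, j))) (coords (bs ! i)))"
      using mat j by (simp add: matrix_in_basis_def coords_sum coords_scale)
    also have "\<dots> = (\<Sum>i<length bs. (\<lambda>k. if k = i then to_ac (A $$ (i, j)) else 0))"
      by (intro sum.cong) (auto simp: coords_basis scale_fun_def)
    also have "\<dots> = (\<lambda>k. if k < length bs then to_ac (A $$ (k, j)) else 0)"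
    proof
      fix k
      have "(\<Sum>i\<in>I. (\<lambda>k. if k = i then to_ac (A $$ (i, j)) else 0)) k = (\<Sum>i\<in>I. if k = i then to_ac (A $$ (i, j)) else 0)"
        if "finite I" for I
        using that by (induction I) auto
      then show "(\<Sum>i<length bs. (\<lambda>k. if k = i then to_ac (A $$ (i, j)) else 0)) k =
          (if k < length bs then to_ac (A $$ (k, j)) else 0)"
        by simp
    qed
    also have "\<dots> = mat_act A_ac (coords x)"
      unfolding j(2) coords_basis[OF j(1)] using A_carrier j(1)
      by (auto simp: mat_act_def fun_eq_iff if_distrib[of "\<lambda>x. _ * x"] cong: if_cong)
    finally show ?case .
  qed
qed

lemma coords_P: "coords (P g x) = poly_endo scale_fun (map_poly to_ac g) (mat_act A_ac) (coords x)"
proof (induction g arbitrary: x)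
  case (pCons a g)
  then show ?case
    by (simp add: poly_endo_pCons fun_space.poly_endo_pCons map_poly_pCons coords_add coords_scale coords_u)
qed (simp add: coords_0)

text \<open>The coordinate vectors of the original basis span the scalar extension, so
  \<open>g\<close> annihilates the matrix there; on an eigenvector it acts as g(z).\<close>

lemma eigenvalue_annihilated:
  assumes ann: "\<And>x. P g x = 0" and z: "eigenvalue A_ac z"
  shows "poly (map_poly to_ac g) z = 0"
proof -
  let ?n = "length bs" and ?g = "map_poly to_ac g"
  interpret act: Vector_Spaces.linear scale_fun scale_fun "mat_act A_ac"
    by (rule linear_mat_act)
  interpret gact: Vector_Spaces.linear scale_fun scale_fun "poly_endo scale_fun ?g (mat_act A_ac)"
    by (rule fun_space.linear_poly_endo[OF linear_mat_act])
  have "A_ac \<in> carrier_mat ?n ?n"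
    using A_carrier by simp
  then obtain c where c: "c \<noteq> 0" "\<forall>i\<ge>?n. c i = 0" "mat_act A_ac c = scale_fun z c"
    using z eigenvalue_iff_mat_act by blast
  have "c = (\<Sum>j<?n. scale_fun (c j) (coords (bs ! j)))"
  proof
    fix i
    have "(\<Sum>j\<in>I. scale_fun (c j) (\<lambda>i. if i = j then 1 else 0)) i = (\<Sum>j\<in>I. if i = j then c j else 0)"
      if "finite I" for I
      using that by (induction I) (auto simp: scale_fun_def)
    then show "c i = (\<Sum>j<?n. scale_fun (c j) (coords (bs ! j))) i"
      using c(2) by (simp add: coords_basis)
  qed
  then have "poly_endo scale_fun ?g (mat_act A_ac) c =
      (\<Sum>j<?n. scale_fun (c j) (coords (P g (bs ! j))))"
    by (metis (no_types, lifting) gact.sum gact.scale coords_P sum.cong)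
  also have "\<dots> = 0"
    by (simp add: ann coords_0 scale_fun_def fun_eq_iff zero_fun_def)
  finally have "poly_endo scale_fun ?g (mat_act A_ac) c = 0" .
  moreover have "poly_endo scale_fun f (mat_act A_ac) c = scale_fun (poly f z) c" for f
  proof (induction f)
    case (pCons a f)
    interpret fact: Vector_Spaces.linear scale_fun scale_fun "poly_endo scale_fun f (mat_act A_ac)"
      by (rule fun_space.linear_poly_endo[OF linear_mat_act])
    show ?case
      by (simp add: fun_space.poly_endo_pCons c(3) fact.scale pCons.IH) (simp add: scale_fun_def fun_eq_iff algebra_simps)
  qed simp
  ultimately show ?thesis
    using c(1) by simp
qed

text \<open>Over the closure \<open>h\<close> splits into linear factors, and the nonzero coordinate
  vector of \<open>v\<close> leads to an eigenvector for one of its roots.\<close>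

lemma ex_eigenvalue_of_kernel:
  assumes "h \<noteq> 0" and "P h v = 0" and "v \<noteq> 0"
  shows "\<exists>z. eigenvalue A_ac z \<and> poly (map_poly to_ac h) z = 0"
proof -
  have "map_poly to_ac h \<noteq> 0"
    using assms(1) by (simp add: map_poly_eq_0_iff)
  moreover have "poly_endo scale_fun (map_poly to_ac h) (mat_act A_ac) (coords v) = 0"
    using assms(2) by (simp add: coords_0 flip: coords_P)
  moreover have "coords v \<noteq> 0"
    using assms(3) by (simp add: coords_eq_0_iff)
  ultimately obtain z g where zg: "poly (map_poly to_ac h) z = 0"
    "poly_endo scale_fun g (mat_act A_ac) (coords v) \<noteq> 0"
    "mat_act A_ac (poly_endo scale_fun g (mat_act A_ac) (coords v)) = scale_fun z (poly_endo scale_fun g (mat_act A_ac) (coords v))"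
    using fun_space.ex_eigenvector_of_kernel[OF alg_closed_imp_poly_has_root linear_mat_act, of "map_poly to_ac h" A_ac "coords v"]
    by blast
  let ?S = "{c :: nat \<Rightarrow> 'a alg_closure. \<forall>i\<ge>length bs. c i = 0}"
  have "poly_endo scale_fun g (mat_act A_ac) (coords v) \<in> ?S"
    by (rule fun_space.poly_endo_closed)
      (use A_carrier in \<open>auto simp: fun_space.subspace_def scale_fun_def mat_act_def coords_def\<close>)
  then have "eigenvalue A_ac z"
    using zg A_carrier by (subst eigenvalue_iff_mat_act[of _ "length bs"]) auto
  then show ?thesis
    using zg(1) by blast
qed

end

lemma closure_eigenvalue_annihilated:
  assumes "\<And>x. P g x = 0" and "closure_eigenvalue scale u z"
  shows "poly (map_poly to_ac g) z = 0"
  using assms(2) eigenvalue_annihilated[OF _ _ assms(1)]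
  unfolding closure_eigenvalue_def represented_on_def by blast

lemma ex_closure_eigenvalue_of_kernel:
  assumes "h \<noteq> 0" and "P h v = 0" and "v \<noteq> 0"
  shows "\<exists>z. closure_eigenvalue scale u z \<and> poly (map_poly to_ac h) z = 0"
proof -
  obtain bs where bs: "set bs = Basis" "distinct bs"
    using finite_distinct_list[OF finite_Basis] by blast
  have basis: "basis_of scale UNIV bs"
    using bs independent_Basis span_Basis by (simp add: basis_of_def)
  define A where "A = mat (length bs) (length bs) (\<lambda>(i, j). representation Basis (u (bs ! j)) (bs ! i))"
  have "u (bs ! j) = (\<Sum>i<length bs. A $$ (i, j) *s bs ! i)" if "j < length bs" for j
  proof -
    have "u (bs ! j) = (\<Sum>b\<in>Basis. representation Basis (u (bs ! j)) b *s b)"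
      using independent_Basis span_Basis finite_Basis by (intro sum_representation_eq[symmetric]) auto
    also have "\<dots> = (\<Sum>i<length bs. representation Basis (u (bs ! j)) (bs ! i) *s bs ! i)"
      unfolding bs(1)[symmetric] using bs(2)
      by (intro sum.reindex_bij_betw[symmetric] bij_betw_nth) auto
    finally show ?thesis
      using that by (simp add: A_def)
  qed
  then have "matrix_in_basis scale bs u A"
    by (simp add: matrix_in_basis_def A_def)
  then show ?thesis
    using ex_eigenvalue_of_kernel[OF basis _ assms] basis
    unfolding closure_eigenvalue_def represented_on_def by blast
qed

lemma ex_annihilating_poly: "\<exists>f. f \<noteq> 0 \<and> (\<forall>x. P f x = 0)"
proof -
  have "\<exists>f. f \<noteq> 0 \<and> P f v = 0" for v
  proof (rule ccontr)
    assume no: "\<not> (\<exists>f. f \<noteq> 0 \<and> P f v = 0)"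
    \<comment> \<open>If no nonzero polynomial killed \<open>v\<close>, the iterates of this single
      vector would be independent beyond the dimension.\<close>
    have "(\<Sum>j\<in>{()}. Suc (dim (UNIV :: 'v set))) \<le> dim (UNIV :: 'v set)"
      by (rule sum_degree_le_dim[where w = "\<lambda>_. v"]) (use no in auto)
    then show False
      by simp
  qed
  then obtain f where f: "\<And>v. f v \<noteq> 0" "\<And>v. P (f v) v = 0"
    by metis
  let ?f = "\<Prod>b\<in>Basis. f b"
  have "P ?f x = 0" for x
  proof -
    have "x \<in> span Basis"
      by (simp add: span_Basis)
    then show ?thesis
    proof (induction rule: span_induct)
      case base
      show ?case
        by (rule P.subspace_kernel)
    next
      case (step b)
      then have "?f = (\<Prod>b\<in>Basis - {b}. f b) * f b"
        using finite_Basis by (simp add: prod.remove[of _ b] mult.commute)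
      then show ?case
        by (simp only: P_mult f(2) P.zero)
    qed
  qed
  moreover have "?f \<noteq> 0"
    using f(1) finite_Basis by simp
  ultimately show ?thesis
    by blast
qed

text \<open>Remove all factors f1 and f2 from an annihilating polynomial. The cofactor h shares no
  root with f1 f2, so a nonzero vector killed by h would produce a forbidden eigenvalue.\<close>

lemma annihilated_of_closure_eigenvalues:
  assumes irr: "Factorial_Ring.irreducible f1" "Factorial_Ring.irreducible f2"
    and deg: "Polynomial.degree f1 > 0" "Polynomial.degree f2 > 0"
    and eig: "\<And>z. closure_eigenvalue scale u z \<Longrightarrow> poly (map_poly to_ac (f1 * f2)) z = 0"
  shows "\<exists>N. \<forall>x. P ((f1 * f2) ^ Suc N) x = 0"
proof -
  obtain f where f: "f \<noteq> 0" "\<And>x. P f x = 0"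
    using ex_annihilating_poly by blast
  obtain a g where g: "f = f1 ^ a * g" "\<not> f1 dvd g"
    using ex_power_factor[OF f(1) deg(1)] by blast
  have "g \<noteq> 0"
    using g(2) by auto
  then obtain b h where h: "g = f2 ^ b * h" "\<not> f2 dvd h"
    using ex_power_factor[OF _ deg(2)] by blast
  have "\<not> f1 dvd h"
    using g(2) h(1) by auto
  then have comax: "comaximal (f1 * f2) h"
    using irreducible_comaximal[OF irr(1)] irreducible_comaximal[OF irr(2) h(2)] by (intro comaximal_mult)
  then obtain c d where cd: "c * (f1 * f2) + d * h = 1"
    by (auto simp: comaximal_def)
  have no_root: "poly (map_poly to_ac h) z \<noteq> 0" if "poly (map_poly to_ac (f1 * f2)) z = 0" for z
  proof
    assume "poly (map_poly to_ac h) z = 0"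
    then have "poly (map_poly to_ac (c * (f1 * f2) + d * h)) z = 0"
      using that by (simp add: to_ac.hom_add to_ac.hom_mult)
    then show False
      unfolding cd by simp
  qed
  have "h \<noteq> 0"
    using h(2) by auto
  have kill: "P (f1 ^ a * f2 ^ b) x = 0" for x
  proof (rule ccontr)
    assume "P (f1 ^ a * f2 ^ b) x \<noteq> 0"
    moreover have "h * (f1 ^ a * f2 ^ b) = f"
      by (simp add: g(1) h(1) mult_ac)
    then have "P h (P (f1 ^ a * f2 ^ b) x) = 0"
      using f(2) by (metis P_mult)
    ultimately show False
      using ex_closure_eigenvalue_of_kernel[OF \<open>h \<noteq> 0\<close>] eig no_root by blast
  qed
  have "f1 ^ a * f2 ^ b dvd (f1 * f2) ^ Suc (a + b)"
    unfolding power_mult_distrib by (intro mult_dvd_mono le_imp_power_dvd) auto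
  then obtain e where "(f1 * f2) ^ Suc (a + b) = e * (f1 ^ a * f2 ^ b)"
    by (metis dvdE mult.commute)
  then have "\<forall>x. P ((f1 * f2) ^ Suc (a + b)) x = 0"
    by (simp only: P_mult[of e] kill P.zero simp_thms)
  then show ?thesis
    by blast
qed

end

section \<open>Paired elementary divisors\<close>

lemma diag_block_mat_concat: "diag_block_mat (map diag_block_mat Ass) = diag_block_mat (concat Ass)"
  by (induction Ass) (simp_all add: diag_block_mat_append Let_def)

definition halves :: "nat multiset \<Rightarrow> nat multiset" where
  "halves ms = (\<Sum>m\<in>#ms. {#(m + 1) div 2, m div 2#})"

lemma halves_simps [simp]:
  "halves {#} = {#}" "halves (add_mset m ms) = {#(m + 1) div 2, m div 2#} + halves ms"
  by (simp_all add: halves_def)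

lemma size_halves: "size (halves ms) = 2 * size ms"
  by (induction ms) auto

lemma paired_powers_eq_halves: "paired_powers f ms = image_mset (\<lambda>k. f ^ k) (halves ms)"
  by (induction ms) (simp_all add: paired_powers_def)

lemma paired_powers_add_mset:
  "paired_powers f (add_mset m ms) = add_mset (f ^ ((m + 1) div 2)) (add_mset (f ^ (m div 2)) (paired_powers f ms))"
  by (simp add: paired_powers_def)

text \<open>A number m contributes two halves that reach c if m \<ge> 2c, exactly one if m = 2c - 1,
  and none otherwise. An odd count thus needs some m = 2c - 1, whose other half c - 1 is new at the
  lower level.\<close>

lemma count_halves_ge:
  assumes "c > 0"
  shows "size {#x \<in># halves ms. c \<le> x#} \<le> size {#x \<in># halves ms. c - 1 \<le> x#} \<and>
    (odd (size {#x \<in># halves ms. c \<le> x#}) \<longrightarrow>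
      size {#x \<in># halves ms. c \<le> x#} < size {#x \<in># halves ms. c - 1 \<le> x#})"
proof (induction ms)
  case (add m ms)
  consider "m \<ge> 2 * c" | "m = 2 * c - 1" | "m < 2 * c - 1"
    by linarith
  then show ?case
  proof cases
    case 1
    then have "c \<le> m div 2" "c \<le> (m + 1) div 2" "c - 1 \<le> m div 2" "c - 1 \<le> (m + 1) div 2"
      by linarith+
    then show ?thesis
      using add.IH by simp
  next
    case 2
    then have "\<not> c \<le> m div 2" "c \<le> (m + 1) div 2" "c - 1 \<le> m div 2" "c - 1 \<le> (m + 1) div 2"
      using assms by linarith+
    then show ?thesis
      using add.IH by simp
  next
    case 3
    then have "\<not> c \<le> m div 2" "\<not> c \<le> (m + 1) div 2"
      by linarith+
    then show ?thesis
      using add.IH by (auto intro: le_trans)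
  qed
qed simp

text \<open>A gap of at least two below an odd position would contradict the parity in
  \<open>count_halves_ge\<close>.\<close>

lemma sorted_halves_gap:
  assumes sorted: "sorted_wrt (\<ge>) xs" and mset: "mset xs = halves ms" and i: "2 * i + 1 < length xs"
  shows "xs ! (2 * i) \<le> Suc (xs ! (2 * i + 1))"
proof (rule ccontr)
  define c where "c = xs ! (2 * i)"
  assume "\<not> xs ! (2 * i) \<le> Suc (xs ! (2 * i + 1))"
  then have gap: "Suc (xs ! (2 * i + 1)) < c"
    by (simp add: c_def)
  have nth: "xs ! k' \<le> xs ! k" if "k \<le> k'" "k' < length xs" for k k'
    using sorted_wrt_nth_less[OF sorted, of k k'] that by (cases "k = k'") auto
  \<comment> \<open>Across the gap, both levels c and c - 1 cut the sorted list after its first 2i +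
    1 entries, an odd number.\<close>
  have size: "size {#x \<in># halves ms. j \<le> x#} = 2 * i + 1" if j: "j \<le> c" "xs ! (2 * i + 1) < j" for j
  proof -
    have "filter (\<lambda>x. j \<le> x) (take (2 * i + 1) xs) = take (2 * i + 1) xs"
      unfolding filter_id_conv
    proof
      fix x assume "x \<in> set (take (2 * i + 1) xs)"
      then obtain k where "k < 2 * i + 1" "x = xs ! k"
        by (auto simp: in_set_conv_nth)
      then show "j \<le> x"
        using nth[of k "2 * i"] i j(1) by (simp add: c_def)
    qed
    moreover have "filter (\<lambda>x. j \<le> x) (drop (2 * i + 1) xs) = []"
    proof -
      have drop: "drop (2 * i + 1) xs = xs ! (2 * i + 1) # drop (Suc (2 * i + 1)) xs"
        by (rule Cons_nth_drop_Suc[symmetric, OF i])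
      have "sorted_wrt (\<ge>) (drop (2 * i + 1) xs)"
        by (rule sorted_wrt_drop[OF sorted])
      then have "\<forall>x\<in>set (drop (2 * i + 1) xs). x \<le> xs ! (2 * i + 1)"
        unfolding drop by simp
      then show ?thesis
        unfolding filter_empty_conv using j(2) by (meson leD le_less_trans)
    qed
    ultimately have "filter (\<lambda>x. j \<le> x) xs = take (2 * i + 1) xs"
      by (metis append_Nil2 append_take_drop_id filter_append)
    then have "size (mset (filter (\<lambda>x. j \<le> x) xs)) = 2 * i + 1"
      using i by (simp only: size_mset length_take)
    then show ?thesis
      by (simp only: mset_filter mset)
  qed
  have "c > 0" "c - 1 \<le> c" "xs ! (2 * i + 1) < c - 1" "xs ! (2 * i + 1) < c"
    using gap by linarith+
  note 1 = size[OF order_refl this(4)] and 2 = size[OF this(2,3)]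
  show False
    using count_halves_ge[OF \<open>c > 0\<close>, of ms] unfolding 1 2 by simp
qed

lemma ex_paired_exponents:
  obtains \<alpha> where "\<And>i. \<alpha> (Suc i) \<le> \<alpha> i" and "\<And>i. 2 * size ms \<le> i \<Longrightarrow> \<alpha> i = 0"
    and "\<And>k. \<alpha> (2 * k) \<le> Suc (\<alpha> (2 * k + 1))" and "mset (map \<alpha> [0..<2 * size ms]) = halves ms"
proof -
  define xs where "xs = rev (sorted_list_of_multiset (halves ms))"
  have mset: "mset xs = halves ms"
    by (simp add: xs_def)
  then have len: "length xs = 2 * size ms"
    by (metis size_halves size_mset)
  have sorted: "sorted_wrt (\<ge>) xs"
    by (simp add: xs_def sorted_wrt_rev)
  \<comment> \<open>Padding by 0 keeps the sequence decreasing and makes the later invariant factors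
    1.\<close>
  define \<alpha> where "\<alpha> i = (if i < length xs then xs ! i else 0)" for i
  show thesis
  proof (rule that[of \<alpha>])
    show "\<alpha> (Suc i) \<le> \<alpha> i" for i
      using sorted_wrt_nth_less[OF sorted, of i "Suc i"] by (simp add: \<alpha>_def)
    show "\<alpha> i = 0" if "2 * size ms \<le> i" for i
      using that by (simp add: \<alpha>_def len)
    show "\<alpha> (2 * k) \<le> Suc (\<alpha> (2 * k + 1))" for k
    proof (cases "2 * k + 1 < length xs")
      case True
      then show ?thesis
        using sorted_halves_gap[OF sorted mset True] by (simp add: \<alpha>_def)
    next
      case False
      then have "\<not> 2 * k < length xs"
        using len by presburger
      then show ?thesis
        by (simp add: \<alpha>_def)
    qed
    have "map \<alpha> [0..<2 * size ms] = map (\<lambda>i. xs ! i) [0..<length xs]"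
      by (intro map_cong) (auto simp: \<alpha>_def len)
    then show "mset (map \<alpha> [0..<2 * size ms]) = halves ms"
      by (simp only: map_nth mset)
  qed
qed

lemma halves_double_plus:
  assumes "a k \<in> {0, 1 :: nat}"
  shows "(2 * b k + a k + 1) div 2 = b k + a k" "(2 * b k + a k) div 2 = b k"
  using assms by auto

section \<open>Blocks, elementary divisors and invariant factors\<close>

context endomorphism
begin

lemma decomposes_as_ones: "decomposes_as (replicate_mset k 1 + G) \<longleftrightarrow> decomposes_as G"
  by (induction k) (simp_all add: decomposes_as_one)

lemma represented_blocks_iff:
  assumes "\<And>f m. (f, m) \<in> set bl \<Longrightarrow> lead_coeff f = 1"
  shows "represented scale u (diag_block_mat (map (\<lambda>(f, m).
      diag_block_mat [companion (f ^ ((m + 1) div 2)), companion (f ^ (m div 2))]) bl)) \<longleftrightarrow>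
    decomposes_as (mset (concat (map halved_powers bl)))"
proof -
  have "map (\<lambda>(f, m). diag_block_mat [companion (f ^ ((m + 1) div 2)), companion (f ^ (m div 2))]) bl =
      map diag_block_mat (map (map companion) (map halved_powers bl))"
    by (simp add: case_prod_unfold)
  then have "diag_block_mat (map (\<lambda>(f, m).
      diag_block_mat [companion (f ^ ((m + 1) div 2)), companion (f ^ (m div 2))]) bl) =
      diag_block_mat (map companion (concat (map halved_powers bl)))"
    by (simp only: diag_block_mat_concat map_concat)
  then show ?thesis
    using assms by (subst represented_companions_iff[symmetric]) (auto simp: lead_coeff_power)
qed

text \<open>The annihilator of \<open>v\<close> is exactly \<open>r\<close>, so every annihilating
  polynomial is a multiple of \<open>r\<close>; conversely \<open>r\<close> kills all
  generators.\<close>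

lemma minimal_poly_eqI:
  assumes cyc: "cyclic_decomposition M" and vr: "(v, r) \<in># M" and dvd: "\<And>w g. (w, g) \<in># M \<Longrightarrow> g dvd r"
  shows "minimal_poly scale u = r"
proof -
  have ann: "annihilates scale g u \<longleftrightarrow> r dvd g" for g
  proof
    assume "annihilates scale g u"
    then have "P g v = 0"
      by (simp add: annihilates_def)
    then show "r dvd g"
      by (rule cyclic_decomposition_annihilator[OF cyc vr])
  next
    assume "r dvd g"
    have "{x. P g x = 0} = UNIV"
    proof (rule cyclic_decompositionD(3)[OF cyc])
      show "subspace {x. P g x = 0}"
        by (rule P.subspace_kernel)
      show "u x \<in> {x. P g x = 0}" if "x \<in> {x. P g x = 0}" for x
        using that poly_endo_intertwine[OF linear_u, of u u g x] by simp
      fix w g' assume wg: "(w, g') \<in># M"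
      then obtain h where "g = h * g'"
        using dvd[OF wg] \<open>r dvd g\<close> by (metis dvdE dvd_trans mult.commute)
      then show "w \<in> {x. P g x = 0}"
        using cyclic_decompositionD(2)[OF cyc wg] by (simp add: P_mult)
    qed
    then show "annihilates scale g u"
      by (auto simp: annihilates_def fun_eq_iff)
  qed
  have monic: "lead_coeff r = 1"
    by (rule cyclic_decompositionD(1)[OF cyc vr])
  show ?thesis
    unfolding minimal_poly_def
  proof (rule the_equality)
    show "m = r" if "lead_coeff m = 1 \<and> (\<forall>g. annihilates scale g u \<longleftrightarrow> m dvd g)" for m
    proof (rule poly_dvd_antisym)
      show "lead_coeff m = lead_coeff r"
        using that monic by simp
      show "m dvd r"
        using conjunct2[OF that, THEN spec, of r] ann[of r] by simp
      show "r dvd m"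
        using conjunct2[OF that, THEN spec, of m] ann[of m] by simp
    qed
  qed (use ann monic in blast)
qed

lemma minimal_poly_invariant:
  assumes "decomposes_as (mset (map r [0..<n]))" and "n > 0" and "\<And>i. r (Suc i) dvd r i"
  shows "minimal_poly scale u = r 0" and "\<And>i. r i dvd r 0"
proof -
  show dvd: "r i dvd r 0" for i
    using assms(3) by (induction i) (auto intro: dvd_trans)
  obtain M where M: "image_mset snd M = mset (map r [0..<n])" "cyclic_decomposition M"
    using assms(1) by (auto simp: decomposes_as_def)
  have "r 0 \<in># image_mset snd M"
    unfolding M(1) using assms(2) by simp
  then obtain v where "(v, r 0) \<in># M"
    by force
  moreover have "g dvd r 0" if "(w, g) \<in># M" for w g
  proof -
    have "g \<in># image_mset snd M"
      using that by force
    then show ?thesis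
      unfolding M(1) using dvd by auto
  qed
  ultimately show "minimal_poly scale u = r 0"
    by (rule minimal_poly_eqI[OF M(2)])
qed

end

context pq_endomorphism
begin

lemma monic_F: "lead_coeff (F1 ^ k) = 1" "lead_coeff (F2 ^ k) = 1"
proof -
  have "lead_coeff F1 = 1" "lead_coeff F2 = 1"
    by (simp_all add: F1_def F2_def)
  then show "lead_coeff (F1 ^ k) = 1" "lead_coeff (F2 ^ k) = 1"
    by (simp_all only: lead_coeff_power power_one)
qed

lemma degree_F: "Polynomial.degree F1 = 2" "Polynomial.degree F2 = 2"
  by (simp_all add: F1_def F2_def)

text \<open>The single index m stands for the pair k, \<epsilon> through m = 2k +
  \<epsilon>.\<close>

definition block :: "'a poly \<times> nat \<Rightarrow> 'a mat" where
  "block = (\<lambda>(f, m). diag_block_mat [companion (f ^ ((m + 1) div 2)), companion (f ^ (m div 2))])"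

lemma represented_by_blocks_iff:
  "(\<exists>Bs. represented scale u (diag_block_mat Bs) \<and> (\<forall>B\<in>set Bs. \<exists>f\<in>{F1, F2}. \<exists>m. B = block (f, m))) \<longleftrightarrow>
   (\<exists>ms ns. decomposes_as (paired_powers F1 ms + paired_powers F2 ns))"
proof
  assume "\<exists>Bs. represented scale u (diag_block_mat Bs) \<and> (\<forall>B\<in>set Bs. \<exists>f\<in>{F1, F2}. \<exists>m. B = block (f, m))"
  then obtain Bs where Bs: "represented scale u (diag_block_mat Bs)"
    "\<forall>B\<in>set Bs. \<exists>f\<in>{F1, F2}. \<exists>m. B = block (f, m)"
    by blast
  have "\<exists>fm. fst fm \<in> {F1, F2} \<and> B = block fm" if B: "B \<in> set Bs" for B
  proof -
    obtain f m where "f \<in> {F1, F2}" "B = block (f, m)"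
      using bspec[OF Bs(2) B] by blast
    then show ?thesis
      by (intro exI[of _ "(f, m)"]) simp
  qed
  then obtain h where h: "\<And>B. B \<in> set Bs \<Longrightarrow> fst (h B) \<in> {F1, F2} \<and> B = block (h B)"
    by metis
  define bl where "bl = map h Bs"
  have bl: "f = F1 \<or> f = F2" if "(f, m) \<in> set bl" for f m
    using that h by (auto simp: bl_def) (metis fst_conv insertE singletonD)+
  have "map block bl = Bs"
    unfolding bl_def map_map by (rule map_idI) (metis h comp_apply)
  have represented_iff: "represented scale u (diag_block_mat Bs) \<longleftrightarrow>
      decomposes_as (mset (concat (map halved_powers bl)))"
    unfolding \<open>map block bl = Bs\<close>[symmetric] block_def
    by (rule represented_blocks_iff) (use bl monic_F[of 1] in auto)
  have dec: "decomposes_as (mset (concat (map halved_powers bl)))"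
    using Bs(1) by (simp only: represented_iff)
  have "mset (concat (map halved_powers bl)) =
      paired_powers F1 (mset (map snd (filter (\<lambda>fm. fst fm = F1) bl))) +
      paired_powers F2 (mset (map snd (filter (\<lambda>fm. fst fm \<noteq> F1) bl)))"
    using bl
  proof (induction bl)
    case (Cons fm bl)
    have "f = F1 \<or> f = F2" if "(f, m) \<in> set bl" for f m
      using Cons.prems[of f m] that by simp
    note IH = Cons.IH[OF this]
    obtain f m where fm: "fm = (f, m)"
      by (cases fm)
    have "f = F1 \<or> f = F2"
      using Cons.prems[of f m] by (simp add: fm)
    with IH show ?case
      by (cases "f = F1") (simp_all add: fm paired_powers_add_mset)
  qed (simp add: paired_powers_def)
  then show "\<exists>ms ns. decomposes_as (paired_powers F1 ms + paired_powers F2 ns)"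
    using dec by metis
next
  assume "\<exists>ms ns. decomposes_as (paired_powers F1 ms + paired_powers F2 ns)"
  then obtain ms ns where dec: "decomposes_as (paired_powers F1 ms + paired_powers F2 ns)"
    by blast
  obtain ml nl where ml: "mset ml = ms" and nl: "mset nl = ns"
    using ex_mset by metis
  define bl where "bl = map (Pair F1) ml @ map (Pair F2) nl"
  have bl: "f = F1 \<or> f = F2" if "(f, m) \<in> set bl" for f m
    using that by (auto simp: bl_def)
  have "decomposes_as (mset (concat (map halved_powers bl)))"
    unfolding bl_def map_append concat_append mset_append mset_paired_list ml nl by (rule dec)
  then have "represented scale u (diag_block_mat (map block bl))"
    unfolding block_def
    by (subst represented_blocks_iff) (use bl monic_F[of 1] in auto)
  moreover have "\<forall>B\<in>set (map block bl). \<exists>f\<in>{F1, F2}. \<exists>m. B = block (f, m)"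
    using bl by force
  ultimately show "\<exists>Bs. represented scale u (diag_block_mat Bs) \<and> (\<forall>B\<in>set Bs. \<exists>f\<in>{F1, F2}. \<exists>m. B = block (f, m))"
    by blast
qed

end

context pq_endomorphism
begin

lemma comaximal_powers: "comaximal (F1 ^ k) (F2 ^ l)"
  by (rule comaximal_power[OF comaximal_F1_F2])

text \<open>After all factors F1 and F2 are removed, the cofactor is coprime to the product it
  divides, so it is a monic unit.\<close>

lemma dvd_powers_form:
  assumes "g dvd F1 ^ k * F2 ^ l" and "lead_coeff g = 1"
  shows "\<exists>a b. g = F1 ^ a * F2 ^ b"
proof -
  have "g \<noteq> 0"
    using assms(2) by auto
  then obtain a h where h: "g = F1 ^ a * h" "\<not> F1 dvd h"
    using ex_power_factor[of g F1] degree_F by auto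
  then have "h \<noteq> 0"
    by auto
  then obtain b h' where h': "h = F2 ^ b * h'" "\<not> F2 dvd h'"
    using ex_power_factor[of h F2] degree_F by auto
  have "\<not> F1 dvd h'"
    using h(2) h'(1) by auto
  then have "comaximal F1 h'" "comaximal F2 h'"
    using irreducible_comaximal[OF _ h'(2)] irreducible_comaximal[of F1 h'] irreducible_1 irreducible_2
    by (simp_all add: F1_def F2_def)
  then have "comaximal (F1 ^ k * F2 ^ l) h'"
    using comaximal_power[of F1 h' k 1] comaximal_power[of F2 h' l 1] by (intro comaximal_mult) simp_all
  then have "comaximal h' (F1 ^ k * F2 ^ l)"
    by (rule comaximal_commute)
  moreover have "h' dvd (F1 ^ k * F2 ^ l) * 1"
    using assms(1) unfolding h(1) h'(1) by (metis dvd_mult_right mult.assoc mult_1_right)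
  ultimately have "h' dvd 1"
    by (rule irreducible_comaximal_prime)
  moreover have "lead_coeff h' = 1"
    using assms(2) monic_F unfolding h(1) h'(1) by (simp only: lead_coeff_mult mult_1_left)
  ultimately have "h' = 1"
    by (auto simp: is_unit_iff_degree elim!: degree_eq_zeroE simp flip: one_pCons)
  then show ?thesis
    using h(1) h'(1) by auto
qed

text \<open>Sort the exponents of F1 and F2 separately in decreasing order and multiply equal
  positions by the Chinese remainder theorem. Sorting the halves keeps consecutive positions 2k, 2k
  + 1 within 1 of each other.\<close>

lemma invariant_factors_of_decomposes:
  assumes "decomposes_as (paired_powers F1 ms + paired_powers F2 ns)"
  shows "\<exists>m n. minimal_poly scale u = F1 ^ m * F2 ^ n"
    and "\<exists>r. invariant_factors scale u r \<and>
      (\<forall>k. \<exists>a\<in>{0, 1}. \<exists>b\<in>{0, 1}. r (2 * k) = r (2 * k + 1) * (F1 ^ a * F2 ^ b))"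
proof -
  \<comment> \<open>A common number of pairs, so that both exponent lists have equal length; the
    successor makes position 0 exist even for the zero space, where the minimal polynomial is
    1.\<close>
  define K where "K = Suc (max (size ms) (size ns))"
  define ms' where "ms' = replicate_mset (K - size ms) 0 + ms"
  define ns' where "ns' = replicate_mset (K - size ns) 0 + ns"
  have size: "size ms' = K" "size ns' = K"
    by (auto simp: ms'_def ns'_def K_def)
  have pad: "paired_powers f (replicate_mset k 0 + ms) = replicate_mset (2 * k) 1 + paired_powers f ms" for f :: "'a poly" and k ms
    by (induction k) (simp_all add: paired_powers_def)
  have "paired_powers F1 ms' + paired_powers F2 ns' =
      replicate_mset (2 * (K - size ms)) 1 + (replicate_mset (2 * (K - size ns)) 1 + (paired_powers F1 ms + paired_powers F2 ns))"
    unfolding ms'_def ns'_def pad by (simp add: ac_simps)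
  then have dec: "decomposes_as (paired_powers F1 ms' + paired_powers F2 ns')"
    using assms by (simp only: decomposes_as_ones)
  obtain \<alpha> where \<alpha>: "\<And>i. \<alpha> (Suc i) \<le> \<alpha> i" "\<And>i. 2 * K \<le> i \<Longrightarrow> \<alpha> i = 0"
    "\<And>k. \<alpha> (2 * k) \<le> Suc (\<alpha> (2 * k + 1))" "mset (map \<alpha> [0..<2 * K]) = halves ms'"
    using ex_paired_exponents[of ms'] unfolding size by metis
  obtain \<beta> where \<beta>: "\<And>i. \<beta> (Suc i) \<le> \<beta> i" "\<And>i. 2 * K \<le> i \<Longrightarrow> \<beta> i = 0"
    "\<And>k. \<beta> (2 * k) \<le> Suc (\<beta> (2 * k + 1))" "mset (map \<beta> [0..<2 * K]) = halves ns'"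
    using ex_paired_exponents[of ns'] unfolding size by metis
  define r where "r i = F1 ^ \<alpha> i * F2 ^ \<beta> i" for i
  have "paired_powers F1 ms' = image_mset (\<lambda>i. F1 ^ \<alpha> i) (mset [0..<2 * K])"
    "paired_powers F2 ns' = image_mset (\<lambda>i. F2 ^ \<beta> i) (mset [0..<2 * K])"
    unfolding paired_powers_eq_halves \<alpha>(4)[symmetric] \<beta>(4)[symmetric] mset_map
    by (simp_all add: image_mset.compositionality o_def)
  then have "decomposes_as (image_mset r (mset [0..<2 * K]) + {#})"
    unfolding r_def using dec by (subst decomposes_as_image_mult) (simp_all add: comaximal_powers monic_F)
  then have dec_r: "decomposes_as (mset (map r [0..<2 * K]))"
    by simp
  have dvd: "r (Suc i) dvd r i" for i
    unfolding r_def using \<alpha>(1) \<beta>(1) by (intro mult_dvd_mono le_imp_power_dvd) auto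
  have monic: "lead_coeff (r i) = 1" for i
    unfolding r_def by (simp only: lead_coeff_mult monic_F mult_1_left)
  have "minimal_poly scale u = r 0"
    by (rule minimal_poly_invariant[OF dec_r _ dvd]) (simp add: K_def)
  then show "\<exists>m n. minimal_poly scale u = F1 ^ m * F2 ^ n"
    by (auto simp: r_def)
  have "represented scale u (diag_block_mat (map companion (map r [0..<2 * K])))"
    using dec_r monic by (subst represented_companions_iff) auto
  then have "represented scale u (diag_block_mat (map (\<lambda>i. companion (r i)) [0..<2 * K]))"
    by (simp add: o_def)
  moreover have "\<forall>i\<ge>2 * K. r i = 1"
    using \<alpha>(2) \<beta>(2) by (simp add: r_def)
  ultimately have "invariant_factors scale u r"
    unfolding invariant_factors_def using monic dvd by blast
  moreover have "\<exists>a\<in>{0, 1}. \<exists>b\<in>{0, 1}. r (2 * k) = r (2 * k + 1) * (F1 ^ a * F2 ^ b)" for k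
  proof -
    have diff: "\<exists>a\<in>{0, 1}. x = y + a" if "x \<le> Suc y" "y \<le> x" for x y :: nat
      using that by (cases "x = y") auto
    obtain a where a: "a \<in> {0, 1}" "\<alpha> (2 * k) = \<alpha> (2 * k + 1) + a"
      using diff[OF \<alpha>(3)[of k] \<alpha>(1)[of "2 * k", unfolded Suc_eq_plus1]] by blast
    obtain b where b: "b \<in> {0, 1}" "\<beta> (2 * k) = \<beta> (2 * k + 1) + b"
      using diff[OF \<beta>(3)[of k] \<beta>(1)[of "2 * k", unfolded Suc_eq_plus1]] by blast
    have "r (2 * k) = r (2 * k + 1) * (F1 ^ a * F2 ^ b)"
      unfolding r_def a(2) b(2) power_add by (simp only: ac_simps)
    then show ?thesis
      using a(1) b(1) by blast
  qed
  ultimately show "\<exists>r. invariant_factors scale u r \<and>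
      (\<forall>k. \<exists>a\<in>{0, 1}. \<exists>b\<in>{0, 1}. r (2 * k) = r (2 * k + 1) * (F1 ^ a * F2 ^ b))"
    by blast
qed

text \<open>All invariant factors divide the minimal polynomial, so they are products of powers of
  F1 and F2. Splitting them apart, positions 2k and 2k + 1 give exponents that are the two halves of
  a single number.\<close>

lemma decomposes_of_invariant_factors:
  assumes min: "minimal_poly scale u = F1 ^ m * F2 ^ n" and inv: "invariant_factors scale u r"
    and pairs: "\<forall>k. \<exists>a\<in>{0, 1}. \<exists>b\<in>{0, 1}. r (2 * k) = r (2 * k + 1) * (F1 ^ a * F2 ^ b)"
  shows "\<exists>ms ns. decomposes_as (paired_powers F1 ms + paired_powers F2 ns)"
proof -
  obtain l where monic: "\<And>i. lead_coeff (r i) = 1" and dvd: "\<And>i. r (Suc i) dvd r i"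
    and one: "\<And>i. i \<ge> l \<Longrightarrow> r i = 1"
    and rep: "represented scale u (diag_block_mat (map (\<lambda>i. companion (r i)) [0..<l]))"
    using inv by (auto simp: invariant_factors_def)
  \<comment> \<open>The cut-off may be odd; 2K exceeds it and is even, and the additional factors
    are 1.\<close>
  define K where "K = Suc l"
  have "represented scale u (diag_block_mat (map companion (map r [0..<l])))"
    using rep by (simp add: o_def)
  then have "decomposes_as (mset (map r [0..<l]))"
    using monic by (subst (asm) represented_companions_iff) auto
  moreover have "mset (map r [0..<2 * K]) = replicate_mset (2 * K - l) 1 + mset (map r [0..<l])"
  proof -
    have "[0..<2 * K] = [0..<l] @ [l..<2 * K]"
    proof -
      have "2 * K = l + Suc (Suc l)"
        by (simp add: K_def)
      then show ?thesis
        by (simp only: upt_add_eq_append[of 0 l, OF le0])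
    qed
    moreover have "map r [l..<2 * K] = replicate (2 * K - l) 1"
      using one by (intro replicate_eqI) auto
    ultimately show ?thesis
      by (simp only: map_append mset_append mset_replicate add.commute)
  qed
  ultimately have dec: "decomposes_as (mset (map r [0..<2 * K]))"
    by (simp only: decomposes_as_ones)
  have "2 * K > 0"
    by (simp add: K_def)
  note r0 = minimal_poly_invariant[OF dec this dvd]
  have "r i dvd F1 ^ m * F2 ^ n" for i
    using r0(2)[of i] by (simp only: r0(1)[symmetric] min)
  then have "\<exists>a b. r (2 * k + 1) = F1 ^ a * F2 ^ b" for k
    using dvd_powers_form monic by blast
  then obtain \<alpha> \<beta> where odd: "\<And>k. r (2 * k + 1) = F1 ^ \<alpha> k * F2 ^ \<beta> k"
    by metis
  obtain a b where ab: "\<And>k. a k \<in> {0, 1::nat}" "\<And>k. b k \<in> {0, 1::nat}"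
    "\<And>k. r (2 * k) = r (2 * k + 1) * (F1 ^ a k * F2 ^ b k)"
    using pairs by metis
  have even: "r (2 * k) = F1 ^ (\<alpha> k + a k) * F2 ^ (\<beta> k + b k)" for k
    unfolding ab(3) odd power_add by (simp only: ac_simps)
  \<comment> \<open>The number with halves \<alpha> k + a k and \<alpha> k.\<close>
  define ms where "ms k = 2 * \<alpha> k + a k" for k
  define ns where "ns k = 2 * \<beta> k + b k" for k
  have "decomposes_as (mset (map r [0..<2 * k]) + G) \<longleftrightarrow>
      decomposes_as (paired_powers F1 (mset (map ms [0..<k])) + paired_powers F2 (mset (map ns [0..<k])) + G)" for k G
  proof (induction k arbitrary: G)
    case (Suc k)
    have halves: "(ms k + 1) div 2 = \<alpha> k + a k" "ms k div 2 = \<alpha> k" "(ns k + 1) div 2 = \<beta> k + b k" "ns k div 2 = \<beta> k"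
      using halves_double_plus[of a k \<alpha>] halves_double_plus[of b k \<beta>] ab(1,2) by (simp_all add: ms_def ns_def)
    let ?H = "paired_powers F1 (mset (map ms [0..<k])) + paired_powers F2 (mset (map ns [0..<k])) + G"
    have "mset (map r [0..<2 * Suc k]) + G = mset (map r [0..<2 * k]) + add_mset (r (2 * k)) (add_mset (r (2 * k + 1)) G)"
      by simp
    then have "decomposes_as (mset (map r [0..<2 * Suc k]) + G) \<longleftrightarrow>
        decomposes_as (add_mset (r (2 * k)) (add_mset (r (2 * k + 1)) ?H))"
      by (simp only: Suc.IH) (simp add: ac_simps)
    also have "\<dots> \<longleftrightarrow> decomposes_as (add_mset (F1 ^ (\<alpha> k + a k)) (add_mset (F2 ^ (\<beta> k + b k)) (add_mset (r (2 * k + 1)) ?H)))"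
      unfolding even by (rule decomposes_as_mult) (simp_all only: comaximal_powers monic_F)
    also have "\<dots> \<longleftrightarrow> decomposes_as (add_mset (F1 ^ \<alpha> k * F2 ^ \<beta> k) (add_mset (F1 ^ (\<alpha> k + a k)) (add_mset (F2 ^ (\<beta> k + b k)) ?H)))"
      unfolding odd by (simp only: add_mset_commute)
    also have "\<dots> \<longleftrightarrow> decomposes_as (add_mset (F1 ^ \<alpha> k) (add_mset (F2 ^ \<beta> k) (add_mset (F1 ^ (\<alpha> k + a k)) (add_mset (F2 ^ (\<beta> k + b k)) ?H))))"
      by (rule decomposes_as_mult) (simp_all only: comaximal_powers monic_F)
    also have "add_mset (F1 ^ \<alpha> k) (add_mset (F2 ^ \<beta> k) (add_mset (F1 ^ (\<alpha> k + a k)) (add_mset (F2 ^ (\<beta> k + b k)) ?H))) =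
        paired_powers F1 (mset (map ms [0..<Suc k])) + paired_powers F2 (mset (map ns [0..<Suc k])) + G"
      using halves by (simp add: paired_powers_def)
    finally show ?case .
  qed (simp add: paired_powers_def)
  from this[of K "{#}"] dec show ?thesis
    by auto
qed

end

section \<open>Equivalence of the three conditions\<close>

theorem theorem4p27:
  fixes p q :: "'a::field poly"
    and L :: "'a alg_closure set"
    and x1 x2 y1 y2 :: "'a alg_closure"
    and \<delta> :: 'a
    and scale :: "'a \<Rightarrow> 'v::ab_group_add \<Rightarrow> 'v"
    and Basis :: "'v set"
    and u :: "'v \<Rightarrow> 'v"
  assumes "lead_coeff p = 1" and "Polynomial.degree p = 2" and "Factorial_Ring.irreducible p"
    and "lead_coeff q = 1" and "Polynomial.degree q = 2" and "Factorial_Ring.irreducible q"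
    and "splitting_field p = L" and "splitting_field q = L"
    and "\<not> homothetic p q"
    and "separable_poly p"
    and "\<delta> = poly p 0 * inverse (poly q 0)"
    and "Root p = {x1, x2}" and "Root q = {y1, y2}"
    and "finite_dimensional_vector_space scale Basis"
    and "Vector_Spaces.linear scale scale u"
  shows "(q_exceptional scale p q u \<and> pq_quotient scale p q u \<longleftrightarrow>
          (\<exists>m n. minimal_poly scale u =
             trace_poly L \<delta> (x1 * inverse y1) ^ m * trace_poly L \<delta> (x1 * inverse y2) ^ n) \<and>
          (\<exists>r. invariant_factors scale u r \<and>
             (\<forall>k. \<exists>a\<in>{0, 1}. \<exists>b\<in>{0, 1}.
                r (2 * k) = r (2 * k + 1) * (trace_poly L \<delta> (x1 * inverse y1) ^ a *
                                             trace_poly L \<delta> (x1 * inverse y2) ^ b))))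
       \<and> (q_exceptional scale p q u \<and> pq_quotient scale p q u \<longleftrightarrow>
          (\<exists>Bs. represented scale u (diag_block_mat Bs) \<and>
             (\<forall>B\<in>set Bs. \<exists>x\<in>Root p. \<exists>y\<in>Root q. \<exists>k. \<exists>\<epsilon>\<in>{0, 1}.
                B = diag_block_mat
                  [companion (trace_poly L \<delta> (x * inverse y) ^ (k + \<epsilon>)),
                   companion (trace_poly L \<delta> (to_ac \<delta> * inverse x * y) ^ k)])))"
proof -
  obtain np tp where p: "p = [:np, - tp, 1:]"
    using degree_2_monic_eq[OF assms(1,2)] by (metis minus_minus)
  obtain nq tq where q: "q = [:nq, - tq, 1:]"
    using degree_2_monic_eq[OF assms(4,5)] by (metis minus_minus)
  have \<delta>: "\<delta> = np * inverse nq"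
    using assms(11) unfolding p q by simp
  interpret pq: pq_fields tp np tq nq L x1 x2 y1 y2 \<delta>
    using assms(3,6-10,12,13) \<delta> unfolding p q by unfold_locales
  obtain T1 T2 where T: "np * T1 + np * T2 = \<delta> * tp * tq"
    "np * T1 * T2 = \<delta> * \<delta> * tq * tq + \<delta> * tp * tp - 4 * np * \<delta>"
    "T1 \<noteq> T2"
    "Factorial_Ring.irreducible [:\<delta>, - T1, 1:]" "Factorial_Ring.irreducible [:\<delta>, - T2, 1:]"
    "\<not> [:\<delta>, - T1, 1:] dvd [:- \<delta>, 0, 1:]" "\<not> [:\<delta>, - T2, 1:] dvd [:- \<delta>, 0, 1:]"
    and trace: "trace_poly L \<delta> (x1 * inverse y1) = [:\<delta>, - T1, 1:]"
      "trace_poly L \<delta> (x1 * inverse y2) = [:\<delta>, - T2, 1:]"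
      "trace_poly L \<delta> (x2 * inverse y1) = [:\<delta>, - T2, 1:]"
      "trace_poly L \<delta> (x2 * inverse y2) = [:\<delta>, - T1, 1:]"
    and roots: "\<And>w. to_ac \<delta> - to_ac T1 * w + w * w = 0 \<longleftrightarrow> w = x1 * inverse y1 \<or> w = x2 * inverse y2"
      "\<And>w. to_ac \<delta> - to_ac T2 * w + w * w = 0 \<longleftrightarrow> w = x1 * inverse y2 \<or> w = x2 * inverse y1"
    by (rule pq.trace_poly_data) blast
  interpret fd: finite_dimensional_vector_space scale Basis
    by fact
  interpret endo: endomorphism scale Basis u
    by (intro endomorphism.intro endomorphism_axioms.intro assms(14,15))
  interpret e: pq_endomorphism scale Basis u tp np tq nq \<delta> T1 T2
    by unfold_locales (fact pq.nz pq.np_eq T)+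
  have F: "trace_poly L \<delta> (x1 * inverse y1) = e.F1" "trace_poly L \<delta> (x1 * inverse y2) = e.F2"
    "trace_poly L \<delta> (x2 * inverse y1) = e.F2" "trace_poly L \<delta> (x2 * inverse y2) = e.F1"
    unfolding e.F1_def e.F2_def by (fact trace)+
  \<comment> \<open>All three conditions are compared with this statement about elementary
    divisors.\<close>
  let ?E = "\<exists>ms ns. endo.decomposes_as (paired_powers e.F1 ms + paired_powers e.F2 ns)"
  \<comment> \<open>The four quotients of roots are the roots of F1 F2, so being q-exceptional is a
    condition on roots of a polynomial over the base field.\<close>
  have ratios: "{x * inverse y | x y. x \<in> Root p \<and> y \<in> Root q} = {z. poly (map_poly to_ac (e.F1 * e.F2)) z = 0}"
  proof -
    have "poly (map_poly to_ac (e.F1 * e.F2)) z = 0 \<longleftrightarrow>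
        to_ac \<delta> - to_ac T1 * z + z * z = 0 \<or> to_ac \<delta> - to_ac T2 * z + z * z = 0" for z
      unfolding e.F1_def e.F2_def to_ac.hom_mult poly_mult mult_eq_0_iff poly_map_to_ac_quadratic by simp
    then show ?thesis
      unfolding roots assms(12,13) by blast
  qed
  have i: "q_exceptional scale p q u \<and> pq_quotient scale p q u \<longleftrightarrow> ?E"
  proof
    assume *: "q_exceptional scale p q u \<and> pq_quotient scale p q u"
    have "\<exists>N. \<forall>x. endo.P ((e.F1 * e.F2) ^ Suc N) x = 0"
    proof (rule endo.annihilated_of_closure_eigenvalues)
      show "Factorial_Ring.irreducible e.F1" "Factorial_Ring.irreducible e.F2"
        unfolding e.F1_def e.F2_def by (fact T)+
      show "poly (map_poly to_ac (e.F1 * e.F2)) z = 0" if "closure_eigenvalue scale u z" for z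
        using * that unfolding q_exceptional_def ratios by blast
    qed (simp_all add: e.degree_F)
    then show ?E
      using e.decomposes_of_quotient * unfolding p q by blast
  next
    assume ?E
    then obtain ms ns where dec: "endo.decomposes_as (paired_powers e.F1 ms + paired_powers e.F2 ns)"
      by blast
    obtain N where "\<And>x. endo.P ((e.F1 * e.F2) ^ Suc N) x = 0"
      using e.decomposes_kill[OF dec] by blast
    then have "poly (map_poly to_ac ((e.F1 * e.F2) ^ Suc N)) z = 0" if "closure_eigenvalue scale u z" for z
      using that by (rule endo.closure_eigenvalue_annihilated)
    then have "poly (map_poly to_ac (e.F1 * e.F2)) z = 0" if "closure_eigenvalue scale u z" for z
      using that unfolding to_ac.hom_power poly_power by (metis power_eq_0_iff)
    then have "q_exceptional scale p q u"
      unfolding q_exceptional_def ratios by blast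
    moreover have "pq_quotient scale p q u"
      unfolding p q by (rule e.quotient_of_decomposes[OF dec])
    ultimately show "q_exceptional scale p q u \<and> pq_quotient scale p q u"
      by blast
  qed
  have ii: "(\<exists>m n. minimal_poly scale u = e.F1 ^ m * e.F2 ^ n) \<and>
      (\<exists>r. invariant_factors scale u r \<and>
        (\<forall>k. \<exists>a\<in>{0, 1}. \<exists>b\<in>{0, 1}. r (2 * k) = r (2 * k + 1) * (e.F1 ^ a * e.F2 ^ b))) \<longleftrightarrow> ?E"
    (is "?min \<and> ?inv \<longleftrightarrow> _")
  proof
    assume *: "?min \<and> ?inv"
    from conjunct1[OF *] obtain m n where "minimal_poly scale u = e.F1 ^ m * e.F2 ^ n"
      by (elim exE)
    moreover from conjunct2[OF *] obtain r where "invariant_factors scale u r"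
      "\<forall>k. \<exists>a\<in>{0, 1}. \<exists>b\<in>{0, 1}. r (2 * k) = r (2 * k + 1) * (e.F1 ^ a * e.F2 ^ b)"
      by (elim exE conjE)
    ultimately show ?E
      by (rule e.decomposes_of_invariant_factors)
  next
    assume ?E
    then obtain ms ns where dec: "endo.decomposes_as (paired_powers e.F1 ms + paired_powers e.F2 ns)"
      by blast
    show "?min \<and> ?inv"
      by (intro conjI e.invariant_factors_of_decomposes[OF dec])
  qed
  have block: "(\<exists>x\<in>Root p. \<exists>y\<in>Root q. \<exists>k. \<exists>\<epsilon>\<in>{0, 1}. B = diag_block_mat
      [companion (trace_poly L \<delta> (x * inverse y) ^ (k + \<epsilon>)),
       companion (trace_poly L \<delta> (to_ac \<delta> * inverse x * y) ^ k)]) \<longleftrightarrow>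
     (\<exists>f\<in>{e.F1, e.F2}. \<exists>m. B = e.block (f, m))" for B
  proof
    assume "\<exists>x\<in>Root p. \<exists>y\<in>Root q. \<exists>k. \<exists>\<epsilon>\<in>{0, 1}. B = diag_block_mat
      [companion (trace_poly L \<delta> (x * inverse y) ^ (k + \<epsilon>)),
       companion (trace_poly L \<delta> (to_ac \<delta> * inverse x * y) ^ k)]"
    then obtain x y k \<epsilon> where xy: "x \<in> Root p" "y \<in> Root q" and \<epsilon>: "\<epsilon> \<in> {0, 1}"
      and B: "B = diag_block_mat
      [companion (trace_poly L \<delta> (x * inverse y) ^ (k + \<epsilon>)),
       companion (trace_poly L \<delta> (to_ac \<delta> * inverse x * y) ^ k)]"
      by blast
    have "trace_poly L \<delta> (x * inverse y) \<in> {e.F1, e.F2}"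
      using xy F unfolding assms(12,13) by auto
    moreover have "B = e.block (trace_poly L \<delta> (x * inverse y), 2 * k + \<epsilon>)"
      using \<epsilon> pq.trace_poly_reciprocal[of x y] xy unfolding B assms(12,13) e.block_def by auto
    ultimately show "\<exists>f\<in>{e.F1, e.F2}. \<exists>m. B = e.block (f, m)"
      by blast
  next
    assume "\<exists>f\<in>{e.F1, e.F2}. \<exists>m. B = e.block (f, m)"
    then obtain f m where f: "f \<in> {e.F1, e.F2}" and B: "B = e.block (f, m)"
      by blast
    \<comment> \<open>Keeping x = x1 and letting y run over both roots of q reaches F1 and
      F2.\<close>
    obtain y where y: "y \<in> Root q" "f = trace_poly L \<delta> (x1 * inverse y)"
      using f F(1,2) unfolding assms(13) by (metis insertCI insertE singletonD)
    have x1: "x1 \<in> Root p"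
      by (simp add: assms(12))
    have "(m + 1) div 2 = m div 2 + m mod 2"
      by presburger
    then have "B = diag_block_mat
      [companion (trace_poly L \<delta> (x1 * inverse y) ^ (m div 2 + m mod 2)),
       companion (trace_poly L \<delta> (to_ac \<delta> * inverse x1 * y) ^ (m div 2))]"
      using pq.trace_poly_reciprocal[of x1 y] y unfolding B assms(13) e.block_def by simp
    moreover have "m mod 2 \<in> {0, 1}"
      by auto
    ultimately show "\<exists>x\<in>Root p. \<exists>y\<in>Root q. \<exists>k. \<exists>\<epsilon>\<in>{0, 1}. B = diag_block_mat
      [companion (trace_poly L \<delta> (x * inverse y) ^ (k + \<epsilon>)),
       companion (trace_poly L \<delta> (to_ac \<delta> * inverse x * y) ^ k)]"
      using x1 y(1)
      by - (rule bexI[of _ x1], rule bexI[of _ y], rule exI[of _ "m div 2"], rule bexI[of _ "m mod 2"])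
  qed
  show ?thesis
    unfolding block F(1,2) ii e.represented_by_blocks_iff i by simp
qed

end
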